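(* Let $0<\alpha<1$, let $\Omega\subset(0,\alpha)$ be a finite set with a probability distribution $\mathbb P=(p_\beta)_{\beta\in\Omega}$, let $\nu=\mathbb P^{\otimes\mathbb N}$ on $\Sigma=\Omega^{\mathbb N}$, and let $\mu$ be the absolutely continuous stationary probability measure of the associated random system of intermittent maps $(T_\beta)_{\beta\in\Omega}$. Let $\varphi\in C^1([0,1])$ with $\mu(\varphi)=0$. Then for every $p>\max\{1,\frac1\alpha-1\}$ there is a constant $C_{\alpha,p,\|\varphi\|_{C^1}}$, depending only on $\alpha$, $p$ and $\|\varphi\|_{C^1}$, such that for every $\epsilon>0$ and every integer $n\ge2$ $$(\nu\otimes\mu)\Big\{(\omega,x):\Big|\sum_{j=1}^n\varphi(\mathcal T^j_\omega x)\Big|\ge n\epsilon\Big\}\le C_{\alpha,p,\|\varphi\|_{C^1}}\,n^{1-\frac1\alpha}(\log n)^{\frac1\alpha}\epsilon^{-2p}.$$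
   Context: For $\beta\in(0,1)$ the intermittent map $T_\beta:[0,1]\to[0,1]$ is $T_\beta(x)=x+2^\beta x^{1+\beta}$ for $0\le x\le 1/2$ and $T_\beta(x)=2x-1$ for $1/2<x\le1$. For $\omega=(\omega_1,\omega_2,\dots)\in\Sigma=\Omega^{\mathbb N}$, $\mathcal T^j_\omega:=T_{\omega_j}\circ\cdots\circ T_{\omega_1}$. A probability measure $\mu$ on $[0,1]$ is stationary if $\mu(A)=\sum_{\beta\in\Omega}p_\beta\,\mu(T_\beta^{-1}A)$ for all Borel $A$; equivalently $\nu\otimes\mu$ is invariant under $F(\omega,x)=(\tau\omega,T_{\omega_1}x)$, where $\tau$ is the left shift on $\Sigma$. It is known that there is a unique stationary probability measure absolutely continuous with respect to Lebesgue measure; $\mu$ denotes this measure, and $\mu(\varphi)=\int\varphi\,d\mu$. *)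

theory Defs
  imports "HOL-Probability.Probability"
begin

definition intermittent_map :: "real \<Rightarrow> real \<Rightarrow> real" where
  "intermittent_map \<beta> x =
     (if x \<le> 1/2 then x + 2 powr \<beta> * x powr (1 + \<beta>) else 2 * x - 1)"

text \<open>Sequences are indexed from 0, so \<open>\<omega> j\<close> plays the role of \<open>\<omega>\<^sub>j\<^sub>+\<^sub>1\<close>, and
  \<open>random_iterate \<omega> j\<close> is the composition of the first \<open>j\<close> maps, the first one applied
  being \<open>intermittent_map (\<omega> 0)\<close>.\<close>

primrec random_iterate :: "(nat \<Rightarrow> real) \<Rightarrow> nat \<Rightarrow> real \<Rightarrow> real" where
  "random_iterate \<omega> 0 x = x"
| "random_iterate \<omega> (Suc j) x = intermittent_map (\<omega> j) (random_iterate \<omega> j x)"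

definition prob_distribution_on :: "real set \<Rightarrow> (real \<Rightarrow> real) \<Rightarrow> bool" where
  "prob_distribution_on \<Omega> P \<longleftrightarrow> (\<forall>\<beta>\<in>\<Omega>. 0 \<le> P \<beta>) \<and> (\<Sum>\<beta>\<in>\<Omega>. P \<beta>) = 1"

text \<open>The underlying space is the set of all sequences in \<open>\<Omega>\<close>, and \<open>\<Omega>\<close> carries its
  discrete sigma-algebra.\<close>

definition bernoulli_measure :: "real set \<Rightarrow> (real \<Rightarrow> real) \<Rightarrow> (nat \<Rightarrow> real) measure" where
  "bernoulli_measure \<Omega> P = PiM UNIV (\<lambda>_. point_measure \<Omega> (\<lambda>\<beta>. ennreal (P \<beta>)))"

definition stationary_measure :: "real set \<Rightarrow> (real \<Rightarrow> real) \<Rightarrow> real measure \<Rightarrow> bool" where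
  "stationary_measure \<Omega> P \<mu> \<longleftrightarrow>
     prob_space \<mu> \<and> sets \<mu> = sets (restrict_space borel {0..1}) \<and>
     (\<forall>A\<in>sets \<mu>. measure \<mu> A =
        (\<Sum>\<beta>\<in>\<Omega>. P \<beta> * measure \<mu> (intermittent_map \<beta> -` A \<inter> {0..1})))"

definition ac_stationary_measure :: "real set \<Rightarrow> (real \<Rightarrow> real) \<Rightarrow> real measure \<Rightarrow> bool" where
  "ac_stationary_measure \<Omega> P \<mu> \<longleftrightarrow>
     stationary_measure \<Omega> P \<mu> \<and> absolutely_continuous (restrict_space lborel {0..1}) \<mu>"

text \<open>Derivatives are taken within \<open>[0,1]\<close>, hence one-sided at the end points; the values of
  a function outside \<open>[0,1]\<close> play no role.\<close>

definition unit_deriv :: "(real \<Rightarrow> real) \<Rightarrow> real \<Rightarrow> real" where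
  "unit_deriv \<phi> x = vector_derivative \<phi> (at x within {0..1})"

definition C1_unit :: "(real \<Rightarrow> real) \<Rightarrow> bool" where
  "C1_unit \<phi> \<longleftrightarrow> \<phi> differentiable_on {0..1} \<and> continuous_on {0..1} (unit_deriv \<phi>)"

definition C1_norm :: "(real \<Rightarrow> real) \<Rightarrow> real" where
  "C1_norm \<phi> = (SUP x\<in>{0..1}. \<bar>\<phi> x\<bar>) + (SUP x\<in>{0..1}. \<bar>unit_deriv \<phi> x\<bar>)"

end

theory Submission
  imports Defs
begin

text \<open>
  Time is reversed: for the annealed transfer operator \<open>Q\<close> and the stationary density \<open>h\<close>, the
  conditional expectation of \<open>\<phi>\<close> given the orbit from time \<open>l\<close> on is \<open>Q\<^sup>l (\<phi> h) / h\<close>, so everything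
  rests on a bound \<open>C l\<^sup>1\<^sup>-\<^sup>1\<^sup>/\<^sup>\<alpha>\<close> for the \<open>L\<^sup>1\<close> norm of \<open>Q\<^sup>l (\<phi> h)\<close> with \<open>C\<close> independent of \<open>\<Omega>\<close>.

  That bound comes from coupling decreasing densities \<open>u \<le> A x\<^sup>-\<^sup>\<alpha>\<close> for which \<open>x\<^sup>K u\<close> increases. If
  \<open>K = 1 + \<alpha>\<close>, such a density is bounded below by a constant; subtracting half of it keeps the density
  in the class with \<open>K = 2 (1 + \<alpha>)\<close>. Flattening the result near the set that needs more than \<open>n\<close> steps
  to leave the left branch costs mass \<open>O(n\<^sup>1\<^sup>-\<^sup>1\<^sup>/\<^sup>\<alpha>)\<close>, and after \<open>n\<close> steps the exponent is back at
  \<open>1 + \<alpha>\<close>, because each passage through the right branch halves it.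

  The moment of order \<open>2 p\<close> of the Birkhoff sums is then bounded by \<open>n\<^sup>2\<^sup>p\<^sup>+\<^sup>1\<^sup>-\<^sup>1\<^sup>/\<^sup>\<alpha>\<close> as in Rio's
  inequality, by expanding \<open>\<bar>S\<bar>\<^sup>2\<^sup>p\<close> one step at a time and telescoping its derivative, and Markov's
  inequality concludes.
\<close>

section \<open>Inverse branches and change of variables\<close>

text \<open>The constant must not see how close \<Omega> comes to 0 or to \<alpha>. Each branch is
  therefore estimated for a single \<beta> < \<alpha>, with exponents in \<alpha> only; the
  conditions obtained are convex, so averaging over P costs nothing. The obstacle is the neutral
  fixed point. Left branches preserve the exponent K but never lower it, so mass that keeps taking
  them does not regain regularity. Flattening removes exactly this part: it leaves a constant near
  0, and the all-left image of a constant has exponent 1 + \<alpha>. The mass given up there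
  produces the rate n^(1 - 1/\<alpha>). A second difficulty is that h comes from the Radon-Nikodym
  theorem, as an L^1 class without any regularity. The iterates of the density 1 obey all bounds at
  every point of (0,1] and stand in for h; the contraction itself, together with density of
  Lipschitz functions, shows that they converge to h. In the moment estimate, p > 1/\<alpha> - 1
  makes b/p < 1 for b = 1/\<alpha> - 1, so that the weights (l + 1)^(-b/p) have sums of order n^(1 -
  b/p).\<close>

lemma powr_le_tangent:
  fixes t s :: real assumes "0 \<le> s" "s \<le> 1" "0 \<le> t"
  shows "t powr s \<le> 1 + s * (t - 1)"
proof (cases "t = 0")
  case False
  with assms have "t powr s * 1 powr (1 - s) \<le> s * t + (1 - s) * 1"
    by (intro Youngs_inequality_0) auto
  then show ?thesis by (simp add: algebra_simps)
qed (use assms in auto)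

text \<open>Bernoulli's inequality for exponents at least 1, deduced from the concave case with
  exponent 1/r at the point t^r.\<close>

lemma powr_ge_tangent:
  fixes t r :: real assumes "1 \<le> r" "0 \<le> t"
  shows "1 + r * (t - 1) \<le> t powr r"
proof -
  have "(t powr r) powr (1/r) \<le> 1 + (1/r) * (t powr r - 1)"
    using assms by (intro powr_le_tangent) auto
  moreover have "(t powr r) powr (1/r) = t" using assms by (simp add: powr_powr)
  ultimately have "t \<le> 1 + (1/r) * (t powr r - 1)" by simp
  then have "r * t \<le> r * (1 + (1/r) * (t powr r - 1))" using assms by (intro mult_left_mono) auto
  also have "\<dots> = r + (t powr r - 1)" using assms by (simp add: algebra_simps)
  finally show ?thesis by (simp add: algebra_simps)
qed

section \<open>The left branch and its inverse\<close>

definition left_inv :: "real \<Rightarrow> real \<Rightarrow> real" where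
  "left_inv \<beta> = the_inv_into {0..1/2} (intermittent_map \<beta>)"

text \<open>Derivative of the left branch, written through (2y)^\<beta> because the branch itself is
  y (1 + (2y)^\<beta>). At y = 0 its value is 1, since \<open>0 powr \<beta>\<close> is 0.\<close>

definition left_slope :: "real \<Rightarrow> real \<Rightarrow> real" where
  "left_slope \<beta> y = 1 + (1 + \<beta>) * (2 * y) powr \<beta>"

lemma intermittent_map_left:
  assumes "0 \<le> y" "y \<le> 1/2"
  shows "intermittent_map \<beta> y = y * (1 + (2 * y) powr \<beta>)"
  using assms by (simp add: intermittent_map_def powr_add powr_mult algebra_simps)

context
  fixes \<beta> :: real assumes \<beta>: "0 < \<beta>" "\<beta> < 1"
begin

lemma intermittent_map_strict_mono: "strict_mono_on {0..1/2} (intermittent_map \<beta>)"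
proof (rule strict_mono_onI)
  fix r s :: real assume rs: "r \<in> {0..1/2}" "s \<in> {0..1/2}" "r < s"
  have "(2 * r) powr \<beta> \<le> (2 * s) powr \<beta>" using rs \<beta> by (intro powr_mono2) auto
  then have "r * (1 + (2 * r) powr \<beta>) < s * (1 + (2 * s) powr \<beta>)"
    using rs by (intro mult_less_le_imp_less) (auto intro: add_pos_nonneg)
  then show "intermittent_map \<beta> r < intermittent_map \<beta> s"
    using rs by (simp add: intermittent_map_left)
qed

lemma intermittent_map_continuous: "continuous_on {0..1/2} (intermittent_map \<beta>)"
proof -
  have "continuous_on {0..1/2} (\<lambda>y. y * (1 + (2 * y) powr \<beta>))"
    using \<beta> by (intro continuous_intros continuous_on_powr') auto
  then show ?thesis
    by (rule continuous_on_eq) (simp add: intermittent_map_left)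
qed

lemma intermittent_map_image: "intermittent_map \<beta> ` {0..1/2} = {0..1}"
proof
  show "intermittent_map \<beta> ` {0..1/2} \<subseteq> {0..1}"
  proof (clarsimp, intro conjI)
    fix y :: real assume y: "0 \<le> y" "y * 2 \<le> 1"
    have "(2 * y) powr \<beta> \<le> 1 powr \<beta>" using y \<beta> by (intro powr_mono2) auto
    then have "y * (1 + (2 * y) powr \<beta>) \<le> (1/2) * 2" using y by (intro mult_mono) auto
    then show "intermittent_map \<beta> y \<le> 1" "0 \<le> intermittent_map \<beta> y" 
      using y by (auto simp: intermittent_map_left)
  qed
  show "{0..1} \<subseteq> intermittent_map \<beta> ` {0..1/2}"
  proof
    fix x :: real assume x: "x \<in> {0..1}"
    have "\<exists>y\<ge>0. y \<le> 1/2 \<and> intermittent_map \<beta> y = x"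
      using x intermittent_map_continuous
      by (intro IVT') (auto simp: intermittent_map_left)
    then show "x \<in> intermittent_map \<beta> ` {0..1/2}" by auto
  qed
qed

lemma intermittent_map_inj: "inj_on (intermittent_map \<beta>) {0..1/2}"
  using intermittent_map_strict_mono by (rule strict_mono_on_imp_inj_on)

lemma intermittent_map_unit:
  assumes "x \<in> {0..1}" shows "intermittent_map \<beta> x \<in> {0..1}"
proof (cases "x \<le> 1/2")
  case True
  then show ?thesis using assms intermittent_map_image by auto
qed (use assms in \<open>auto simp: intermittent_map_def\<close>)

lemma left_inv_map: "x \<in> {0..1} \<Longrightarrow> intermittent_map \<beta> (left_inv \<beta> x) = x"
  unfolding left_inv_def using intermittent_map_inj intermittent_map_image
  by (intro f_the_inv_into_f) auto

lemma map_left_inv: "y \<in> {0..1/2} \<Longrightarrow> left_inv \<beta> (intermittent_map \<beta> y) = y"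
  unfolding left_inv_def using intermittent_map_inj by (intro the_inv_into_f_f)

lemma left_inv_range: "x \<in> {0..1} \<Longrightarrow> left_inv \<beta> x \<in> {0..1/2}"
  unfolding left_inv_def using intermittent_map_inj intermittent_map_image
  by (intro the_inv_into_into) auto

lemma left_inv_eq:
  assumes "x \<in> {0..1}" shows "x = left_inv \<beta> x * (1 + (2 * left_inv \<beta> x) powr \<beta>)"
  using left_inv_map[OF assms] left_inv_range[OF assms] intermittent_map_left by auto

lemma left_inv_pos: "x \<in> {0<..1} \<Longrightarrow> 0 < left_inv \<beta> x"
  using left_inv_eq[of x] left_inv_range[of x] by (cases "left_inv \<beta> x = 0") auto

text \<open>In the coordinate \<xi> = (2y)^\<beta> both the image point and the slope are affine in
  \<xi> for given y, so the branch estimates become one-variable inequalities on (0,1].\<close>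

lemma left_inv_coords:
  assumes "0 < x" "x \<le> 1"
  defines "y \<equiv> left_inv \<beta> x" and "\<xi> \<equiv> (2 * left_inv \<beta> x) powr \<beta>"
  shows "0 < y" "y \<le> 1/2" "0 < \<xi>" "\<xi> \<le> 1" "x = y * (1 + \<xi>)" "left_slope \<beta> y = 1 + (1 + \<beta>) * \<xi>"
proof -
  show y: "0 < y" "y \<le> 1/2" using assms left_inv_pos[of x] left_inv_range[of x] by auto
  then have "\<xi> \<le> 1 powr \<beta>" unfolding \<xi>_def y_def using \<beta> by (intro powr_mono2) auto
  then show "0 < \<xi>" "\<xi> \<le> 1" using y by (auto simp: \<xi>_def y_def)
  show "x = y * (1 + \<xi>)" using left_inv_eq[of x] assms by auto
qed (simp add: left_slope_def \<xi>_def y_def)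

lemma left_inv_mono:
  assumes "x \<in> {0..1}" "x' \<in> {0..1}" "x \<le> x'" shows "left_inv \<beta> x \<le> left_inv \<beta> x'"
proof (rule ccontr)
  assume "\<not> ?thesis"
  then have "intermittent_map \<beta> (left_inv \<beta> x') < intermittent_map \<beta> (left_inv \<beta> x)"
    using left_inv_range assms by (intro strict_mono_onD[OF intermittent_map_strict_mono]) auto
  then show False using assms by (simp add: left_inv_map)
qed

lemma left_inv_continuous: "continuous_on {0..1} (left_inv \<beta>)"
  using continuous_on_inv[OF intermittent_map_continuous, of "left_inv \<beta>"] map_left_inv
  by (simp add: intermittent_map_image)

lemma intermittent_map_deriv:
  assumes "0 < y" "y < 1/2"
  shows "(intermittent_map \<beta> has_real_derivative left_slope \<beta> y) (at y)"
proof -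
  have "((\<lambda>y. y + 2 powr \<beta> * y powr (1 + \<beta>)) has_real_derivative
      1 + 2 powr \<beta> * ((1 + \<beta>) * y powr (1 + \<beta> - 1))) (at y)"
    using assms by (auto intro!: derivative_eq_intros)
  moreover have "1 + 2 powr \<beta> * ((1 + \<beta>) * y powr (1 + \<beta> - 1)) = left_slope \<beta> y"
    using assms by (simp add: left_slope_def powr_mult algebra_simps)
  ultimately have "((\<lambda>y. y + 2 powr \<beta> * y powr (1 + \<beta>)) has_real_derivative left_slope \<beta> y) (at y)"
    by simp
  moreover have "eventually (\<lambda>z. z \<in> {..<1/2}) (nhds y)"
    using assms by (intro eventually_nhds_in_open) auto
  then have "eventually (\<lambda>y. intermittent_map \<beta> y = y + 2 powr \<beta> * y powr (1 + \<beta>)) (nhds y)"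
    by eventually_elim (auto simp: intermittent_map_def)
  ultimately show ?thesis
    by (subst DERIV_cong_ev[OF refl _ refl]) auto
qed

lemma left_slope_ge1: "1 \<le> left_slope \<beta> y"
  using \<beta> by (simp add: left_slope_def)

lemma left_inv_interior:
  assumes "0 < x" "x < 1" shows "0 < left_inv \<beta> x" "left_inv \<beta> x < 1/2"
proof -
  show "0 < left_inv \<beta> x" using assms left_inv_pos by auto
  have "left_inv \<beta> x \<noteq> 1/2"
  proof
    assume "left_inv \<beta> x = 1/2"
    then have "2 * left_inv \<beta> x = 1" by simp
    then show False using assms left_inv_eq[of x] by (metis add_cancel_right_right atLeastAtMost_iff less_eq_real_def mult.commute one_add_one powr_one_eq_one less_irrefl)
  qed
  then show "left_inv \<beta> x < 1/2" using left_inv_range[of x] assms by auto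
qed

lemma left_inv_deriv:
  assumes "0 < x" "x < 1"
  shows "(left_inv \<beta> has_real_derivative 1 / left_slope \<beta> (left_inv \<beta> x)) (at x)"
proof -
  have "(left_inv \<beta> has_real_derivative inverse (left_slope \<beta> (left_inv \<beta> x))) (at x)"
  proof (rule DERIV_inverse_function[where f = "intermittent_map \<beta>" and a = 0 and b = 1])
    show "(intermittent_map \<beta> has_real_derivative left_slope \<beta> (left_inv \<beta> x)) (at (left_inv \<beta> x))"
      using left_inv_interior[OF assms] by (intro intermittent_map_deriv)
    show "left_slope \<beta> (left_inv \<beta> x) \<noteq> 0" using left_slope_ge1[of "left_inv \<beta> x"] by auto
    show "isCont (left_inv \<beta>) x"
      using left_inv_continuous assms by (intro continuous_on_interior) auto
  qed (use assms left_inv_map in auto)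
  then show ?thesis by (simp add: inverse_eq_divide)
qed

lemma left_inv_image: "left_inv \<beta> ` {0<..<1} = {0<..<1/2}"
proof
  show "left_inv \<beta> ` {0<..<1} \<subseteq> {0<..<1/2}" using left_inv_interior by auto
  show "{0<..<1/2} \<subseteq> left_inv \<beta> ` {0<..<1}"
  proof
    fix y :: real assume y: "y \<in> {0<..<1/2}"
    have "intermittent_map \<beta> 0 < intermittent_map \<beta> y" "intermittent_map \<beta> y < intermittent_map \<beta> (1/2)"
      using y by (auto intro!: strict_mono_onD[OF intermittent_map_strict_mono])
    then show "y \<in> left_inv \<beta> ` {0<..<1}"
      using y map_left_inv[of y] by (intro image_eqI[of _ _ "intermittent_map \<beta> y"]) (auto simp: intermittent_map_left)
  qed
qed

lemma left_inv_inj: "inj_on (left_inv \<beta>) {0<..<1}"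
  by (rule inj_on_inverseI[where g = "intermittent_map \<beta>"]) (auto simp: left_inv_map)

end

section \<open>Lebesgue measure on the unit interval and substitution along an inverse
  branch\<close>

abbreviation lam :: "real measure" where "lam \<equiv> restrict_space lborel {0..1}"

lemma prob_space_lam: "prob_space lam"
  by (rule prob_space_restrict_space) auto

lemma integrable_lam_iff:
  "integrable lam f \<longleftrightarrow> set_integrable lborel {0..1} (f :: real \<Rightarrow> real)"
  by (simp add: integrable_restrict_space set_integrable_def)

lemma integral_lam:
  "integral\<^sup>L lam f = (LINT x:{0..1}|lborel. (f x :: real))"
  by (simp add: integral_restrict_space set_lebesgue_integral_def)

text \<open>Substitution is available for absolute integrability with respect to the completed
  measure, so f passes to \<open>lebesgue\<close> and the result returns; the measurability
  hypothesis on the transformed integrand permits the return. Open intervals avoid the end points,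
  where \<sigma> need not be differentiable, and differ from the closed ones by null sets.\<close>

lemma branch_integral:
  fixes f \<sigma> \<sigma>' :: "real \<Rightarrow> real"
  assumes deriv: "\<And>x. 0 < x \<Longrightarrow> x < 1 \<Longrightarrow> (\<sigma> has_real_derivative \<sigma>' x) (at x)"
    and pos: "\<And>x. 0 < x \<Longrightarrow> x < 1 \<Longrightarrow> 0 \<le> \<sigma>' x"
    and inj: "inj_on \<sigma> {0<..<1}" and im: "\<sigma> ` {0<..<1} = {a<..<b}"
    and sub: "{a<..<b} \<subseteq> {0..1}"
    and f: "integrable lam f"
    and meas: "(\<lambda>x. \<sigma>' x * f (\<sigma> x)) \<in> borel_measurable lam"
  shows "integrable lam (\<lambda>x. \<sigma>' x * f (\<sigma> x))"
    and "(LINT x|lam. \<sigma>' x * f (\<sigma> x)) = (LINT x|lam. indicator {a<..<b} x * f x)"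
proof -
  let ?g = "\<lambda>x. \<sigma>' x * f (\<sigma> x)"
  have f1: "set_integrable lborel {a<..<b} f"
    by (rule set_integrable_subset[OF f[unfolded integrable_lam_iff] _ sub]) simp
  then have f2: "f absolutely_integrable_on {a<..<b}"
    unfolding set_integrable_def
    by (subst integrable_completion) (auto dest: borel_measurable_integrable)
  have "(\<lambda>x. \<bar>\<sigma>' x\<bar> * f (\<sigma> x)) absolutely_integrable_on {0<..<1} \<and>
      integral {0<..<1} (\<lambda>x. \<bar>\<sigma>' x\<bar> * f (\<sigma> x)) = integral {a<..<b} f"
    using f2 deriv inj im
    by (intro has_absolute_integral_change_of_variables_1'[THEN iffD2])
       (auto intro: has_field_derivative_at_within)
  then have *: "(\<lambda>x. \<bar>\<sigma>' x\<bar> * f (\<sigma> x)) absolutely_integrable_on {0<..<1}"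
     "integral {0<..<1} (\<lambda>x. \<bar>\<sigma>' x\<bar> * f (\<sigma> x)) = integral {a<..<b} f" by auto
  have g: "?g absolutely_integrable_on {0<..<1}" "integral {0<..<1} ?g = integral {a<..<b} f"
  proof -
    show "?g absolutely_integrable_on {0<..<1}"
      using pos by (intro set_integrable_cong[THEN iffD1, OF refl refl _ *(1)]) auto
    have "integral {0<..<1} ?g = integral {0<..<1} (\<lambda>x. \<bar>\<sigma>' x\<bar> * f (\<sigma> x))"
      using pos by (intro Henstock_Kurzweil_Integration.integral_cong) auto
    with *(2) show "integral {0<..<1} ?g = integral {a<..<b} f" by simp
  qed
  have m1: "set_borel_measurable lborel {0..1} ?g"
    using meas by (simp add: set_borel_measurable_def borel_measurable_restrict_space_iff mult.commute)
  have m2: "set_borel_measurable lborel {0<..<1} ?g"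
    by (rule set_borel_measurable_subset[OF m1]) auto
  have g2: "set_integrable lborel {0<..<1} ?g"
    using g(1) m2 unfolding set_integrable_def set_borel_measurable_def
    by (subst (asm) integrable_completion) auto
  have AEs: "AE x in lborel. x \<notin> {0, 1::real}"
    using AE_lborel_singleton[of 0] AE_lborel_singleton[of 1] by eventually_elim auto
  have ae: "AE x in lborel. indicator {0..1} x *\<^sub>R ?g x = indicator {0<..<1} x *\<^sub>R ?g x"
    using AEs by eventually_elim (auto simp: indicator_def)
  have mm: "(\<lambda>x. indicator {0..1} x *\<^sub>R ?g x) \<in> borel_measurable lborel"
    "(\<lambda>x. indicator {0<..<1} x *\<^sub>R ?g x) \<in> borel_measurable lborel"
    using m1 m2 by (simp_all add: set_borel_measurable_def)
  show "integrable lam ?g"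
    using g2 integrable_cong_AE[OF mm ae] by (simp add: integrable_lam_iff set_integrable_def)
  have "integral\<^sup>L lam ?g = (LINT x:{0<..<1}|lborel. ?g x)"
    unfolding integral_lam set_lebesgue_integral_def using integral_cong_AE[OF mm ae] by simp
  also have "\<dots> = integral {0<..<1} ?g"
    using g2 by (rule set_borel_integral_eq_integral)
  also have "\<dots> = (LINT x:{a<..<b}|lborel. f x)"
    using g(2) set_borel_integral_eq_integral(2)[OF f1] by simp
  also have "\<dots> = (LINT x|lam. indicator {a<..<b} x * f x)"
    unfolding integral_lam set_lebesgue_integral_def using sub
    by (intro Bochner_Integration.integral_cong) (auto simp: indicator_def)
  finally show "integral\<^sup>L lam ?g = (LINT x|lam. indicator {a<..<b} x * f x)" .
qed

section \<open>The annealed transfer operator\<close>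

lemma sets_lam [measurable_cong]: "sets lam = sets (restrict_space borel {0..1})"
  by (simp add: sets_restrict_space)

lemma space_lam [simp]: "space lam = {0..1}"
  by (simp add: space_restrict_space)

lemma lam_borelI: "f \<in> borel_measurable borel \<Longrightarrow> f \<in> borel_measurable lam"
  by (intro measurable_restrict_space1) simp

lemma measurable_to_lam:
  assumes "f \<in> borel_measurable lam" "\<And>x. x \<in> {0..1} \<Longrightarrow> f x \<in> {0..1::real}"
  shows "f \<in> measurable lam lam"
  using assms by (intro measurable_restrict_space2) auto

lemma integrable_lam_mult_bounded:
  assumes "integrable lam u" "v \<in> borel_measurable lam" "\<And>x. x \<in> {0..1} \<Longrightarrow> \<bar>v x\<bar> \<le> (B::real)"
  shows "integrable lam (\<lambda>x. u x * v x)"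
proof (rule Bochner_Integration.integrable_bound)
  show "integrable lam (\<lambda>x. B * u x)" using assms(1) by simp
  show "(\<lambda>x. u x * v x) \<in> borel_measurable lam" using assms by measurable
  show "AE x in lam. norm (u x * v x) \<le> norm (B * u x)"
  proof (rule AE_I2)
    fix x :: real assume "x \<in> space lam"
    then have "\<bar>v x\<bar> \<le> \<bar>B\<bar>" using assms(3)[of x] by simp
    then have "\<bar>u x\<bar> * \<bar>v x\<bar> \<le> \<bar>u x\<bar> * \<bar>B\<bar>" by (rule mult_left_mono) simp
    then show "norm (u x * v x) \<le> norm (B * u x)"
      by (simp only: real_norm_def abs_mult mult.commute[of "\<bar>B\<bar>"])
  qed
qed

lemma integrable_lam_bounded:
  assumes "v \<in> borel_measurable lam" "\<And>x. x \<in> {0..1} \<Longrightarrow> \<bar>v x\<bar> \<le> (B::real)"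
  shows "integrable lam v"
proof -
  interpret prob_space lam by (rule prob_space_lam)
  have "integrable lam (\<lambda>x. 1 * v x)" by (rule integrable_lam_mult_bounded[OF _ assms]) auto
  then show ?thesis by simp
qed

text \<open>The point 0 is excluded because bounds by \<open>x powr - \<alpha>\<close> are useless
  there: \<open>0 powr - \<alpha>\<close> is 0.\<close>

lemma integral_lam_mono:
  assumes "integrable lam f" "integrable lam g" "\<And>x. 0 < x \<Longrightarrow> x \<le> 1 \<Longrightarrow> f x \<le> (g x :: real)"
  shows "integral\<^sup>L lam f \<le> integral\<^sup>L lam g"
proof (rule integral_mono_AE[OF assms(1,2)])
  have "AE x in lborel. x \<noteq> (0::real)" by (rule AE_lborel_singleton)
  then have "AE x in lam. x \<noteq> 0" by (subst AE_restrict_space_iff) auto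
  then show "AE x in lam. f x \<le> g x"
    using AE_space by eventually_elim (use assms(3) in auto)
qed

lemma integral_lam_cong:
  assumes "\<And>x. x \<in> {0..1} \<Longrightarrow> f x = (g x :: real)"
  shows "integral\<^sup>L lam f = integral\<^sup>L lam g"
  by (rule Bochner_Integration.integral_cong) (use assms in auto)

lemma measurable_intermittent_map [measurable]: "intermittent_map \<beta> \<in> borel_measurable borel"
  unfolding intermittent_map_def[abs_def] by measurable

context
  fixes \<beta> :: real assumes \<beta>: "0 < \<beta>" "\<beta> < 1"
begin

lemma intermittent_map_lam: "intermittent_map \<beta> \<in> measurable lam lam"
  using intermittent_map_unit[OF \<beta>] by (intro measurable_to_lam lam_borelI) auto

lemma left_inv_lam: "left_inv \<beta> \<in> measurable lam lam"
proof (rule measurable_to_lam)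
  show "left_inv \<beta> \<in> borel_measurable lam"
    using borel_measurable_continuous_on_restrict[OF left_inv_continuous[OF \<beta>]]
    by (simp cong: measurable_cong_sets add: sets_lam)
qed (use left_inv_range[OF \<beta>] in fastforce)

lemma left_slope_lam: "left_slope \<beta> \<in> borel_measurable lam"
  unfolding left_slope_def[abs_def] by (intro lam_borelI) measurable

text \<open>Substituting \<open>left_inv\<close> turns composition with the left branch into
  division by the slope. Bounded test functions suffice: constants give conservation of mass,
  indicators identify functions almost everywhere.\<close>

lemma left_branch_integral:
  fixes u v :: "real \<Rightarrow> real"
  assumes u: "integrable lam u" and v: "v \<in> borel_measurable lam" "\<And>x. x \<in> {0..1} \<Longrightarrow> \<bar>v x\<bar> \<le> B"
  shows "integrable lam (\<lambda>x. u (left_inv \<beta> x) / left_slope \<beta> (left_inv \<beta> x) * v x)" (is ?A)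
    and "(LINT x|lam. u (left_inv \<beta> x) / left_slope \<beta> (left_inv \<beta> x) * v x) =
      (LINT x|lam. indicator {0<..<1/2} x * (u x * v (intermittent_map \<beta> x)))" (is ?B)
proof -
  note [measurable] = left_inv_lam left_slope_lam intermittent_map_lam v(1)
  have um [measurable]: "u \<in> borel_measurable lam" using u by simp
  let ?f = "\<lambda>x. u x * v (intermittent_map \<beta> x)"
  let ?s = "\<lambda>x. 1 / left_slope \<beta> (left_inv \<beta> x)"
  have f: "integrable lam ?f"
    using v intermittent_map_unit[OF \<beta>] by (intro integrable_lam_mult_bounded[OF u, of _ B]) auto
  have eq: "?s x * ?f (left_inv \<beta> x) = u (left_inv \<beta> x) / left_slope \<beta> (left_inv \<beta> x) * v x"
    if "x \<in> {0..1}" for x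
    using left_inv_map[OF \<beta> that] by simp
  have m: "(\<lambda>x. ?s x * ?f (left_inv \<beta> x)) \<in> borel_measurable lam" by measurable
  have pos: "0 \<le> ?s x" for x using left_slope_ge1[OF \<beta>, of "left_inv \<beta> x"] by simp
  have sub: "{0<..<1/2} \<subseteq> {0..1::real}" by auto
  have bi: "integrable lam (\<lambda>x. ?s x * ?f (left_inv \<beta> x))"
    "(LINT x|lam. ?s x * ?f (left_inv \<beta> x)) = (LINT x|lam. indicator {0<..<1/2} x * ?f x)"
    using branch_integral[of "left_inv \<beta>" ?s 0 "1/2", OF left_inv_deriv[OF \<beta>] pos left_inv_inj[OF \<beta>] left_inv_image[OF \<beta>] sub f m]
    by simp_all
  show ?A
    using bi(1) by (subst (asm) Bochner_Integration.integrable_cong[OF refl eq]) auto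
  show ?B
    using bi(2) by (subst integral_lam_cong[OF eq[symmetric]]) auto
qed

end

text \<open>The right branch is common to all \<beta>, so its operator carries no average over
  \<Omega>.\<close>

definition right_op :: "(real \<Rightarrow> real) \<Rightarrow> real \<Rightarrow> real" where
  "right_op u x = u ((1 + x) / 2) / 2"

lemma right_branch_integral:
  fixes u v :: "real \<Rightarrow> real"
  assumes u: "integrable lam u" and v: "v \<in> borel_measurable lam" "\<And>x. x \<in> {0..1} \<Longrightarrow> \<bar>v x\<bar> \<le> B"
  shows "integrable lam (\<lambda>x. right_op u x * v x)" (is ?A)
    and "(LINT x|lam. right_op u x * v x) =
      (LINT x|lam. indicator {1/2<..<1} x * (u x * v (intermittent_map \<beta> x)))" (is ?B)
proof -
  have [measurable]: "(\<lambda>x. (1 + x) / 2) \<in> measurable lam lam"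
    by (intro measurable_to_lam lam_borelI) auto
  \<comment> \<open>Cutting off at 0 makes the right branch a map of [0,1] into itself without
    changing it on [1/2,1], so that v is evaluated inside [0,1] only.\<close>
  have [measurable]: "(\<lambda>x. max 0 (2 * x - 1)) \<in> measurable lam lam"
    by (intro measurable_to_lam lam_borelI) auto
  note [measurable] = v(1)
  have um [measurable]: "u \<in> borel_measurable lam" using u by simp
  let ?f = "\<lambda>x. u x * v (max 0 (2 * x - 1))"
  let ?\<sigma> = "\<lambda>x::real. (1 + x) / 2"
  have f: "integrable lam ?f"
    using v by (intro integrable_lam_mult_bounded[OF u, of _ B]) auto
  have m: "(\<lambda>x. (1/2) * ?f (?\<sigma> x)) \<in> borel_measurable lam" by measurable
  have eq: "(1/2) * ?f (?\<sigma> x) = right_op u x * v x" if "x \<in> {0..1}" for x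
    using that by (auto simp: right_op_def field_simps max_def)
  have d: "(?\<sigma> has_real_derivative 1/2) (at x)" for x
    by (auto intro!: derivative_eq_intros)
  have inj: "inj_on ?\<sigma> {0<..<1}" by (simp add: inj_on_def)
  have sub: "{1/2<..<1} \<subseteq> {0..1::real}" by auto
  have im: "?\<sigma> ` {0<..<1} = {1/2<..<1}"
  proof (intro equalityI subsetI)
    fix y :: real assume "y \<in> {1/2<..<1}"
    then show "y \<in> ?\<sigma> ` {0<..<1}" by (intro image_eqI[of _ _ "2 * y - 1"]) auto
  next
    fix y :: real assume "y \<in> ?\<sigma> ` {0<..<1}"
    then obtain x where "y = (1 + x) / 2" "0 < x" "x < 1" by auto
    then show "y \<in> {1/2<..<1}" by simp
  qed
  have bi: "integrable lam (\<lambda>x. (1/2) * ?f (?\<sigma> x))"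
    "(LINT x|lam. (1/2) * ?f (?\<sigma> x)) = (LINT x|lam. indicator {1/2<..<1} x * ?f x)"
    using branch_integral[of ?\<sigma> "\<lambda>_. 1/2" "1/2" 1, OF d _ inj im sub f m] by simp_all
  show ?A
    using bi(1) by (subst (asm) Bochner_Integration.integrable_cong[OF refl eq]) auto
  have "(LINT x|lam. right_op u x * v x) = (LINT x|lam. (1/2) * ?f (?\<sigma> x))"
    by (rule integral_lam_cong) (simp only: eq)
  also note bi(2)
  also have "(LINT x|lam. indicator {1/2<..<1} x * ?f x) =
      (LINT x|lam. indicator {1/2<..<1} x * (u x * v (intermittent_map \<beta> x)))"
    by (rule integral_lam_cong) (auto simp: indicator_def intermittent_map_def)
  finally show ?B .
qed

text \<open>LSV stands for Liverani-Saussol-Vaienti. The stationary measure stays outside: the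
  contraction concerns \<open>transfer\<close> alone, and uniformity is expressed by quantifying
  over all instances with the same \<alpha>.\<close>

locale random_lsv =
  fixes \<alpha> :: real and \<Omega> :: "real set" and P :: "real \<Rightarrow> real"
  assumes \<alpha>: "0 < \<alpha>" "\<alpha> < 1" and finite_\<Omega>: "finite \<Omega>" and \<Omega>_sub: "\<Omega> \<subseteq> {0<..<\<alpha>}"
    and prob: "prob_distribution_on \<Omega> P"
begin

lemma \<Omega>D: "\<beta> \<in> \<Omega> \<Longrightarrow> 0 < \<beta>" "\<beta> \<in> \<Omega> \<Longrightarrow> \<beta> < \<alpha>" "\<beta> \<in> \<Omega> \<Longrightarrow> \<beta> < 1"
  using \<Omega>_sub \<alpha> by auto

lemma P_nonneg: "\<beta> \<in> \<Omega> \<Longrightarrow> 0 \<le> P \<beta>" and P_sum: "(\<Sum>\<beta>\<in>\<Omega>. P \<beta>) = 1"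
  using prob by (auto simp: prob_distribution_on_def)

lemma P_average_le: "(\<And>\<beta>. \<beta> \<in> \<Omega> \<Longrightarrow> f \<beta> \<le> c) \<Longrightarrow> (\<Sum>\<beta>\<in>\<Omega>. P \<beta> * f \<beta>) \<le> c"
proof -
  assume "\<And>\<beta>. \<beta> \<in> \<Omega> \<Longrightarrow> f \<beta> \<le> c"
  then have "(\<Sum>\<beta>\<in>\<Omega>. P \<beta> * f \<beta>) \<le> (\<Sum>\<beta>\<in>\<Omega>. P \<beta> * c)"
    by (intro sum_mono mult_left_mono P_nonneg)
  also have "\<dots> = c" by (simp flip: sum_distrib_right add: P_sum)
  finally show ?thesis .
qed

definition left_op :: "(real \<Rightarrow> real) \<Rightarrow> real \<Rightarrow> real" where
  "left_op u x = (\<Sum>\<beta>\<in>\<Omega>. P \<beta> * (u (left_inv \<beta> x) / left_slope \<beta> (left_inv \<beta> x)))"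

definition transfer :: "(real \<Rightarrow> real) \<Rightarrow> real \<Rightarrow> real" where
  "transfer u x = left_op u x + right_op u x"

text \<open>The right branch is moved inside the average because the weights sum to 1; for each
  \<beta> the domains (0,1/2) and (1/2,1) then fill [0,1] up to three points.\<close>

lemma transfer_dual:
  assumes u: "integrable lam u" and v: "v \<in> borel_measurable lam" "\<And>x. x \<in> {0..1} \<Longrightarrow> \<bar>v x\<bar> \<le> B"
  shows "integrable lam (\<lambda>x. transfer u x * v x)"
    and "(LINT x|lam. transfer u x * v x) =
      (\<Sum>\<beta>\<in>\<Omega>. P \<beta> * (LINT x|lam. u x * v (intermittent_map \<beta> x)))"
proof -
  let ?l = "\<lambda>\<beta> x. u (left_inv \<beta> x) / left_slope \<beta> (left_inv \<beta> x) * v x"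
  have *: "transfer u x * v x = (\<Sum>\<beta>\<in>\<Omega>. P \<beta> * (?l \<beta> x)) + right_op u x * v x" for x
    by (simp add: transfer_def left_op_def distrib_right sum_distrib_right mult.assoc)
  have l: "integrable lam (?l \<beta>)" if "\<beta> \<in> \<Omega>" for \<beta>
    using left_branch_integral(1)[OF \<Omega>D(1,3)[OF that] u v] .
  have r: "integrable lam (\<lambda>x. right_op u x * v x)"
    by (rule right_branch_integral(1)[OF u v])
  show "integrable lam (\<lambda>x. transfer u x * v x)"
    unfolding * using l r by (intro Bochner_Integration.integrable_add Bochner_Integration.integrable_sum integrable_mult_right) auto
  have "(LINT x|lam. transfer u x * v x) =
     (\<Sum>\<beta>\<in>\<Omega>. P \<beta> * (LINT x|lam. ?l \<beta> x)) + (LINT x|lam. right_op u x * v x)"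
    unfolding * using l r
    by (subst Bochner_Integration.integral_add)
       (auto simp: Bochner_Integration.integral_sum simp del: times_divide_eq_left times_divide_eq_right
         intro!: Bochner_Integration.integrable_sum integrable_mult_right)
  also have "\<dots> = (\<Sum>\<beta>\<in>\<Omega>. P \<beta> * ((LINT x|lam. ?l \<beta> x) + (LINT x|lam. right_op u x * v x)))"
    by (simp add: distrib_left sum.distrib P_sum flip: sum_distrib_right)
  also have "\<dots> = (\<Sum>\<beta>\<in>\<Omega>. P \<beta> * (LINT x|lam. u x * v (intermittent_map \<beta> x)))"
  proof (rule sum.cong[OF refl])
    fix \<beta> assume \<beta>: "\<beta> \<in> \<Omega>"
    note [measurable] = intermittent_map_lam[OF \<Omega>D(1,3)[OF \<beta>]]
    have f: "integrable lam (\<lambda>x. u x * v (intermittent_map \<beta> x))"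
      using v intermittent_map_unit[OF \<Omega>D(1,3)[OF \<beta>]] by (intro integrable_lam_mult_bounded[OF u, of _ B]) auto
    have i: "integrable lam (\<lambda>x. indicator A x * (u x * v (intermittent_map \<beta> x)))" if "A \<in> sets borel" for A
    proof -
      have "(indicator A :: real \<Rightarrow> real) \<in> borel_measurable lam" using that by (intro lam_borelI) auto
      from integrable_lam_mult_bounded[OF f this, of 1] show ?thesis
        by (simp add: mult.commute indicator_def)
    qed
    have "(LINT x|lam. ?l \<beta> x) + (LINT x|lam. right_op u x * v x) =
       (LINT x|lam. indicator {0<..<1/2} x * (u x * v (intermittent_map \<beta> x))
          + indicator {1/2<..<1} x * (u x * v (intermittent_map \<beta> x)))"
      using left_branch_integral(2)[OF \<Omega>D(1,3)[OF \<beta>] u v] right_branch_integral(2)[OF u v, of \<beta>] i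
      by simp
    also have "\<dots> = (LINT x|lam. u x * v (intermittent_map \<beta> x))"
    proof (rule integral_cong_AE)
      have "AE x in lborel. x \<notin> {0, 1/2, 1::real}"
        using AE_lborel_singleton[of 0] AE_lborel_singleton[of 1] AE_lborel_singleton[of "1/2"] by eventually_elim auto
      then have "AE x in lam. x \<notin> {0, 1/2, 1::real}" by (subst AE_restrict_space_iff) auto
      then show "AE x in lam. indicator {0<..<1/2} x * (u x * v (intermittent_map \<beta> x))
          + indicator {1/2<..<1} x * (u x * v (intermittent_map \<beta> x)) = u x * v (intermittent_map \<beta> x)"
        using AE_space by eventually_elim (auto simp: indicator_def)
      show "(\<lambda>x. indicator {0<..<1/2} x * (u x * v (intermittent_map \<beta> x))
          + indicator {1/2<..<1} x * (u x * v (intermittent_map \<beta> x))) \<in> borel_measurable lam"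
        by (intro borel_measurable_add borel_measurable_integrable i) simp_all
    qed (rule borel_measurable_integrable[OF f])
    finally show "P \<beta> * ((LINT x|lam. ?l \<beta> x) + (LINT x|lam. right_op u x * v x)) =
      P \<beta> * (LINT x|lam. u x * v (intermittent_map \<beta> x))" by simp
  qed
  finally show "(LINT x|lam. transfer u x * v x) =
      (\<Sum>\<beta>\<in>\<Omega>. P \<beta> * (LINT x|lam. u x * v (intermittent_map \<beta> x)))" .
qed

lemma transfer_integrable: "integrable lam u \<Longrightarrow> integrable lam (transfer u)"
  using transfer_dual(1)[of u "\<lambda>_. 1" 1] by simp

lemma transfer_integral: "integrable lam u \<Longrightarrow> integral\<^sup>L lam (transfer u) = integral\<^sup>L lam u"
  using transfer_dual(2)[of u "\<lambda>_. 1" 1] by (simp add: P_sum flip: sum_distrib_right)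

lemma transfer_pow_integrable: "integrable lam u \<Longrightarrow> integrable lam ((transfer ^^ n) u)"
  by (induction n) (auto simp: transfer_integrable)

lemma transfer_pow_integral: "integrable lam u \<Longrightarrow> integral\<^sup>L lam ((transfer ^^ n) u) = integral\<^sup>L lam u"
  by (induction n) (auto simp: transfer_integral transfer_pow_integrable)

lemma left_op_mono:
  assumes "\<And>\<beta>. \<beta> \<in> \<Omega> \<Longrightarrow> u (left_inv \<beta> x) \<le> v (left_inv \<beta> x)"
  shows "left_op u x \<le> left_op v x"
  unfolding left_op_def
proof (intro sum_mono mult_left_mono P_nonneg divide_right_mono assms)
  fix \<beta> assume "\<beta> \<in> \<Omega>"
  then show "0 \<le> left_slope \<beta> (left_inv \<beta> x)" 
    using left_slope_ge1[OF \<Omega>D(1,3), of \<beta> "left_inv \<beta> x"] by linarith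
qed

lemma left_op_linear:
  "left_op (\<lambda>x. a * u x + b * v x) x = a * left_op u x + b * left_op v x"
  unfolding left_op_def sum_distrib_left sum.distrib[symmetric]
  by (rule sum.cong[OF refl]) (simp add: add_divide_distrib distrib_left mult.left_commute)

lemma transfer_linear:
  "transfer (\<lambda>x. a * u x + b * v x) x = a * transfer u x + b * transfer v x"
  by (simp add: transfer_def left_op_linear right_op_def distrib_left add_divide_distrib)

lemma transfer_pow_linear:
  "(transfer ^^ n) (\<lambda>x. a * u x + b * v x) x = a * (transfer ^^ n) u x + b * (transfer ^^ n) v x"
proof (induction n arbitrary: x)
  case (Suc n)
  then have "(transfer ^^ n) (\<lambda>x. a * u x + b * v x) = (\<lambda>x. a * (transfer ^^ n) u x + b * (transfer ^^ n) v x)"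
    by auto
  then show ?case by (simp add: transfer_linear)
qed simp

lemma transfer_mono:
  assumes "\<And>x. x \<in> {0..1} \<Longrightarrow> u x \<le> v x" "x \<in> {0..1}"
  shows "transfer u x \<le> transfer v x"
proof -
  have "left_inv \<beta> x \<in> {0..1}" if "\<beta> \<in> \<Omega>" for \<beta>
    using left_inv_range[OF \<Omega>D(1,3)[OF that] assms(2)] by auto
  then show ?thesis unfolding transfer_def right_op_def
    using assms by (intro add_mono left_op_mono divide_right_mono) auto
qed

lemma transfer_pow_mono:
  assumes "\<And>x. x \<in> {0..1} \<Longrightarrow> u x \<le> v x" "x \<in> {0..1}"
  shows "(transfer ^^ n) u x \<le> (transfer ^^ n) v x"
  using assms(2) by (induction n arbitrary: x) (auto intro: assms(1) transfer_mono)

lemma transfer_pow_abs: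
  assumes "x \<in> {0..1}"
  shows "\<bar>(transfer ^^ n) u x\<bar> \<le> (transfer ^^ n) (\<lambda>x. \<bar>u x\<bar>) x"
proof -
  have "(transfer ^^ n) (\<lambda>x. (-1) * u x + 0 * u x) x = - (transfer ^^ n) u x"
    unfolding transfer_pow_linear by simp
  then have "- (transfer ^^ n) u x \<le> (transfer ^^ n) (\<lambda>x. \<bar>u x\<bar>) x"
    using transfer_pow_mono[of "\<lambda>x. (-1) * u x + 0 * u x" "\<lambda>x. \<bar>u x\<bar>" x n] assms by simp
  moreover have "(transfer ^^ n) u x \<le> (transfer ^^ n) (\<lambda>x. \<bar>u x\<bar>) x"
    by (rule transfer_pow_mono) (use assms in auto)
  ultimately show ?thesis by linarith
qed

text \<open>Positivity bounds the absolute value of the image by the image of the absolute value,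
  and mass is conserved.\<close>

lemma transfer_pow_contract:
  assumes "integrable lam u"
  shows "(LINT x|lam. \<bar>(transfer ^^ n) u x\<bar>) \<le> (LINT x|lam. \<bar>u x\<bar>)"
proof -
  have "(LINT x|lam. \<bar>(transfer ^^ n) u x\<bar>) \<le> (LINT x|lam. (transfer ^^ n) (\<lambda>x. \<bar>u x\<bar>) x)"
    using assms by (intro integral_lam_mono) (auto intro!: transfer_pow_abs transfer_pow_integrable)
  also have "\<dots> = (LINT x|lam. \<bar>u x\<bar>)" using assms by (intro transfer_pow_integral) auto
  finally show ?thesis .
qed

end

section \<open>Densities controlled by powers\<close>

text \<open>For differentiable u this means u \<ge> 0 and - K u / x \<le> u' \<le> 0. The integrated
  form needs no derivative, so it survives flattening, and it is convex, so it survives averaging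
  over branches.\<close>

definition regular :: "real \<Rightarrow> (real \<Rightarrow> real) \<Rightarrow> bool" where
  "regular K u \<longleftrightarrow> (\<forall>x\<in>{0<..1}. 0 \<le> u x) \<and>
     (\<forall>x\<in>{0<..1}. \<forall>y\<in>{0<..1}. x \<le> y \<longrightarrow> u y \<le> u x \<and> x powr K * u x \<le> y powr K * u y)"

lemma regularD:
  assumes "regular K u"
  shows "0 < x \<Longrightarrow> x \<le> 1 \<Longrightarrow> 0 \<le> u x"
    and "0 < x \<Longrightarrow> x \<le> y \<Longrightarrow> y \<le> 1 \<Longrightarrow> u y \<le> u x"
    and "0 < x \<Longrightarrow> x \<le> y \<Longrightarrow> y \<le> 1 \<Longrightarrow> x powr K * u x \<le> y powr K * u y"
  using assms by (auto simp: regular_def)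

lemma regularI:
  assumes "\<And>x. 0 < x \<Longrightarrow> x \<le> 1 \<Longrightarrow> 0 \<le> u x"
    and "\<And>x y. 0 < x \<Longrightarrow> x \<le> y \<Longrightarrow> y \<le> 1 \<Longrightarrow> u y \<le> u x"
    and "\<And>x y. 0 < x \<Longrightarrow> x \<le> y \<Longrightarrow> y \<le> 1 \<Longrightarrow> x powr K * u x \<le> y powr K * u y"
  shows "regular K u"
  using assms by (auto simp: regular_def)

lemma regular_weaken:
  assumes "regular K u" "K \<le> K'" shows "regular K' u"
proof (rule regularI)
  fix x y :: real assume xy: "0 < x" "x \<le> y" "y \<le> 1"
  have "x powr (K' - K) * (x powr K * u x) \<le> y powr (K' - K) * (y powr K * u y)"
    using xy assms by (intro mult_mono powr_mono2 mult_nonneg_nonneg regularD[OF assms(1)]) auto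
  then show "x powr K' * u x \<le> y powr K' * u y"
    by (simp flip: mult.assoc powr_add)
qed (use regularD[OF assms(1)] in auto)

lemma regular_const: "0 \<le> c \<Longrightarrow> 0 \<le> K \<Longrightarrow> regular K (\<lambda>_. c)"
  by (intro regularI mult_right_mono powr_mono2) auto

lemma regular_add: "regular K u \<Longrightarrow> regular K v \<Longrightarrow> regular K (\<lambda>x. u x + v x)"
  unfolding regular_def by (simp add: distrib_left add_mono)

lemma regular_scale:
  assumes "regular K u" "0 \<le> c" shows "regular K (\<lambda>x. c * u x)"
proof (rule regularI)
  fix x y :: real assume xy: "0 < x" "x \<le> y" "y \<le> 1"
  show "x powr K * (c * u x) \<le> y powr K * (c * u y)"
    using mult_left_mono[OF regularD(3)[OF assms(1) xy] assms(2)] by (simp add: mult_ac)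
qed (use regularD[OF assms(1)] assms(2) in \<open>auto intro: mult_left_mono\<close>)

lemma regular_sum:
  assumes "finite S" "\<And>i. i \<in> S \<Longrightarrow> regular K (u i)" "0 \<le> K"
  shows "regular K (\<lambda>x. \<Sum>i\<in>S. u i x)"
  using assms by (induction S) (auto intro: regular_const regular_add)

lemma regular_cong:
  assumes "regular K u" "\<And>x. 0 < x \<Longrightarrow> x \<le> 1 \<Longrightarrow> v x = u x" shows "regular K v"
  using assms unfolding regular_def by auto

text \<open>x^K u(max x e) is (x / max x e)^K times the value of t^K u(t) at t = max x e, and both
  factors increase with x.\<close>

lemma regular_truncate:
  assumes u: "regular K u" and K: "0 \<le> K" and e: "0 < e" "e \<le> 1"
  shows "regular K (\<lambda>x. u (max x e))"
proof (rule regularI)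
  fix x y :: real assume xy: "0 < x" "x \<le> y" "y \<le> 1"
  have "x powr K * u (max x e) = (x / max x e) powr K * (max x e powr K * u (max x e))"
    using xy e by (simp add: powr_divide)
  also have "\<dots> \<le> (y / max y e) powr K * (max y e powr K * u (max y e))"
  proof (rule mult_mono)
    have "x / max x e \<le> y / max y e" using xy e by (auto simp: max_def field_simps)
    then show "(x / max x e) powr K \<le> (y / max y e) powr K" using xy e K by (intro powr_mono2) auto
    show "max x e powr K * u (max x e) \<le> max y e powr K * u (max y e)"
      using xy e by (intro regularD(3)[OF u]) auto
    show "0 \<le> max x e powr K * u (max x e)" using xy e by (intro mult_nonneg_nonneg regularD(1)[OF u]) auto
  qed auto
  also have "\<dots> = y powr K * u (max y e)" using xy e by (simp add: powr_divide)
  finally show "x powr K * u (max x e) \<le> y powr K * u (max y e)" .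
qed (use e in \<open>auto intro: regularD[OF u]\<close>)

text \<open>With \<open>X = x\<^sup>K\<close> and \<open>Y = y\<^sup>K\<close> the claim is \<open>X\<^sup>2 (u x - d) \<le> Y\<^sup>2 (u y - d)\<close>.\<close>

lemma regular_subtract:
  assumes u: "regular K u" and d: "0 \<le> d" "\<And>x. 0 < x \<Longrightarrow> x \<le> 1 \<Longrightarrow> 2 * d \<le> u x" and K: "0 \<le> K"
  shows "regular (2 * K) (\<lambda>x. u x - d)"
proof (rule regularI)
  fix x y :: real assume xy: "0 < x" "x \<le> y" "y \<le> 1"
  define X Y where "X = x powr K" and "Y = y powr K"
  have XY: "0 < X" "X \<le> Y" using xy K by (auto simp: X_def Y_def intro: powr_mono2)
  have h: "X * u x \<le> Y * u y" using regularD(3)[OF u xy] by (simp add: X_def Y_def)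
  have uy: "2 * d \<le> u y" using d(2)[of y] xy by auto
  have "X\<^sup>2 * (u x - d) \<le> Y\<^sup>2 * (u y - d)"
  \<comment> \<open>If X u(x) \<ge> 2 d Y, then X u(x) \<ge> d (X + Y), so replacing the outer X by
    Y gains at least d (Y^2 - X^2). Otherwise the left side is at most 2 d X Y - d X^2 \<le> d Y^2,
    and 2 d \<le> u(y) concludes.\<close>
  proof (cases "X * u x \<ge> 2 * d * Y")
    case True
    have "d * X \<le> d * Y" using XY d by (intro mult_left_mono) auto
    then have "0 \<le> (X * u x - d * (X + Y)) * (Y - X)"
      using True XY by (intro mult_nonneg_nonneg) (auto simp: algebra_simps)
    moreover have "Y * (X * u x) \<le> Y * (Y * u y)" using h XY by (intro mult_left_mono) auto
    ultimately show ?thesis by (simp add: algebra_simps power2_eq_square)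
  next
    case False
    then have "X * (X * u x) \<le> X * (2 * d * Y)" using XY by (intro mult_left_mono) auto
    moreover have "0 \<le> d * (Y - X)\<^sup>2" using d by simp
    moreover have "Y\<^sup>2 * (2 * d) \<le> Y\<^sup>2 * u y" using uy by (intro mult_left_mono) auto
    ultimately show ?thesis by (simp add: algebra_simps power2_eq_square)
  qed
  moreover have "x powr (2 * K) = X\<^sup>2" "y powr (2 * K) = Y\<^sup>2"
    by (simp_all add: X_def Y_def power2_eq_square flip: powr_add)
  ultimately show "x powr (2 * K) * (u x - d) \<le> y powr (2 * K) * (u y - d)" by simp
next
  fix x :: real assume "0 < x" "x \<le> 1"
  then show "0 \<le> u x - d" using d(2)[of x] d(1) by auto
qed (use regularD[OF u] in auto)

text \<open>With \<open>z = (1 + x) / 2\<close> one has \<open>x\<^sup>K\<^sup>/\<^sup>2 u z = (x / z\<^sup>2)\<^sup>K\<^sup>/\<^sup>2 z\<^sup>K u z\<close>, and \<open>x / z\<^sup>2\<close> increases on \<open>[0,1]\<close>.\<close>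

lemma regular_right_op:
  assumes u: "regular K u" and K: "0 \<le> K"
  shows "regular (K / 2) (right_op u)"
proof (rule regularI)
  fix x y :: real assume xy: "0 < x" "x \<le> y" "y \<le> 1"
  define z where "z = (\<lambda>x::real. (1 + x) / 2)"
  have z: "0 < z x" "0 < z y" "z x \<le> z y" "z y \<le> 1" using xy by (auto simp: z_def)
  have *: "t powr (K/2) * u (z t) = (t / (z t)\<^sup>2) powr (K / 2) * (z t powr K * u (z t))" 
    if "0 < t" for t :: real
  proof -
    have "0 < z t" using that by (simp add: z_def)
    then have "((z t)\<^sup>2) powr (K / 2) = z t powr K"
      by (simp add: power2_eq_square powr_mult flip: powr_add)
    then show ?thesis using that \<open>0 < z t\<close> by (simp add: powr_divide)
  qed
  have "x * (1 + y)\<^sup>2 \<le> y * (1 + x)\<^sup>2"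
  proof -
    have "x * y \<le> 1 * 1" using xy by (intro mult_mono) auto
    then have "0 \<le> (y - x) * (1 - x * y)" using xy by (intro mult_nonneg_nonneg) auto
    then show ?thesis by (simp add: algebra_simps power2_eq_square)
  qed
  then have "x / (z x)\<^sup>2 \<le> y / (z y)\<^sup>2"
    using xy by (simp add: z_def field_simps)
  then have "(x / (z x)\<^sup>2) powr (K / 2) * (z x powr K * u (z x)) \<le> (y / (z y)\<^sup>2) powr (K / 2) * (z y powr K * u (z y))"
    using xy z K by (intro mult_mono powr_mono2 regularD[OF u] mult_nonneg_nonneg) auto
  then have "x powr (K/2) * u (z x) \<le> y powr (K/2) * u (z y)"
    using xy by (simp only: *)
  then show "x powr (K/2) * right_op u x \<le> y powr (K/2) * right_op u y"
    by (simp add: right_op_def z_def)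
qed (auto simp: right_op_def intro!: regularD[OF u])

text \<open>x^K u(y) / slope equals y^K u(y) times (1 + \<xi>)^K / (1 + (1 + \<beta>) \<xi>), and
  the second factor must increase with \<xi>. With r = (1 + \<xi>') / (1 + \<xi>), the slopes have
  ratio at most 1 + (1 + \<beta>) (r - 1), which Bernoulli bounds by r^(1 + \<beta>) \<le> r^K. This
  is the origin of the threshold 1 + \<beta> for K.\<close>

lemma regular_left_branch:
  assumes u: "regular K u" and \<beta>: "0 < \<beta>" "\<beta> < 1" and K: "1 + \<beta> \<le> K"
  shows "regular K (\<lambda>x. u (left_inv \<beta> x) / left_slope \<beta> (left_inv \<beta> x))"
proof (rule regularI)
  fix x :: real assume x: "0 < x" "x \<le> 1"
  show "0 \<le> u (left_inv \<beta> x) / left_slope \<beta> (left_inv \<beta> x)"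
    using left_inv_pos[OF \<beta>, of x] left_inv_range[OF \<beta>, of x] left_slope_ge1[OF \<beta>, of "left_inv \<beta> x"] x
    by (intro divide_nonneg_nonneg regularD[OF u]) auto
next
  fix x x' :: real assume x: "0 < x" "x \<le> x'" "x' \<le> 1"
  define y y' where "y = left_inv \<beta> x" and "y' = left_inv \<beta> x'"
  define \<xi> \<xi>' where "\<xi> = (2 * y) powr \<beta>" and "\<xi>' = (2 * y') powr \<beta>"
  have y: "0 < y" "y \<le> y'" "y' \<le> 1"
    using x left_inv_pos[OF \<beta>, of x] left_inv_mono[OF \<beta>, of x x'] left_inv_range[OF \<beta>, of x']
    by (auto simp: y_def y'_def)
  have \<xi>: "0 \<le> \<xi>" "\<xi> \<le> \<xi>'" using y \<beta> by (auto simp: \<xi>_def \<xi>'_def intro: powr_mono2)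
  have s: "left_slope \<beta> y = 1 + (1 + \<beta>) * \<xi>" "left_slope \<beta> y' = 1 + (1 + \<beta>) * \<xi>'"
    by (simp_all add: left_slope_def \<xi>_def \<xi>'_def)
  have xy: "x = y * (1 + \<xi>)" "x' = y' * (1 + \<xi>')"
    using left_inv_eq[OF \<beta>, of x] left_inv_eq[OF \<beta>, of x'] x by (auto simp: y_def y'_def \<xi>_def \<xi>'_def)
  have s_pos: "0 < 1 + (1 + \<beta>) * \<xi>" "0 < 1 + (1 + \<beta>) * \<xi>'" "1 + (1 + \<beta>) * \<xi> \<le> 1 + (1 + \<beta>) * \<xi>'"
    using \<xi> \<beta> by (auto intro: add_pos_nonneg)
  show "u y' / left_slope \<beta> y' \<le> u y / left_slope \<beta> y"
    unfolding s using s_pos y by (intro frac_le regularD[OF u]) auto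
  define r where "r = (1 + \<xi>') / (1 + \<xi>)"
  have r: "1 \<le> r" using \<xi> by (simp add: r_def)
  have "(1 + (1 + \<beta>) * \<xi>') / (1 + (1 + \<beta>) * \<xi>) = 1 + (1 + \<beta>) * (\<xi>' - \<xi>) / (1 + (1 + \<beta>) * \<xi>)"
    using s_pos by (simp add: field_simps)
  also have "\<dots> \<le> 1 + (1 + \<beta>) * (\<xi>' - \<xi>) / (1 + \<xi>)"
    using \<xi> \<beta> by (intro add_left_mono divide_left_mono mult_pos_pos mult_nonneg_nonneg) (auto simp: algebra_simps add_pos_nonneg)
  also have "\<dots> = 1 + (1 + \<beta>) * (r - 1)" using \<xi> by (simp add: r_def field_simps)
  also have "\<dots> \<le> r powr (1 + \<beta>)" using \<beta> r by (intro powr_ge_tangent) auto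
  also have "\<dots> \<le> r powr K" using r K by (intro powr_mono) auto
  also have "\<dots> = (1 + \<xi>') powr K / (1 + \<xi>) powr K" using \<xi> by (simp add: r_def powr_divide)
  finally have "(1 + \<xi>) powr K / (1 + (1 + \<beta>) * \<xi>) \<le> (1 + \<xi>') powr K / (1 + (1 + \<beta>) * \<xi>')"
    using \<xi> s_pos by (simp add: field_simps)
  then have "y powr K * u y * ((1 + \<xi>) powr K / (1 + (1 + \<beta>) * \<xi>)) \<le>
      y' powr K * u y' * ((1 + \<xi>') powr K / (1 + (1 + \<beta>) * \<xi>'))"
    using y s_pos by (intro mult_mono regularD[OF u] mult_nonneg_nonneg) auto
  then show "x powr K * (u y / left_slope \<beta> y) \<le> x' powr K * (u y' / left_slope \<beta> y')"
    unfolding s xy using y \<xi> by (simp add: powr_mult mult_ac)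
qed

text \<open>Since y^(-\<alpha>) = x^(-\<alpha>) (1 + \<xi>)^\<alpha> and (1 + \<xi>)^\<alpha> \<le>
  1 + \<alpha> \<xi>, division by the slope, which is at most 3, leaves a relative gain of at least
  (1 - \<alpha>) \<xi> / 3. It becomes an absolute gain through x^\<alpha> \<le> (2y)^\<alpha> \<le>
  (2y)^\<beta> = \<xi>; the last inequality uses \<beta> < \<alpha> and 2y \<le> 1, and makes the
  gain independent of \<beta>.\<close>

lemma left_branch_powr:
  assumes \<beta>: "0 < \<beta>" "\<beta> < \<alpha>" and \<alpha>: "\<alpha> < 1" and x: "0 < x" "x \<le> 1"
  shows "left_inv \<beta> x powr - \<alpha> / left_slope \<beta> (left_inv \<beta> x) \<le> x powr - \<alpha> - (1 - \<alpha>) / 3"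
proof -
  have \<beta>1: "\<beta> < 1" using assms by simp
  define y where "y = left_inv \<beta> x"
  define \<xi> where "\<xi> = (2 * y) powr \<beta>"
  note c = left_inv_coords[OF \<beta>(1) \<beta>1 x, folded y_def, folded \<xi>_def]
  have y: "0 < y" "y \<le> 1/2" and \<xi>: "0 \<le> \<xi>" "\<xi> \<le> 1" and xy: "x = y * (1 + \<xi>)"
    and s: "left_slope \<beta> y = 1 + (1 + \<beta>) * \<xi>" using c by auto
  have s_pos: "0 < 1 + (1 + \<beta>) * \<xi>" "1 + (1 + \<beta>) * \<xi> \<le> 3"
  proof -
    show "0 < 1 + (1 + \<beta>) * \<xi>" using \<xi> \<beta> by (intro add_pos_nonneg) auto
    have "(1 + \<beta>) * \<xi> \<le> 2 * 1" using \<xi> \<beta> \<beta>1 by (intro mult_mono) auto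
    then show "1 + (1 + \<beta>) * \<xi> \<le> 3" by simp
  qed
  have "(1 + \<xi>) powr \<alpha> \<le> 1 + \<alpha> * \<xi>"
    using powr_le_tangent[of \<alpha> "1 + \<xi>"] assms \<xi> by simp
  also have "\<dots> \<le> (1 - (1 - \<alpha>) / 3 * \<xi>) * (1 + (1 + \<beta>) * \<xi>)"
  proof -
    define w where "w = (1 - \<alpha>) / 3 * \<xi>"
    have "w * (1 + (1 + \<beta>) * \<xi>) \<le> w * 3"
      using s_pos \<xi> \<alpha> by (intro mult_left_mono) (auto simp: w_def)
    also have "\<dots> = \<xi> - \<alpha> * \<xi>" by (simp add: w_def field_simps)
    finally have "w * (1 + (1 + \<beta>) * \<xi>) \<le> \<xi> - \<alpha> * \<xi>" .
    moreover have "0 \<le> \<beta> * \<xi>" using \<beta> \<xi> by simp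
    ultimately have "1 + \<alpha> * \<xi> \<le> (1 - w) * (1 + (1 + \<beta>) * \<xi>)" by (simp add: algebra_simps)
    then show ?thesis by (simp add: w_def)
  qed
  finally have 1: "(1 + \<xi>) powr \<alpha> / (1 + (1 + \<beta>) * \<xi>) \<le> 1 - (1 - \<alpha>) / 3 * \<xi>"
    using s_pos by (simp add: field_simps)
  have "y * (1 + \<xi>) \<le> y * 2" using y \<xi> by (intro mult_left_mono) auto
  then have "x \<le> 2 * y" using xy by simp
  then have "x powr \<alpha> \<le> (2 * y) powr \<alpha>" using x assms by (intro powr_mono2) auto
  also have "\<dots> \<le> \<xi>" unfolding \<xi>_def using y assms by (intro powr_mono') auto
  finally have "x powr - \<alpha> * x powr \<alpha> \<le> x powr - \<alpha> * \<xi>" by (intro mult_left_mono) auto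
  then have 2: "1 \<le> x powr - \<alpha> * \<xi>" using x by (simp flip: powr_add)
  have "y powr - \<alpha> = x powr - \<alpha> * (1 + \<xi>) powr \<alpha>"
    unfolding xy using y \<xi> by (simp add: powr_mult flip: powr_add)
  then have "y powr - \<alpha> / left_slope \<beta> y = x powr - \<alpha> * ((1 + \<xi>) powr \<alpha> / (1 + (1 + \<beta>) * \<xi>))"
    by (simp add: s)
  also have "\<dots> \<le> x powr - \<alpha> * (1 - (1 - \<alpha>) / 3 * \<xi>)"
    by (intro mult_left_mono 1) auto
  also have "\<dots> = x powr - \<alpha> - (1 - \<alpha>) / 3 * (x powr - \<alpha> * \<xi>)" by (simp add: algebra_simps)
  also have "\<dots> \<le> x powr - \<alpha> - (1 - \<alpha>) / 3 * 1"
    using \<alpha> 2 by (intro diff_left_mono mult_left_mono) auto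
  finally show ?thesis by (simp add: y_def)
qed

text \<open>The argument z of u is at least 1/2, so for decreasing u the number u(z) / 2 is at most
  the mass on [0,1/2].\<close>

lemma right_op_le:
  assumes u: "regular K u" "integrable lam u" and x: "0 < x" "x \<le> 1"
  shows "right_op u x \<le> integral\<^sup>L lam u"
proof -
  interpret prob_space lam by (rule prob_space_lam)
  define z where "z = (1 + x) / 2"
  have z: "1/2 \<le> z" "z \<le> 1" using x by (auto simp: z_def)
  have [measurable]: "{0..1/2} \<in> sets lam" by (auto simp: sets_restrict_space)
  have "u z / 2 = u z * measure lam {0..1/2}"
    by (subst measure_restrict_space) auto
  also have "\<dots> = (LINT t|lam. u z * indicator {0..1/2} t)" by simp
  also have "\<dots> \<le> integral\<^sup>L lam u"
  proof (rule integral_lam_mono[OF _ u(2)])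
    show "integrable lam (\<lambda>t. u z * indicator {0..1/2} t)"
      by (intro integrable_mult_right integrable_real_indicator) (auto simp: emeasure_eq_measure)
  qed (use z regularD[OF u(1)] in \<open>auto simp: indicator_def\<close>)
  finally show ?thesis by (simp add: right_op_def z_def)
qed

definition cone :: "real \<Rightarrow> real \<Rightarrow> real \<Rightarrow> (real \<Rightarrow> real) \<Rightarrow> bool" where
  "cone \<alpha> K A u \<longleftrightarrow> integrable lam u \<and> regular K u \<and> (\<forall>x\<in>{0<..1}. u x \<le> A * x powr - \<alpha>)"

lemma coneD:
  assumes "cone \<alpha> K A u"
  shows "integrable lam u" "regular K u" "0 < x \<Longrightarrow> x \<le> 1 \<Longrightarrow> u x \<le> A * x powr - \<alpha>"
  using assms by (auto simp: cone_def)

lemma cone_mass_near_0: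
  assumes \<alpha>: "0 < \<alpha>" "\<alpha> < 1" and u: "cone \<alpha> K A u" and x: "0 < x" "x \<le> 1"
  shows "(LINT t|lam. indicator {0..x} t * u t) \<le> A * x powr (1 - \<alpha>) / (1 - \<alpha>)"
proof -
  have i: "integrable lam (\<lambda>t. indicator {0..x} t * u t)"
  proof -
    have "(indicator {0..x} :: real \<Rightarrow> real) \<in> borel_measurable lam" by (intro lam_borelI) auto
    from integrable_lam_mult_bounded[OF coneD(1)[OF u] this, of 1] show ?thesis
      by (simp add: mult.commute indicator_def)
  qed
  have hi: "((\<lambda>t. t powr - \<alpha>) has_integral x powr (1 - \<alpha>) / (1 - \<alpha>)) {0..x}"
    using has_integral_powr_from_0[of "- \<alpha>" x] assms by simp
  have "(\<lambda>t. t powr - \<alpha>) absolutely_integrable_on {0..x}"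
    using hi by (intro nonnegative_absolutely_integrable_1) (auto simp: integrable_on_def)
  then have si: "set_integrable lborel {0..x} (\<lambda>t. t powr - \<alpha>)"
    unfolding set_integrable_def by (subst (asm) integrable_completion) auto
  then have p: "(LINT t:{0..x}|lborel. t powr - \<alpha>) = x powr (1 - \<alpha>) / (1 - \<alpha>)"
    using set_borel_integral_eq_integral(2)[OF si] hi by (simp add: integral_unique)
  have eq: "indicator {0..1} t *\<^sub>R (indicator {0..x} t * (A * t powr - \<alpha>)) = A * (indicator {0..x} t *\<^sub>R t powr - \<alpha>)" for t
    using x by (auto simp: indicator_def)
  have j: "integrable lam (\<lambda>t. indicator {0..x} t * (A * t powr - \<alpha>))"
    unfolding integrable_lam_iff set_integrable_def eq 
    using si by (intro integrable_mult_right) (simp add: set_integrable_def)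
  have "(LINT t|lam. indicator {0..x} t * u t) \<le> (LINT t|lam. indicator {0..x} t * (A * t powr - \<alpha>))"
    using coneD(3)[OF u] by (intro integral_lam_mono i j) (auto simp: indicator_def)
  also have "\<dots> = A * (x powr (1 - \<alpha>) / (1 - \<alpha>))"
    unfolding integral_lam set_lebesgue_integral_def eq using p
    by (simp add: set_lebesgue_integral_def)
  finally show ?thesis by simp
qed

section \<open>Recovery of regularity\<close>

text \<open>The left branches decrease \<open>x\<^sup>-\<^sup>\<alpha>\<close> by at least \<open>(1 - \<alpha>) / 3\<close>, see \<open>left_branch_powr\<close>, while the
  right branch adds at most the total mass.\<close>

definition astar :: "real \<Rightarrow> real" where "astar \<alpha> = 3 / (1 - \<alpha>)"

text \<open>Upper bound for the points that are mapped to \<open>1\<close> by \<open>n\<close> left branches.\<close>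

definition entry_point :: "real \<Rightarrow> nat \<Rightarrow> real" where
  "entry_point \<alpha> n = (1 + real n * (\<alpha> / 2)) powr (- 1 / \<alpha>)"

text \<open>The factor \<open>1/4\<close> lets a density that is constant below the cutoff, and bounded by
  \<open>4 * astar \<alpha> * x\<^sup>-\<^sup>\<alpha>\<close>, be bounded by \<open>astar \<alpha> * x\<^sup>-\<^sup>\<alpha>\<close> below the entry point.\<close>

definition cutoff :: "real \<Rightarrow> nat \<Rightarrow> real" where
  "cutoff \<alpha> n = entry_point \<alpha> n / (1/4) powr (1 / \<alpha>)"

text \<open>The bound of \<open>cone_mass_near_0\<close> for the mass below the cutoff, per unit of
  mass, when A is \<open>3 * astar \<alpha>\<close>.\<close>

definition loss :: "real \<Rightarrow> nat \<Rightarrow> real" where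
  "loss \<alpha> n = 3 * astar \<alpha> * cutoff \<alpha> n powr (1 - \<alpha>) / (1 - \<alpha>)"

text \<open>Half of the mass of a density bounded by \<open>2 * astar \<alpha> * x\<^sup>-\<^sup>\<alpha>\<close> lies above this point.\<close>

definition bulk_point :: "real \<Rightarrow> real" where
  "bulk_point \<alpha> = ((1 - \<alpha>) / (4 * astar \<alpha>)) powr (1 / (1 - \<alpha>))"

text \<open>The densities of \<open>cone_bulk_lower\<close> with mass m are at least
  \<open>bulk_point \<alpha> powr (1 + \<alpha>) * m / 2\<close>; half of this is subtracted, since
  \<open>regular_subtract\<close> asks for twice the subtracted constant as a lower bound.\<close>

definition coupling :: "real \<Rightarrow> real" where
  "coupling \<alpha> = bulk_point \<alpha> powr (1 + \<alpha>) / 4"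

context fixes \<alpha> :: real assumes \<alpha>: "0 < \<alpha>" "\<alpha> < 1"
begin

lemma astar_ge3: "3 \<le> astar \<alpha>"
  using \<alpha> by (simp add: astar_def field_simps)

lemma bulk_point_bounds: "0 < bulk_point \<alpha>" "bulk_point \<alpha> \<le> 1"
  and bulk_point_powr: "bulk_point \<alpha> powr (1 - \<alpha>) = (1 - \<alpha>) / (4 * astar \<alpha>)"
proof -
  have a: "0 < (1 - \<alpha>) / (4 * astar \<alpha>)" "(1 - \<alpha>) / (4 * astar \<alpha>) \<le> 1"
    using astar_ge3 \<alpha> by (auto simp: field_simps)
  show "0 < bulk_point \<alpha>" using a(1) astar_ge3 \<alpha> by (auto simp: bulk_point_def)
  show "bulk_point \<alpha> \<le> 1" using a \<alpha> powr_mono2[of "1 / (1 - \<alpha>)" _ 1] by (simp add: bulk_point_def)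
  show "bulk_point \<alpha> powr (1 - \<alpha>) = (1 - \<alpha>) / (4 * astar \<alpha>)"
    using a(1) \<alpha> astar_ge3 by (simp only: bulk_point_def powr_powr) simp
qed

lemma coupling_bounds: "0 < coupling \<alpha>" "coupling \<alpha> \<le> 1/4"
  using bulk_point_bounds powr_mono2[of "1 + \<alpha>" "bulk_point \<alpha>" 1] \<alpha> by (auto simp: coupling_def)

lemma entry_point_pos: "0 < entry_point \<alpha> n"
proof -
  have "0 < 1 + real n * (\<alpha> / 2)" using \<alpha> by (intro add_pos_nonneg) auto
  then show ?thesis by (simp add: entry_point_def)
qed

lemma entry_point_le1: "entry_point \<alpha> n \<le> 1"
proof -
  have "1 \<le> 1 + real n * (\<alpha> / 2)" using \<alpha> by simp
  then have "(1 + real n * (\<alpha> / 2)) powr (- 1 / \<alpha>) \<le> (1 + real n * (\<alpha> / 2)) powr 0"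
    using \<alpha> by (intro powr_mono) auto
  then show ?thesis using \<open>1 \<le> 1 + _\<close> by (simp add: entry_point_def)
qed

lemma cutoff_ge: "entry_point \<alpha> n \<le> cutoff \<alpha> n" and cutoff_pos: "0 < cutoff \<alpha> n"
proof -
  have "(1/4) powr (1 / \<alpha>) \<le> (1::real) powr (1 / \<alpha>)" using \<alpha> by (intro powr_mono2) auto
  then show "entry_point \<alpha> n \<le> cutoff \<alpha> n"
    using entry_point_pos[of n] by (simp add: cutoff_def field_simps mult_left_le)
  then show "0 < cutoff \<alpha> n" using entry_point_pos[of n] by linarith
qed

lemma cutoff_powr: "cutoff \<alpha> n powr - \<alpha> = (1/4) * entry_point \<alpha> n powr - \<alpha>"
proof -
  define c :: real where "c = (1/4) powr (1 / \<alpha>)"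
  have "c powr - \<alpha> = 4" using \<alpha> by (simp add: c_def powr_powr powr_minus)
  moreover have "0 \<le> c" by (simp add: c_def)
  ultimately show ?thesis
    unfolding cutoff_def c_def[symmetric] using entry_point_pos[of n] by (simp add: powr_divide)
qed

lemma loss_nonneg: "0 \<le> loss \<alpha> n"
  using \<alpha> astar_ge3 by (simp add: loss_def)

text \<open>For small n the cutoff may exceed 1, and then flattening there makes no sense; but in
  that case the loss is larger than 1/4.\<close>

lemma loss_small_imp_cutoff:
  assumes "loss \<alpha> n \<le> 1/4" shows "cutoff \<alpha> n \<le> 1"
proof (rule ccontr)
  assume "\<not> ?thesis"
  then have "1 \<le> cutoff \<alpha> n powr (1 - \<alpha>)" using \<alpha> powr_mono2[of "1 - \<alpha>" 1 "cutoff \<alpha> n"] by simp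
  then have "3 * astar \<alpha> * 1 \<le> 3 * astar \<alpha> * cutoff \<alpha> n powr (1 - \<alpha>)"
    using astar_ge3 by (intro mult_left_mono) auto
  also have "3 * astar \<alpha> * cutoff \<alpha> n powr (1 - \<alpha>) \<le> (1 - \<alpha>) / 4"
    using assms \<alpha> by (simp add: loss_def field_simps)
  finally show False using astar_ge3 \<alpha> by simp
qed

text \<open>The cutoff is of order n^(-1/\<alpha>), and a density of size x^(-\<alpha>) has mass of
  order e^(1 - \<alpha>) below e; together this is n^(1 - 1/\<alpha>).\<close>

lemma loss_decay: "\<exists>C>0. \<forall>n\<ge>1. loss \<alpha> n \<le> C * real n powr (1 - 1 / \<alpha>)"
proof -
  define c :: real where "c = (1/4) powr (1 / \<alpha>)"
  define D where "D = 3 * astar \<alpha> * (1 / c) powr (1 - \<alpha>) / (1 - \<alpha>)"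
  have c: "0 < c" by (simp add: c_def)
  have D: "0 < D" using astar_ge3 \<alpha> c by (simp add: D_def)
  have "loss \<alpha> n \<le> D * (\<alpha> / 2) powr (1 - 1 / \<alpha>) * real n powr (1 - 1 / \<alpha>)" if "1 \<le> n" for n
  proof -
    have "entry_point \<alpha> n powr (1 - \<alpha>) = (1 + real n * (\<alpha> / 2)) powr (1 - 1/\<alpha>)"
    proof -
      have "- 1 / \<alpha> * (1 - \<alpha>) = 1 - 1 / \<alpha>" using \<alpha> by (simp add: field_simps)
      then show ?thesis by (simp only: entry_point_def powr_powr)
    qed
    also have "\<dots> \<le> (real n * (\<alpha> / 2)) powr (1 - 1/\<alpha>)"
      using \<alpha> that by (intro powr_mono2') (auto simp: field_simps)
    also have "\<dots> = (\<alpha> / 2) powr (1 - 1 / \<alpha>) * real n powr (1 - 1/\<alpha>)"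
      using \<alpha> by (simp add: powr_mult powr_divide)
    finally have "D * entry_point \<alpha> n powr (1 - \<alpha>) \<le> D * ((\<alpha> / 2) powr (1 - 1 / \<alpha>) * real n powr (1 - 1/\<alpha>))"
      using D by (intro mult_left_mono) auto
    moreover have "loss \<alpha> n = D * entry_point \<alpha> n powr (1 - \<alpha>)"
      unfolding loss_def D_def cutoff_def c_def[symmetric]
      using entry_point_pos[of n] c by (simp add: powr_divide)
    ultimately show ?thesis by simp
  qed
  then show ?thesis using D \<alpha> by (intro exI[of _ "D * (\<alpha> / 2) powr (1 - 1 / \<alpha>)"]) auto
qed

text \<open>Each left inverse branch raises x^(-\<alpha>) by at least \<alpha>/2: Bernoulli gives (1
  + \<xi>)^(-\<alpha>) \<le> 1 - \<alpha> \<xi> / 2, and y^\<alpha> \<le> (2y)^\<alpha> \<le> \<xi>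
  again removes the dependence on \<beta>. The entry points satisfy this recursion with equality,
  starting from 1.\<close>

lemma left_inv_entry_point:
  assumes \<beta>: "0 < \<beta>" "\<beta> < \<alpha>" and x: "0 < x" "x \<le> entry_point \<alpha> n"
  shows "left_inv \<beta> x \<le> entry_point \<alpha> (Suc n)"
proof -
  have \<beta>1: "\<beta> < 1" using assms \<alpha> by simp
  have x1: "x \<le> 1" using x entry_point_le1[of n] by linarith
  define y where "y = left_inv \<beta> x"
  define \<xi> where "\<xi> = (2 * y) powr \<beta>"
  note c = left_inv_coords[OF \<beta>(1) \<beta>1 x(1) x1, folded y_def, folded \<xi>_def]
  have y: "0 < y" "y \<le> 1/2" and \<xi>: "0 < \<xi>" "\<xi> \<le> 1" and xy: "x = y * (1 + \<xi>)" using c by auto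
  have "(1 / (1 + \<xi>)) powr \<alpha> \<le> 1 + \<alpha> * (1 / (1 + \<xi>) - 1)"
    using \<alpha> \<xi> by (intro powr_le_tangent) auto
  also have "\<dots> = 1 - \<alpha> * (\<xi> / (1 + \<xi>))" using \<xi> by (simp add: field_simps)
  also have "\<dots> \<le> 1 - \<alpha> * (\<xi> / 2)"
    using \<alpha> \<xi> by (intro diff_left_mono mult_left_mono divide_left_mono) auto
  finally have 1: "(1 + \<xi>) powr - \<alpha> \<le> 1 - \<alpha> * (\<xi> / 2)"
    using \<xi> by (simp add: powr_divide powr_minus_divide)
  have "y powr \<alpha> \<le> (2 * y) powr \<alpha>" using y \<alpha> by (intro powr_mono2) auto
  also have "\<dots> \<le> \<xi>" unfolding \<xi>_def using y assms by (intro powr_mono') auto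
  finally have "y powr - \<alpha> * y powr \<alpha> \<le> y powr - \<alpha> * \<xi>" by (intro mult_left_mono) auto
  then have 2: "1 \<le> y powr - \<alpha> * \<xi>" using y by (simp flip: powr_add)
  have "x powr - \<alpha> = y powr - \<alpha> * (1 + \<xi>) powr - \<alpha>"
    unfolding xy using y \<xi> by (simp add: powr_mult)
  also have "\<dots> \<le> y powr - \<alpha> * (1 - \<alpha> * (\<xi> / 2))" by (intro mult_left_mono 1) auto
  also have "\<dots> = y powr - \<alpha> - \<alpha> / 2 * (y powr - \<alpha> * \<xi>)" by (simp add: algebra_simps)
  also have "\<dots> \<le> y powr - \<alpha> - \<alpha> / 2 * 1"
    using \<alpha> 2 by (intro diff_left_mono mult_left_mono) auto
  finally have 3: "x powr - \<alpha> + \<alpha> / 2 \<le> y powr - \<alpha>" by simp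
  have p: "0 < 1 + real n * (\<alpha> / 2)" for n using \<alpha> by (intro add_pos_nonneg) auto
  have "entry_point \<alpha> n powr - \<alpha> = 1 + real n * (\<alpha> / 2)"
    using \<alpha> p[of n] by (simp add: entry_point_def powr_powr)
  moreover have "entry_point \<alpha> n powr - \<alpha> \<le> x powr - \<alpha>" using x \<alpha> by (intro powr_mono2') auto
  ultimately have "1 + real (Suc n) * (\<alpha> / 2) \<le> y powr - \<alpha>" using 3 by (simp add: field_simps)
  then have "(y powr - \<alpha>) powr (- 1 / \<alpha>) \<le> (1 + real (Suc n) * (\<alpha> / 2)) powr (- 1 / \<alpha>)"
    using \<alpha> p[of "Suc n"] by (intro powr_mono2') auto
  moreover have "(y powr - \<alpha>) powr (- 1 / \<alpha>) = y" using y \<alpha> by (simp add: powr_powr)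
  ultimately show ?thesis by (simp add: entry_point_def y_def)
qed

text \<open>At most half of the mass lies below b = \<open>bulk_point \<alpha>\<close>, and f \<le>
  f(b) above it, so f(b) \<ge> m/2. Monotonicity of x^(1 + \<alpha>) f carries a lower bound from b
  to 1, and monotonicity of f carries it from 1 to all of (0,1].\<close>

lemma cone_bulk_lower:
  assumes f: "cone \<alpha> (1 + \<alpha>) (2 * astar \<alpha> * m) f" and m: "integral\<^sup>L lam f = m" and x: "0 < x" "x \<le> 1"
  shows "2 * (coupling \<alpha> * m) \<le> f x"
proof -
  interpret prob_space lam by (rule prob_space_lam)
  let ?b = "bulk_point \<alpha>"
  note reg = coneD(2)[OF f] and int = coneD(1)[OF f]
  have "(indicator {0..?b} :: real \<Rightarrow> real) \<in> borel_measurable lam" by (intro lam_borelI) auto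
  from integrable_lam_mult_bounded[OF int this, of 1]
  have i: "integrable lam (\<lambda>t. indicator {0..?b} t * f t)" 
    by (simp add: mult.commute indicator_def)
  have "m \<le> (LINT t|lam. indicator {0..?b} t * f t + f ?b)"
    unfolding m[symmetric] using i int bulk_point_bounds
    by (intro integral_lam_mono) (auto simp: indicator_def intro!: regularD(1)[OF reg] regularD(2)[OF reg])
  also have "\<dots> = (LINT t|lam. indicator {0..?b} t * f t) + f ?b"
    using i prob_space by simp
  also have "(LINT t|lam. indicator {0..?b} t * f t) \<le> 2 * astar \<alpha> * m * ?b powr (1 - \<alpha>) / (1 - \<alpha>)"
    by (rule cone_mass_near_0[OF \<alpha> f bulk_point_bounds])
  also have "\<dots> = m / 2"
    unfolding bulk_point_powr using \<alpha> astar_ge3 by (simp add: field_simps)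
  finally have "m / 2 \<le> f ?b" by simp
  then have "?b powr (1 + \<alpha>) * (m / 2) \<le> ?b powr (1 + \<alpha>) * f ?b" by (intro mult_left_mono) auto
  also have "\<dots> \<le> 1 powr (1 + \<alpha>) * f 1"
    using bulk_point_bounds by (intro regularD(3)[OF reg]) auto
  also have "\<dots> \<le> f x" using regularD(2)[OF reg, of x 1] x by simp
  finally show ?thesis by (simp add: coupling_def mult.commute)
qed

end

section \<open>All-left branches, returning branches and the gain of regularity\<close>

context random_lsv
begin

lemma left_op_regular:
  assumes "regular K u" "1 + \<alpha> \<le> K" shows "regular K (left_op u)"
  unfolding left_op_def[abs_def] using assms \<alpha>
  by (intro regular_sum regular_scale regular_left_branch finite_\<Omega> P_nonneg) (auto dest: \<Omega>D)

lemma left_op_powr: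
  assumes "0 < x" "x \<le> 1"
  shows "left_op (\<lambda>x. x powr - \<alpha>) x \<le> x powr - \<alpha> - (1 - \<alpha>) / 3"
  unfolding left_op_def using assms \<alpha> \<Omega>D by (intro P_average_le left_branch_powr) auto

lemma left_op_scale: "left_op (\<lambda>x. c * u x) x = c * left_op u x"
  using left_op_linear[of c u 0 u x] by simp

lemma left_inv_unit:
  assumes "\<beta> \<in> \<Omega>" "0 < x" "x \<le> 1"
  shows "0 < left_inv \<beta> x" "left_inv \<beta> x \<le> 1"
  using left_inv_pos[OF \<Omega>D(1,3)[OF assms(1)], of x] left_inv_range[OF \<Omega>D(1,3)[OF assms(1)], of x] assms by auto

lemma left_op_bound:
  assumes u: "\<And>x. 0 < x \<Longrightarrow> x \<le> 1 \<Longrightarrow> u x \<le> A * x powr - \<alpha>" and A: "0 \<le> A" and x: "0 < x" "x \<le> 1"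
  shows "left_op u x \<le> A * x powr - \<alpha> - A * ((1 - \<alpha>) / 3)"
proof -
  have "left_op u x \<le> left_op (\<lambda>x. A * x powr - \<alpha>) x"
    using left_inv_unit x by (intro left_op_mono u) auto
  also have "\<dots> = A * left_op (\<lambda>x. x powr - \<alpha>) x" by (rule left_op_scale)
  also have "\<dots> \<le> A * (x powr - \<alpha> - (1 - \<alpha>) / 3)" using left_op_powr x A by (intro mult_left_mono) auto
  finally show ?thesis by (simp add: algebra_simps)
qed

lemma transfer_regular:
  assumes "regular K u" "1 + \<alpha> \<le> K" shows "regular K (transfer u)"
proof -
  have "regular (K / 2) (right_op u)" using assms \<alpha> by (intro regular_right_op) auto
  then have "regular K (right_op u)" using assms \<alpha> by (elim regular_weaken) auto
  then show ?thesis unfolding transfer_def[abs_def]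
    using assms by (intro regular_add left_op_regular)
qed

lemma transfer_pow_regular:
  "regular K u \<Longrightarrow> 1 + \<alpha> \<le> K \<Longrightarrow> regular K ((transfer ^^ n) u)"
  by (induction n) (auto intro: transfer_regular)

lemma transfer_cone:
  assumes u: "cone \<alpha> K A u" and K: "1 + \<alpha> \<le> K" and A: "astar \<alpha> * integral\<^sup>L lam u \<le> A" and A0: "0 \<le> A"
  shows "cone \<alpha> K A (transfer u)"
  unfolding cone_def
proof (intro conjI ballI transfer_integrable transfer_regular coneD[OF u] K)
  fix x :: real assume "x \<in> {0<..1}"
  then have x: "0 < x" "x \<le> 1" by auto
  have "A * ((1 - \<alpha>) / 3) \<ge> integral\<^sup>L lam u"
    using A \<alpha> by (simp add: astar_def field_simps)
  moreover have "left_op u x \<le> A * x powr - \<alpha> - A * ((1 - \<alpha>) / 3)"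
    by (rule left_op_bound[OF coneD(3)[OF u] A0 x])
  moreover have "right_op u x \<le> integral\<^sup>L lam u"
    by (rule right_op_le[OF coneD(2,1)[OF u] x])
  ultimately show "transfer u x \<le> A * x powr - \<alpha>" by (simp add: transfer_def)
qed

text \<open>k left inverse branches send points below \<open>entry_point \<alpha> j\<close> below
  \<open>entry_point \<alpha> (j + k)\<close>, so only the values of u there are seen.\<close>

lemma left_op_pow_cong:
  assumes "\<And>x. 0 < x \<Longrightarrow> x \<le> entry_point \<alpha> (j + k) \<Longrightarrow> u x = v x"
    and "0 < x" "x \<le> entry_point \<alpha> j"
  shows "(left_op ^^ k) u x = (left_op ^^ k) v x"
  using assms
proof (induction k arbitrary: j x)
  case (Suc k)
  have "(left_op ^^ k) u (left_inv \<beta> x) = (left_op ^^ k) v (left_inv \<beta> x)" if \<beta>: "\<beta> \<in> \<Omega>" for \<beta>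
  proof (rule Suc.IH[of "Suc j"])
    show "left_inv \<beta> x \<le> entry_point \<alpha> (Suc j)"
      using Suc.prems \<Omega>D[OF \<beta>] \<alpha> by (intro left_inv_entry_point) auto
    show "0 < left_inv \<beta> x"
      using Suc.prems entry_point_le1[OF \<alpha>, of j] by (intro left_inv_unit \<beta>) auto
    show "\<And>x. 0 < x \<Longrightarrow> x \<le> entry_point \<alpha> (Suc j + k) \<Longrightarrow> u x = v x"
      using Suc.prems by simp
  qed
  then show ?case by (simp add: left_op_def[of "(left_op ^^ k) u"] left_op_def[of "(left_op ^^ k) v"])
qed simp

lemma left_op_pow_powr:
  assumes "0 \<le> A" "0 < x" "x \<le> 1"
  shows "(left_op ^^ k) (\<lambda>x. A * x powr - \<alpha>) x \<le> A * x powr - \<alpha>"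
  using assms(2,3)
proof (induction k arbitrary: x)
  case (Suc k)
  have "left_op ((left_op ^^ k) (\<lambda>x. A * x powr - \<alpha>)) x \<le> A * x powr - \<alpha> - A * ((1 - \<alpha>) / 3)"
    using Suc assms(1) by (intro left_op_bound) auto
  moreover have "0 \<le> A * ((1 - \<alpha>) / 3)" using assms(1) \<alpha> by simp
  ultimately show ?case by simp
qed simp

lemma left_op_pow_mono:
  assumes "\<And>x. 0 < x \<Longrightarrow> x \<le> 1 \<Longrightarrow> u x \<le> v x" "0 < x" "x \<le> 1"
  shows "(left_op ^^ k) u x \<le> (left_op ^^ k) v x"
  using assms(2,3)
  by (induction k arbitrary: x) (auto intro!: left_op_mono assms(1) simp: left_inv_unit)

lemma left_op_pow_scale: "(left_op ^^ k) (\<lambda>x. c * u x) x = c * (left_op ^^ k) u x"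
proof (induction k arbitrary: x)
  case (Suc k)
  then have "(left_op ^^ k) (\<lambda>x. c * u x) = (\<lambda>x. c * (left_op ^^ k) u x)" by auto
  then show ?case by (simp add: left_op_scale)
qed simp

text \<open>The contribution to the iterated transfer operator of all inverse branches except the all-left one.\<close>

primrec returned :: "(real \<Rightarrow> real) \<Rightarrow> nat \<Rightarrow> real \<Rightarrow> real" where
  "returned u 0 = (\<lambda>_. 0)"
| "returned u (Suc k) = (\<lambda>x. left_op (returned u k) x + right_op ((transfer ^^ k) u) x)"

lemma transfer_pow_split: "(transfer ^^ k) u x = (left_op ^^ k) u x + returned u k x"
proof (induction k arbitrary: x)
  case (Suc k)
  then have "(transfer ^^ k) u = (\<lambda>x. 1 * (left_op ^^ k) u x + 1 * returned u k x)" by auto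
  then have "left_op ((transfer ^^ k) u) x = 1 * left_op ((left_op ^^ k) u) x + 1 * left_op (returned u k) x"
    by (simp only: left_op_linear)
  then show ?case by (simp add: transfer_def[of "(transfer ^^ k) u"])
qed simp

text \<open>The recursion sorts inverse branches by the most recent passage through the right
  branch; that passage halves 2 (1 + \<alpha>) to 1 + \<alpha>, and the left branches after it
  preserve 1 + \<alpha>.\<close>

lemma returned_regular:
  assumes u: "regular (2 * (1 + \<alpha>)) u"
  shows "regular (1 + \<alpha>) (returned u k)"
proof (induction k)
  case (Suc k)
  have "regular (2 * (1 + \<alpha>) / 2) (right_op ((transfer ^^ k) u))"
    using \<alpha> by (intro regular_right_op transfer_pow_regular u) auto
  also have "2 * (1 + \<alpha>) / 2 = 1 + \<alpha>" by simp
  finally show ?case using Suc by (auto intro!: regular_add left_op_regular)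
qed (use \<alpha> in \<open>auto intro: regular_const\<close>)

text \<open>Starting from 0, each step adds at most m through the right branch, while the drift of
  the left branches removes exactly m when the coefficient is
  \<open>astar \<alpha> * m\<close>.\<close>

lemma returned_bound:
  assumes u: "regular (2 * (1 + \<alpha>)) u" "integrable lam u" "integral\<^sup>L lam u = m" and m: "0 \<le> m"
    and x: "0 < x" "x \<le> 1"
  shows "returned u k x \<le> astar \<alpha> * m * x powr - \<alpha>"
  using x
proof (induction k arbitrary: x)
  case 0
  then show ?case using m astar_ge3[OF \<alpha>] by simp
next
  case (Suc k)
  have "left_op (returned u k) x \<le> astar \<alpha> * m * x powr - \<alpha> - astar \<alpha> * m * ((1 - \<alpha>) / 3)"
    using Suc m astar_ge3[OF \<alpha>] by (intro left_op_bound) auto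
  moreover have "astar \<alpha> * m * ((1 - \<alpha>) / 3) = m" using \<alpha> by (simp add: astar_def)
  moreover have "right_op ((transfer ^^ k) u) x \<le> integral\<^sup>L lam ((transfer ^^ k) u)"
    using Suc.prems \<alpha> by (intro right_op_le[OF transfer_pow_regular[OF u(1)]] u transfer_pow_integrable) auto
  moreover have "integral\<^sup>L lam ((transfer ^^ k) u) = m" using transfer_pow_integral[OF u(2), of k] u(3) by simp
  ultimately show ?case unfolding returned.simps by linarith
qed

text \<open>The all-left part sees u only below the entry point, hence only a constant, and the
  all-left image of a constant is regular with exponent 1 + \<alpha>. In the size bound, the
  all-left part and the returned part contribute \<open>astar \<alpha> * m\<close> each, which gives
  the factor 2.\<close>

lemma recover_cone:
  assumes u: "cone \<alpha> (2 * (1 + \<alpha>)) (4 * astar \<alpha> * m) u" and m: "integral\<^sup>L lam u = m" "0 \<le> m"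
    and cut: "cutoff \<alpha> n \<le> 1" and const: "\<And>x. 0 < x \<Longrightarrow> x \<le> cutoff \<alpha> n \<Longrightarrow> u x = u (cutoff \<alpha> n)"
  shows "cone \<alpha> (1 + \<alpha>) (2 * astar \<alpha> * m) ((transfer ^^ n) u)"
  unfolding cone_def
proof (intro conjI ballI transfer_pow_integrable coneD[OF u])
  let ?c = "u (cutoff \<alpha> n)"
  note reg = coneD(2)[OF u]
  have c: "0 \<le> ?c" using cut cutoff_pos[OF \<alpha>, of n] by (intro regularD(1)[OF reg]) auto
  have K: "1 + \<alpha> \<le> 2 * (1 + \<alpha>)" using \<alpha> by simp
  have e0: "entry_point \<alpha> 0 = 1" by (simp add: entry_point_def)
  have cong: "u x = ?c * 1" if "0 < x" "x \<le> entry_point \<alpha> (0 + n)" for x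
    using const[of x] that cutoff_ge[OF \<alpha>, of n] by auto
  have L: "(left_op ^^ n) u x = ?c * (left_op ^^ n) (\<lambda>_. 1) x" if "0 < x" "x \<le> 1" for x
  proof -
    have "(left_op ^^ n) u x = (left_op ^^ n) (\<lambda>_. ?c * 1) x"
      using that e0 by (intro left_op_pow_cong[where j = 0] cong) auto
    then show ?thesis by (simp only: left_op_pow_scale)
  qed
  have "regular (1 + \<alpha>) ((left_op ^^ n) (\<lambda>_. 1))"
    using \<alpha> by (induction n) (auto intro: regular_const left_op_regular)
  then have "regular (1 + \<alpha>) (\<lambda>x. ?c * (left_op ^^ n) (\<lambda>_. 1) x + returned u n x)"
    by (intro regular_add regular_scale c returned_regular reg)
  then show "regular (1 + \<alpha>) ((transfer ^^ n) u)"
    by (rule regular_cong) (simp add: transfer_pow_split L)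
  fix x :: real assume "x \<in> {0<..1}"
  then have x: "0 < x" "x \<le> 1" by auto
  have A: "0 \<le> astar \<alpha> * m" using m astar_ge3[OF \<alpha>] by simp
  \<comment> \<open>Setting u to 0 above the entry point does not change the all-left image. There
    the size of u, governed by the factor 4, is irrelevant; below, u is constant and
    \<open>cutoff_powr\<close> turns the 4 into 1.\<close>
  define w where "w = (\<lambda>x. if x \<le> entry_point \<alpha> n then u x else 0)"
  have "(left_op ^^ n) u x = (left_op ^^ n) w x"
    using x e0 by (intro left_op_pow_cong[of 0]) (auto simp: w_def)
  also have "\<dots> \<le> (left_op ^^ n) (\<lambda>x. astar \<alpha> * m * x powr - \<alpha>) x"
  proof (rule left_op_pow_mono[OF _ x])
    fix t :: real assume t: "0 < t" "t \<le> 1"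
    show "w t \<le> astar \<alpha> * m * t powr - \<alpha>"
    proof (cases "t \<le> entry_point \<alpha> n")
      case True
      then have "w t = ?c" using const[of t] t cutoff_ge[OF \<alpha>, of n] by (simp add: w_def)
      also have "\<dots> \<le> 4 * astar \<alpha> * m * cutoff \<alpha> n powr - \<alpha>"
        using cut cutoff_pos[OF \<alpha>, of n] by (intro coneD(3)[OF u])
      also have "\<dots> = astar \<alpha> * m * entry_point \<alpha> n powr - \<alpha>"
        unfolding cutoff_powr[OF \<alpha>] by simp
      also have "\<dots> \<le> astar \<alpha> * m * t powr - \<alpha>"
        using A t True \<alpha> by (intro mult_left_mono powr_mono2') auto
      finally show ?thesis .
    qed (use A in \<open>auto simp: w_def\<close>)
  qed
  also have "\<dots> \<le> astar \<alpha> * m * x powr - \<alpha>" by (rule left_op_pow_powr[OF A x])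
  finally show "(transfer ^^ n) u x \<le> 2 * astar \<alpha> * m * x powr - \<alpha>"
    using returned_bound[OF reg coneD(1)[OF u] m x, of n] by (simp add: transfer_pow_split)
qed

end

section \<open>Coupling and polynomial contraction\<close>

text \<open>The state between two coupling stages. The factor 3 grows to 4 when flattening costs up
  to a quarter of the mass, drops to 2 by \<open>recover_cone\<close>, and 2 \<le> 3 (1 -
  \<open>coupling \<alpha>\<close>) brings it back to 3 after the subtraction.\<close>

definition normal_cone :: "real \<Rightarrow> real \<Rightarrow> (real \<Rightarrow> real) \<Rightarrow> bool" where
  "normal_cone \<alpha> m f \<longleftrightarrow> cone \<alpha> (2 * (1 + \<alpha>)) (3 * astar \<alpha> * m) f \<and> integral\<^sup>L lam f = m"

lemma cone_scale:
  assumes "cone \<alpha> K A u" "0 \<le> s" "s * A \<le> B"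
  shows "cone \<alpha> K B (\<lambda>x. s * u x)"
  unfolding cone_def
proof (intro conjI ballI integrable_mult_right regular_scale coneD[OF assms(1)] assms(2))
  fix x :: real assume "x \<in> {0<..1}"
  then have "s * u x \<le> s * (A * x powr - \<alpha>)" using assms(2) by (intro mult_left_mono coneD(3)[OF assms(1)]) auto
  also have "\<dots> \<le> B * x powr - \<alpha>" using assms(3) by (simp add: mult_right_mono flip: mult.assoc)
  finally show "s * u x \<le> B * x powr - \<alpha>" .
qed

lemma normal_cone_scale:
  assumes "normal_cone \<alpha> m f" "0 \<le> s" shows "normal_cone \<alpha> (s * m) (\<lambda>x. s * f x)"
  using assms unfolding normal_cone_def by (auto intro!: cone_scale)

lemma truncate_integrable:
  assumes u: "integrable lam u" "regular K u" and e: "0 < e" "e \<le> 1"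
  shows "integrable lam (\<lambda>x. u (max x e))"
proof (rule integrable_lam_bounded)
  have [measurable]: "(\<lambda>x. max x e) \<in> measurable lam lam"
    using e by (intro measurable_to_lam lam_borelI) auto
  have [measurable]: "u \<in> borel_measurable lam" using u by simp
  show "(\<lambda>x. u (max x e)) \<in> borel_measurable lam" by measurable
  fix x :: real assume "x \<in> {0..1}"
  then have "0 \<le> u (max x e)" "u (max x e) \<le> u e"
    using e by (auto intro!: regularD(1)[OF u(2)] regularD(2)[OF u(2)])
  then show "\<bar>u (max x e)\<bar> \<le> u e" by simp
qed

lemma cone_truncate:
  assumes \<alpha>: "0 < \<alpha>" "\<alpha> < 1" and u: "cone \<alpha> K A u" and K: "0 \<le> K" and e: "0 < e" "e \<le> 1"
  shows "cone \<alpha> K A (\<lambda>x. u (max x e))"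
    and "integral\<^sup>L lam u - A * e powr (1 - \<alpha>) / (1 - \<alpha>) \<le> (LINT x|lam. u (max x e))"
    and "(LINT x|lam. u (max x e)) \<le> integral\<^sup>L lam u"
    and "0 < x \<Longrightarrow> x \<le> 1 \<Longrightarrow> u (max x e) \<le> u x"
proof -
  note reg = coneD(2)[OF u] and int = coneD(1)[OF u]
  have le: "u (max x e) \<le> u x" if "0 < x" "x \<le> 1" for x
    using that e by (auto intro!: regularD(2)[OF reg])
  then show "0 < x \<Longrightarrow> x \<le> 1 \<Longrightarrow> u (max x e) \<le> u x" by auto
  have ti: "integrable lam (\<lambda>x. u (max x e))" by (rule truncate_integrable[OF int reg e])
  show "cone \<alpha> K A (\<lambda>x. u (max x e))"
    unfolding cone_def
  proof (intro conjI ballI ti regular_truncate reg K e)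
    fix x :: real assume "x \<in> {0<..1}"
    then show "u (max x e) \<le> A * x powr - \<alpha>" using le[of x] coneD(3)[OF u, of x] by simp
  qed
  show "(LINT x|lam. u (max x e)) \<le> integral\<^sup>L lam u"
    by (intro integral_lam_mono ti int le)
  have "(indicator {0..e} :: real \<Rightarrow> real) \<in> borel_measurable lam" by (intro lam_borelI) auto
  from integrable_lam_mult_bounded[OF int this, of 1]
  have i: "integrable lam (\<lambda>t. indicator {0..e} t * u t)" 
    by (simp add: mult.commute indicator_def)
  have "integral\<^sup>L lam u \<le> (LINT x|lam. indicator {0..e} x * u x + u (max x e))"
    using e by (intro integral_lam_mono int Bochner_Integration.integrable_add i ti)
      (auto simp: indicator_def max_def intro!: regularD(1)[OF reg])
  also have "\<dots> = (LINT x|lam. indicator {0..e} x * u x) + (LINT x|lam. u (max x e))"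
    using i ti by simp
  finally show "integral\<^sup>L lam u - A * e powr (1 - \<alpha>) / (1 - \<alpha>) \<le> (LINT x|lam. u (max x e))"
    using cone_mass_near_0[OF \<alpha> u e] by simp
qed

text \<open>\<open>D N x\<close> is to be read as: after N steps the relative distance is at most x.
  Each block of n steps contracts by 1 - c at the price C n^(-b). B is chosen before D, so that a
  single constant serves all systems.\<close>

lemma polynomial_decay_recursion:
  fixes b c C :: real
  assumes b: "0 < b" and c: "0 < c" "c < 1" and C: "0 < C"
  shows "\<exists>B>0. \<forall>D :: nat \<Rightarrow> real \<Rightarrow> bool. (\<forall>N. D N 2) \<longrightarrow> (\<forall>N x y. D N x \<longrightarrow> x \<le> y \<longrightarrow> D N y) \<longrightarrow>
    (\<forall>n N x. 1 \<le> n \<longrightarrow> 0 \<le> x \<longrightarrow> D N x \<longrightarrow> D (n + N) (C * real n powr - b + (1 - c) * x)) \<longrightarrow>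
    (\<forall>N\<ge>1. D N (B * real N powr - b))"
proof -
  \<comment> \<open>The proportion of N left to the induction hypothesis: (1 - c) t^(-b) = 1 - c/2.
    Thus half of the contraction survives the change from N to t N, and the remaining c/2 of B pays
    for the block of length about (1 - t) N.\<close>
  define t where "t = ((1 - c) / (1 - c / 2)) powr (1 / b)"
  have q: "0 < (1 - c) / (1 - c / 2)" "(1 - c) / (1 - c / 2) < 1" using c by auto
  have t0: "0 < t" using q c by (simp add: t_def)
  have t1: "t < 1" using powr_less_mono2[of "1 / b" "(1 - c) / (1 - c / 2)" 1] q b by (simp add: t_def)
  have tb: "(1 - c) * t powr - b = 1 - c / 2"
  proof -
    have "t powr - b = ((1 - c) / (1 - c / 2)) powr -1" using b q by (simp only: t_def powr_powr) simp
    also have "\<dots> = (1 - c / 2) / (1 - c)" using q c by (simp add: powr_minus)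
    finally have "t powr - b = (1 - c / 2) / (1 - c)" .
    moreover have "1 - c \<noteq> 0" using c by simp
    ultimately show ?thesis by (metis nonzero_mult_div_cancel_left times_divide_eq_right)
  qed
  define s where "s = 1 - t"
  have s: "0 < s" "s < 1" using t0 t1 by (auto simp: s_def)
  \<comment> \<open>Beyond N0 the block length, s N rounded down, is at least 1 and at least s N /
    2; up to N0, B is so large that the trivial bound 2 suffices.\<close>
  define N0 where "N0 = nat \<lceil>2 / s\<rceil>"
  define B where "B = max (2 * real (Suc N0) powr b) (C * (s / 2) powr - b * 2 / c)"
  have B: "0 < B" "2 * real (Suc N0) powr b \<le> B" "C * (s / 2) powr - b * 2 / c \<le> B"
    by (auto simp: B_def less_max_iff_disj)
  have main: "\<forall>N\<ge>1. D N (B * real N powr - b)" if D2: "\<And>N. D N 2"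
    and Dm: "\<And>N x y. D N x \<Longrightarrow> x \<le> y \<Longrightarrow> D N y"
    and Ds: "\<And>n N x. 1 \<le> n \<Longrightarrow> 0 \<le> x \<Longrightarrow> D N x \<Longrightarrow> D (n + N) (C * real n powr - b + (1 - c) * x)"
    for D :: "nat \<Rightarrow> real \<Rightarrow> bool"
  proof (intro allI impI)
    fix N :: nat assume "1 \<le> N"
    then show "D N (B * real N powr - b)"
    proof (induction N rule: less_induct)
      case (less N)
      show ?case
      proof (cases "N \<le> N0")
        case True
        have "real N powr b \<le> real (Suc N0) powr b" using True b by (intro powr_mono2) auto
        then have "2 * real N powr b \<le> B" using B(2) by linarith
        then have "2 * real N powr b * real N powr - b \<le> B * real N powr - b" by (intro mult_right_mono) auto
        then have "2 \<le> B * real N powr - b" using less.prems by (simp add: mult.assoc flip: powr_add)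
        with D2 show ?thesis by (rule Dm)
      next
        case False
        then have NN: "2 / s \<le> real N" by (simp add: N0_def) linarith
        define n where "n = nat \<lfloor>s * real N\<rfloor>"
        have sN: "2 \<le> s * real N" using NN s by (simp add: field_simps)
        have n1: "real n \<le> s * real N" "s * real N - 1 \<le> real n" using sN by (auto simp: n_def)
        have n: "1 \<le> n" "s / 2 * real N \<le> real n" using n1 sN by linarith+
        have "s * real N < 1 * real N" using s less.prems by (intro mult_strict_right_mono) auto
        then have nN: "n < N" using n1 by linarith
        define N' where "N' = N - n"
        have N': "n + N' = N" "1 \<le> N'" "N' < N" using nN n by (auto simp: N'_def)
        have tN: "t * real N \<le> real N'" using n1 nN by (simp add: N'_def s_def of_nat_diff algebra_simps)
        have "D (n + N') (C * real n powr - b + (1 - c) * (B * real N' powr - b))"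
          using less.IH[OF N'(3,2)] B by (intro Ds n) auto
        moreover have "C * real n powr - b + (1 - c) * (B * real N' powr - b) \<le> B * real N powr - b"
        proof -
          have "real n powr - b \<le> (s / 2 * real N) powr - b" using n s b less.prems by (intro powr_mono2') auto
          also have "\<dots> = (s / 2) powr - b * real N powr - b" by (rule powr_mult)
          finally have 1: "C * real n powr - b \<le> C * ((s / 2) powr - b * real N powr - b)"
            using C by (intro mult_left_mono) auto
          have "real N' powr - b \<le> (t * real N) powr - b" using tN t0 b less.prems by (intro powr_mono2') auto
          also have "\<dots> = t powr - b * real N powr - b" by (rule powr_mult)
          finally have 2: "(1 - c) * (B * real N' powr - b) \<le> (1 - c) * (B * (t powr - b * real N powr - b))"
            using c B by (intro mult_left_mono) auto
          have "(1 - c) * (B * (t powr - b * real N powr - b)) = ((1 - c) * t powr - b) * (B * real N powr - b)" by simp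
          also have "\<dots> = (1 - c / 2) * (B * real N powr - b)" by (simp only: tb)
          finally have 3: "(1 - c) * (B * (t powr - b * real N powr - b)) = (1 - c / 2) * (B * real N powr - b)" .
          have "C * (s / 2) powr - b \<le> B * (c / 2)" using B(3) c by (simp add: field_simps)
          then have "C * (s / 2) powr - b * real N powr - b \<le> B * (c / 2) * real N powr - b" by (intro mult_right_mono) auto
          then show ?thesis using 1 2 unfolding 3 by (simp add: algebra_simps)
        qed
        ultimately show ?thesis unfolding N'(1) by (rule Dm)
      qed
    qed
  qed
  show ?thesis
  proof (intro exI[of _ B] conjI B(1) allI impI)
    fix D :: "nat \<Rightarrow> real \<Rightarrow> bool" and N :: nat
    assume D: "\<forall>N. D N 2" "\<forall>N x y. D N x \<longrightarrow> x \<le> y \<longrightarrow> D N y"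
      "\<forall>n N x. 1 \<le> n \<longrightarrow> 0 \<le> x \<longrightarrow> D N x \<longrightarrow> D (n + N) (C * real n powr - b + (1 - c) * x)"
      and N: "1 \<le> N"
    show "D N (B * real N powr - b)"
      by (rule main[rule_format, OF D(1)[rule_format] D(2)[rule_format] D(3)[rule_format] N])
  qed
qed

context random_lsv
begin

text \<open>Stated relative to the common mass m, so that it applies again to the uncoupled
  remainders, whose mass has shrunk.\<close>

definition contracts :: "nat \<Rightarrow> real \<Rightarrow> bool" where
  "contracts N B \<longleftrightarrow> (\<forall>f g m. 0 \<le> m \<longrightarrow> normal_cone \<alpha> m f \<longrightarrow> normal_cone \<alpha> m g \<longrightarrow>
     (LINT x|lam. \<bar>(transfer ^^ N) f x - (transfer ^^ N) g x\<bar>) \<le> B * m)"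

lemma transfer_pow_add: "(transfer ^^ n) (\<lambda>x. u x + v x) x = (transfer ^^ n) u x + (transfer ^^ n) v x"
  using transfer_pow_linear[of n 1 u 1 v x] by simp

lemma transfer_pow_diff: "(transfer ^^ n) (\<lambda>x. u x - v x) x = (transfer ^^ n) u x - (transfer ^^ n) v x"
  using transfer_pow_linear[of n 1 u "-1" v x] by simp

lemma transfer_pow_scale: "(transfer ^^ n) (\<lambda>x. c * u x) x = c * (transfer ^^ n) u x"
  using transfer_pow_linear[of n c u 0 u x] by simp

lemma normal_cone_abs_integral:
  assumes "normal_cone \<alpha> m f" shows "(LINT x|lam. \<bar>(transfer ^^ N) f x\<bar>) \<le> m"
proof -
  have f: "integrable lam f" "regular (2 * (1 + \<alpha>)) f" "integral\<^sup>L lam f = m"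
    using assms by (auto simp: normal_cone_def dest: coneD)
  have "(LINT x|lam. \<bar>(transfer ^^ N) f x\<bar>) \<le> (LINT x|lam. \<bar>f x\<bar>)"
    by (rule transfer_pow_contract[OF f(1)])
  also have "\<dots> \<le> (LINT x|lam. f x)"
    using f regularD(1)[OF f(2)] by (intro integral_lam_mono) auto
  finally show ?thesis using f by simp
qed

lemma contracts_2: "contracts N 2"
  unfolding contracts_def
proof (intro allI impI)
  fix f g m assume f: "normal_cone \<alpha> m f" and g: "normal_cone \<alpha> m g"
  have i: "integrable lam ((transfer ^^ N) f)" "integrable lam ((transfer ^^ N) g)"
    using f g by (auto simp: normal_cone_def intro!: transfer_pow_integrable dest: coneD)
  have "(LINT x|lam. \<bar>(transfer ^^ N) f x - (transfer ^^ N) g x\<bar>)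
    \<le> (LINT x|lam. \<bar>(transfer ^^ N) f x\<bar> + \<bar>(transfer ^^ N) g x\<bar>)"
    using i by (intro integral_lam_mono) auto
  also have "\<dots> = (LINT x|lam. \<bar>(transfer ^^ N) f x\<bar>) + (LINT x|lam. \<bar>(transfer ^^ N) g x\<bar>)"
    using i by (intro Bochner_Integration.integral_add) auto
  finally show "(LINT x|lam. \<bar>(transfer ^^ N) f x - (transfer ^^ N) g x\<bar>) \<le> 2 * m"
    using normal_cone_abs_integral[OF f, of N] normal_cone_abs_integral[OF g, of N] by linarith
qed

lemma contracts_weaken: "contracts N x \<Longrightarrow> x \<le> y \<Longrightarrow> contracts N y"
  unfolding contracts_def by (meson mult_right_mono order_trans)

text \<open>Flattening at the cutoff, rescaling to the prescribed mass (1 - loss) m and n steps of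
  the transfer operator lead to a density bounded below by \<open>cone_bulk_lower\<close>. The
  subtracted constant depends on m and n but not on f, so two densities of equal mass lose the same
  function; the error is the mass given up before the n steps.\<close>

lemma coupling_stage:
  assumes f: "normal_cone \<alpha> m f" and m: "0 \<le> m" and small: "loss \<alpha> n \<le> 1/4"
  defines "m' \<equiv> (1 - loss \<alpha> n) * m"
  obtains f' where "normal_cone \<alpha> ((1 - coupling \<alpha>) * m') f'"
    "(LINT x|lam. \<bar>(transfer ^^ n) f x - (coupling \<alpha> * m' + f' x)\<bar>) \<le> loss \<alpha> n * m"
proof -
  interpret prob_space lam by (rule prob_space_lam)
  let ?e = "cutoff \<alpha> n" and ?c = "coupling \<alpha>"
  have e: "0 < ?e" "?e \<le> 1" using cutoff_pos[OF \<alpha>] loss_small_imp_cutoff[OF \<alpha> small] by auto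
  have fc: "cone \<alpha> (2 * (1 + \<alpha>)) (3 * astar \<alpha> * m) f" and fm: "integral\<^sup>L lam f = m"
    using f by (auto simp: normal_cone_def)
  have a3: "3 \<le> astar \<alpha>" by (rule astar_ge3[OF \<alpha>])
  have m': "0 \<le> m'" "3/4 * m \<le> m'"
  proof -
    have "3/4 * m \<le> (1 - loss \<alpha> n) * m" using small m by (intro mult_right_mono) auto
    then show "3/4 * m \<le> m'" by (simp add: m'_def)
    then show "0 \<le> m'" using m by linarith
  qed
  define ft where "ft = (\<lambda>x. f (max x ?e))"
  define mt where "mt = integral\<^sup>L lam ft"
  have K: "0 \<le> 2 * (1 + \<alpha>)" using \<alpha> by simp
  note tr = cone_truncate[OF \<alpha> fc K e, folded ft_def]
  have mt: "m' \<le> mt" "mt \<le> m"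
    using tr(2,3) fm by (auto simp: mt_def ft_def m'_def loss_def algebra_simps)
  \<comment> \<open>The mass mt left by flattening depends on f and lies between m' and m; rescaling
    to m' makes it common to all densities of mass m. If mt = 0, then m' = 0 and the quotient 0 is
    the right value.\<close>
  define s where "s = m' / mt"
  have s: "0 \<le> s" "s \<le> 1" "s * mt = m'"
    using mt m' by (auto simp: s_def divide_le_eq_1)
  define fh where "fh = (\<lambda>x. s * ft x)"
  have "s * (3 * astar \<alpha> * m) \<le> 1 * (3 * astar \<alpha> * m)" using s m a3 by (intro mult_right_mono) auto
  also have "\<dots> \<le> 4 * astar \<alpha> * m'" using mult_left_mono[OF m'(2), of "4 * astar \<alpha>"] a3 by simp
  finally have fhc: "cone \<alpha> (2 * (1 + \<alpha>)) (4 * astar \<alpha> * m') fh"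
    unfolding fh_def by (intro cone_scale[OF tr(1)[folded ft_def] s(1)])
  have fhm: "integral\<^sup>L lam fh = m'" using s by (simp add: fh_def mt_def)
  define g where "g = (transfer ^^ n) fh"
  have gc: "cone \<alpha> (1 + \<alpha>) (2 * astar \<alpha> * m') g"
    unfolding g_def by (rule recover_cone[OF fhc fhm m'(1) e(2)]) (auto simp: fh_def ft_def max_def)
  have gi: "integrable lam g" and gm: "integral\<^sup>L lam g = m'"
    using coneD(1)[OF gc] transfer_pow_integral[OF coneD(1)[OF fhc], of n] fhm by (auto simp: g_def)
  define f' where "f' = (\<lambda>x. g x - ?c * m')"
  have cb: "0 < ?c" "?c \<le> 1/4" using coupling_bounds[OF \<alpha>] by auto
  have f'i: "integrable lam f'" unfolding f'_def using gi by auto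
  have f'm: "integral\<^sup>L lam f' = (1 - ?c) * m'" unfolding f'_def using gi gm prob_space by (simp add: algebra_simps)
  have "cone \<alpha> (2 * (1 + \<alpha>)) (3 * astar \<alpha> * ((1 - ?c) * m')) f'"
    unfolding cone_def
  proof (intro conjI ballI f'i)
    show "regular (2 * (1 + \<alpha>)) f'"
      unfolding f'_def using cb m' \<alpha> cone_bulk_lower[OF \<alpha> gc gm] by (intro regular_subtract coneD(2)[OF gc]) auto
    fix x :: real assume x: "x \<in> {0<..1}"
    have "f' x \<le> g x" using cb m' by (simp add: f'_def)
    also have "\<dots> \<le> 2 * astar \<alpha> * m' * x powr - \<alpha>" using x by (intro coneD(3)[OF gc]) auto
    also have "\<dots> \<le> 3 * astar \<alpha> * ((1 - ?c) * m') * x powr - \<alpha>"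
    proof (rule mult_right_mono)
      have "2 * (astar \<alpha> * m') \<le> 3 * (1 - ?c) * (astar \<alpha> * m')"
        using cb m' a3 by (intro mult_right_mono) auto
      then show "2 * astar \<alpha> * m' \<le> 3 * astar \<alpha> * ((1 - ?c) * m')" by (simp add: mult_ac)
    qed simp
    finally show "f' x \<le> 3 * astar \<alpha> * ((1 - ?c) * m') * x powr - \<alpha>" .
  qed
  then have nc: "normal_cone \<alpha> ((1 - ?c) * m') f'" using f'm by (simp add: normal_cone_def)
  have fi: "integrable lam f" "integrable lam fh" using fc fhc by (auto dest: coneD)
  have "(LINT x|lam. \<bar>(transfer ^^ n) f x - (?c * m' + f' x)\<bar>) = (LINT x|lam. \<bar>(transfer ^^ n) (\<lambda>x. f x - fh x) x\<bar>)"
    by (simp add: f'_def g_def transfer_pow_diff)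
  also have "\<dots> \<le> (LINT x|lam. \<bar>f x - fh x\<bar>)"
    using fi by (intro transfer_pow_contract) auto
  also have "\<dots> \<le> (LINT x|lam. f x - fh x)"
  proof (rule integral_lam_mono)
    fix x :: real assume x: "0 < x" "x \<le> 1"
    have "fh x \<le> 1 * ft x" unfolding fh_def
      using s x e by (intro mult_right_mono) (auto simp: ft_def intro!: regularD(1)[OF coneD(2)[OF fc]])
    also have "\<dots> \<le> f x" using tr(4)[OF x] by (simp add: ft_def)
    finally show "\<bar>f x - fh x\<bar> \<le> f x - fh x" by simp
  qed (use fi in auto)
  also have "\<dots> = loss \<alpha> n * m" using fi fm fhm by (simp add: m'_def algebra_simps)
  finally show ?thesis using that nc by blast
qed

text \<open>The constants subtracted from f and g cancel. There remain two errors, together at most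
  2 loss m, and two remainders of equal mass to which the hypothesis applies. The factor 8 also
  covers a loss above 1/4, where the claim is weaker than the trivial bound 2.\<close>

lemma contracts_step:
  assumes B: "contracts N B" "0 \<le> B"
  shows "contracts (n + N) (8 * loss \<alpha> n + (1 - coupling \<alpha>) * B)"
proof (cases "loss \<alpha> n \<le> 1/4")
  case False
  moreover have "0 \<le> (1 - coupling \<alpha>) * B" using B(2) coupling_bounds[OF \<alpha>] by simp
  ultimately have "2 \<le> 8 * loss \<alpha> n + (1 - coupling \<alpha>) * B" by linarith
  then show ?thesis using contracts_2 contracts_weaken by blast
next
  case True
  let ?l = "loss \<alpha> n" and ?c = "coupling \<alpha>"
  have l0: "0 \<le> ?l" by (rule loss_nonneg[OF \<alpha>])
  show ?thesis unfolding contracts_def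
  proof (intro allI impI)
    fix f g m assume m: "0 \<le> m" and f: "normal_cone \<alpha> m f" and g: "normal_cone \<alpha> m g"
    define m' where "m' = (1 - ?l) * m"
    have m': "0 \<le> m'" "m' \<le> m" using True m l0 by (auto simp: m'_def intro: mult_left_le_one_le)
    obtain f' where f': "normal_cone \<alpha> ((1 - ?c) * m') f'"
      "(LINT x|lam. \<bar>(transfer ^^ n) f x - (?c * m' + f' x)\<bar>) \<le> ?l * m"
      using coupling_stage[OF f m True] unfolding m'_def by blast
    obtain g' where g': "normal_cone \<alpha> ((1 - ?c) * m') g'"
      "(LINT x|lam. \<bar>(transfer ^^ n) g x - (?c * m' + g' x)\<bar>) \<le> ?l * m"
      using coupling_stage[OF g m True] unfolding m'_def by blast
    interpret prob_space lam by (rule prob_space_lam)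
    have i: "integrable lam f" "integrable lam g" "integrable lam f'" "integrable lam g'"
      using f g f' g' by (auto simp: normal_cone_def dest: coneD)
    define df where "df = (\<lambda>x. (transfer ^^ n) f x - (?c * m' + f' x))"
    define dg where "dg = (\<lambda>x. (transfer ^^ n) g x - (?c * m' + g' x))"
    have di: "integrable lam df" "integrable lam dg"
      unfolding df_def dg_def using i transfer_pow_integrable by auto
    have eq: "(transfer ^^ (n + N)) f x - (transfer ^^ (n + N)) g x =
      (transfer ^^ N) df x - (transfer ^^ N) dg x + ((transfer ^^ N) f' x - (transfer ^^ N) g' x)" for x
    proof -
      have "(\<lambda>x. (transfer ^^ n) f x - (transfer ^^ n) g x) = (\<lambda>x. df x - dg x + (f' x - g' x))"
        by (auto simp: df_def dg_def)
      then have "(transfer ^^ N) (\<lambda>x. (transfer ^^ n) f x - (transfer ^^ n) g x) x =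
        (transfer ^^ N) (\<lambda>x. df x - dg x + (f' x - g' x)) x" by simp
      then show ?thesis unfolding transfer_pow_add transfer_pow_diff
        by (simp add: add.commute[of n N] funpow_add)
    qed
    let ?t = "transfer ^^ N"
    have ti: "integrable lam (?t df)" "integrable lam (?t dg)" "integrable lam (?t f')" "integrable lam (?t g')"
      using i di by (auto intro: transfer_pow_integrable)
    have "(LINT x|lam. \<bar>(transfer ^^ (n + N)) f x - (transfer ^^ (n + N)) g x\<bar>)
      \<le> (LINT x|lam. \<bar>?t df x\<bar> + \<bar>?t dg x\<bar> + \<bar>?t f' x - ?t g' x\<bar>)"
      unfolding eq using ti by (intro integral_lam_mono) auto
    also have "\<dots> = (LINT x|lam. \<bar>?t df x\<bar>) + (LINT x|lam. \<bar>?t dg x\<bar>) + (LINT x|lam. \<bar>?t f' x - ?t g' x\<bar>)"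
      using ti by simp
    also have "\<dots> \<le> ?l * m + ?l * m + B * ((1 - ?c) * m')"
    proof (intro add_mono)
      show "(LINT x|lam. \<bar>?t df x\<bar>) \<le> ?l * m"
        using transfer_pow_contract[OF di(1), of N] f'(2) by (simp add: df_def)
      show "(LINT x|lam. \<bar>?t dg x\<bar>) \<le> ?l * m"
        using transfer_pow_contract[OF di(2), of N] g'(2) by (simp add: dg_def)
      show "(LINT x|lam. \<bar>?t f' x - ?t g' x\<bar>) \<le> B * ((1 - ?c) * m')"
        using B(1) f'(1) g'(1) m' coupling_bounds[OF \<alpha>] unfolding contracts_def by auto
    qed
    also have "\<dots> \<le> (8 * ?l + (1 - ?c) * B) * m"
    proof -
      have "B * ((1 - ?c) * m') \<le> B * ((1 - ?c) * m)"
        using B(2) m' coupling_bounds[OF \<alpha>] by (intro mult_left_mono) auto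
      moreover have "0 \<le> ?l * m" using l0 m by simp
      ultimately show ?thesis by (simp add: algebra_simps)
    qed
    finally show "(LINT x|lam. \<bar>(transfer ^^ (n + N)) f x - (transfer ^^ (n + N)) g x\<bar>)
      \<le> (8 * ?l + (1 - ?c) * B) * m" .
  qed
qed

end

text \<open>\<open>loss\<close> and \<open>coupling\<close> are functions of \<alpha>, so the
  recursion, and with it B, is fixed before \<Omega> and P.\<close>

lemma uniform_contraction:
  assumes \<alpha>: "0 < \<alpha>" "\<alpha> < 1"
  shows "\<exists>B>0. \<forall>\<Omega> P. random_lsv \<alpha> \<Omega> P \<longrightarrow>
    (\<forall>N\<ge>1. random_lsv.contracts \<alpha> \<Omega> P N (B * real N powr (1 - 1 / \<alpha>)))"
proof -
  obtain C where C: "0 < C" "\<And>n. 1 \<le> n \<Longrightarrow> loss \<alpha> n \<le> C * real n powr (1 - 1 / \<alpha>)"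
    using loss_decay[OF \<alpha>] by auto
  have b: "0 < 1 / \<alpha> - 1" using \<alpha> by (simp add: field_simps)
  have c: "0 < coupling \<alpha>" "coupling \<alpha> < 1" using coupling_bounds[OF \<alpha>] by auto
  obtain B where B: "0 < B" "\<And>D :: nat \<Rightarrow> real \<Rightarrow> bool. (\<forall>N. D N 2) \<Longrightarrow> (\<forall>N x y. D N x \<longrightarrow> x \<le> y \<longrightarrow> D N y) \<Longrightarrow>
    (\<forall>n N x. 1 \<le> n \<longrightarrow> 0 \<le> x \<longrightarrow> D N x \<longrightarrow> D (n + N) (8 * C * real n powr - (1 / \<alpha> - 1) + (1 - coupling \<alpha>) * x)) \<Longrightarrow>
    (\<forall>N\<ge>1. D N (B * real N powr - (1 / \<alpha> - 1)))"
    using polynomial_decay_recursion[OF b c, of "8 * C"] C(1) by auto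
  show ?thesis
  proof (intro exI[of _ B] conjI B(1) allI impI)
    fix \<Omega> P and N :: nat assume "random_lsv \<alpha> \<Omega> P" and N: "1 \<le> N"
    then interpret random_lsv \<alpha> \<Omega> P by simp
    have "\<forall>N\<ge>1. contracts N (B * real N powr - (1 / \<alpha> - 1))"
    proof (rule B(2); intro allI impI)
      show "contracts N 2" for N by (rule contracts_2)
      show "contracts N x \<Longrightarrow> x \<le> y \<Longrightarrow> contracts N y" for N x y by (rule contracts_weaken)
      show "contracts (n + N) (8 * C * real n powr - (1 / \<alpha> - 1) + (1 - coupling \<alpha>) * x)"
        if "1 \<le> n" "0 \<le> x" "contracts N x" for n N x
        using contracts_step[OF that(3,2), of n] C(2)[OF that(1)] by (elim contracts_weaken) simp
    qed
    then show "contracts N (B * real N powr (1 - 1 / \<alpha>))" using N by simp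
  qed
qed

section \<open>Lipschitz observables\<close>

lemma C1_unit_bounds:
  assumes "C1_unit \<phi>"
  shows "0 \<le> C1_norm \<phi>" "\<And>x. x \<in> {0..1} \<Longrightarrow> \<bar>\<phi> x\<bar> \<le> C1_norm \<phi>"
    "(C1_norm \<phi>)-lipschitz_on {0..1} \<phi>"
proof -
  have d: "\<phi> differentiable_on {0..1}" and c': "continuous_on {0..1} (unit_deriv \<phi>)"
    using assms by (auto simp: C1_unit_def)
  have bdd: "bdd_above ((\<lambda>x. \<bar>f x\<bar>) ` {0..1})" if "continuous_on {0..1} f" for f :: "real \<Rightarrow> real"
    using that by (intro bounded_imp_bdd_above compact_imp_bounded compact_continuous_image continuous_intros) auto
  have b1: "\<bar>\<phi> x\<bar> \<le> (SUP x\<in>{0..1}. \<bar>\<phi> x\<bar>)" and b2: "\<bar>unit_deriv \<phi> x\<bar> \<le> (SUP x\<in>{0..1}. \<bar>unit_deriv \<phi> x\<bar>)"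
    if "x \<in> {0..1}" for x
    using that bdd[OF differentiable_imp_continuous_on[OF d]] bdd[OF c'] by (auto intro: cSUP_upper)
  have n: "0 \<le> (SUP x\<in>{0..1}. \<bar>\<phi> x\<bar>)" "0 \<le> (SUP x\<in>{0..1}. \<bar>unit_deriv \<phi> x\<bar>)"
    using b1[of 0] b2[of 0] by auto
  show "0 \<le> C1_norm \<phi>" using n by (simp add: C1_norm_def)
  show "\<bar>\<phi> x\<bar> \<le> C1_norm \<phi>" if "x \<in> {0..1}" for x using b1[OF that] n by (simp add: C1_norm_def)
  show "(C1_norm \<phi>)-lipschitz_on {0..1} \<phi>"
  proof (rule lipschitz_onI)
    fix x y :: real assume xy: "x \<in> {0..1}" "y \<in> {0..1}"
    have "norm (\<phi> x - \<phi> y) \<le> C1_norm \<phi> * norm (x - y)"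
    proof (rule field_differentiable_bound[OF _ _ _ xy])
      fix z :: real assume z: "z \<in> {0..1}"
      have "(\<phi> has_vector_derivative unit_deriv \<phi> z) (at z within {0..1})"
        unfolding unit_deriv_def using d z by (subst vector_derivative_works[symmetric]) (auto simp: differentiable_on_def)
      then show "(\<phi> has_field_derivative unit_deriv \<phi> z) (at z within {0..1})"
        by (simp add: has_real_derivative_iff_has_vector_derivative)
      show "norm (unit_deriv \<phi> z) \<le> C1_norm \<phi>" using b2[OF z] n by (simp add: C1_norm_def)
    qed simp
    then show "dist (\<phi> x) (\<phi> y) \<le> C1_norm \<phi> * dist x y" by (simp add: dist_real_def)
  qed fact
qed

section \<open>Density of Lipschitz functions in L^1, to be applied to the stationary
  density\<close>

definition lipschitz_approx :: "(real \<Rightarrow> real) \<Rightarrow> bool" where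
  "lipschitz_approx h \<longleftrightarrow> integrable lam h \<and>
     (\<forall>e>0. \<exists>g M. M-lipschitz_on {0..1} g \<and> (LINT x|lam. \<bar>h x - g x\<bar>) < e)"

lemma lipschitz_borel:
  assumes "M-lipschitz_on {0..1} (g :: real \<Rightarrow> real)" shows "g \<in> borel_measurable lam"
  using borel_measurable_continuous_on_restrict[OF lipschitz_on_continuous_on[OF assms]]
  by (simp cong: measurable_cong_sets add: sets_lam)

lemma lipschitz_integrable:
  assumes "M-lipschitz_on {0..1} (g :: real \<Rightarrow> real)" shows "integrable lam g"
proof -
  have "compact (g ` {0..1})"
    using lipschitz_on_continuous_on[OF assms] by (intro compact_continuous_image) auto
  then obtain B where "\<forall>y\<in>g ` {0..1}. \<bar>y\<bar> \<le> B"
    by (auto dest!: compact_imp_bounded simp: bounded_real)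
  then show ?thesis by (intro integrable_lam_bounded[of _ B] lipschitz_borel[OF assms]) auto
qed

lemma lipschitz_approx_closed:
  assumes h: "integrable lam h"
    and k: "\<And>e. 0 < e \<Longrightarrow> \<exists>k. lipschitz_approx k \<and> (LINT x|lam. \<bar>h x - k x\<bar>) < e"
  shows "lipschitz_approx h"
  unfolding lipschitz_approx_def
proof (intro conjI h allI impI)
  fix e :: real assume e: "0 < e"
  then obtain k where k: "lipschitz_approx k" "(LINT x|lam. \<bar>h x - k x\<bar>) < e / 2"
    using k[of "e / 2"] by auto
  then obtain g M where g: "M-lipschitz_on {0..1} g" "(LINT x|lam. \<bar>k x - g x\<bar>) < e / 2"
    unfolding lipschitz_approx_def using e by (meson half_gt_zero)
  have i: "integrable lam k" "integrable lam g"
    using k lipschitz_integrable[OF g(1)] by (auto simp: lipschitz_approx_def)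
  have "(LINT x|lam. \<bar>h x - g x\<bar>) \<le> (LINT x|lam. \<bar>h x - k x\<bar> + \<bar>k x - g x\<bar>)"
    using h i by (intro integral_lam_mono) auto
  also have "\<dots> = (LINT x|lam. \<bar>h x - k x\<bar>) + (LINT x|lam. \<bar>k x - g x\<bar>)" using h i by simp
  also have "\<dots> < e" using k g by simp
  finally show "\<exists>g M. M-lipschitz_on {0..1} g \<and> (LINT x|lam. \<bar>h x - g x\<bar>) < e" using g by blast
qed

lemma lipschitz_approx_lim:
  assumes s: "\<And>i. lipschitz_approx (s i)" and h: "integrable lam h" and w: "integrable lam w"
    and lim: "\<And>x. x \<in> {0..1} \<Longrightarrow> (\<lambda>i. s i x) \<longlonglongrightarrow> h x"
    and bd: "\<And>i x. x \<in> {0..1} \<Longrightarrow> \<bar>s i x\<bar> \<le> w x"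
  shows "lipschitz_approx h"
proof (rule lipschitz_approx_closed[OF h])
  fix e :: real assume e: "0 < e"
  have si: "integrable lam (s i)" for i using s by (auto simp: lipschitz_approx_def)
  have "(\<lambda>i. LINT x|lam. \<bar>h x - s i x\<bar>) \<longlonglongrightarrow> (LINT x|lam. 0)"
  proof (rule integral_dominated_convergence[where w = "\<lambda>x. \<bar>h x\<bar> + w x"])
    show "AE x in lam. (\<lambda>i. \<bar>h x - s i x\<bar>) \<longlonglongrightarrow> 0"
    proof (rule AE_I2)
      fix x assume "x \<in> space lam"
      then have "(\<lambda>i. \<bar>h x - s i x\<bar>) \<longlonglongrightarrow> \<bar>h x - h x\<bar>" using lim by (intro tendsto_intros) auto
      then show "(\<lambda>i. \<bar>h x - s i x\<bar>) \<longlonglongrightarrow> 0" by simp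
    qed
    show "AE x in lam. norm \<bar>h x - s i x\<bar> \<le> \<bar>h x\<bar> + w x" for i
    proof (rule AE_I2)
      fix x assume "x \<in> space lam"
      then show "norm \<bar>h x - s i x\<bar> \<le> \<bar>h x\<bar> + w x" using bd[of x i] by auto
    qed
  qed (use h w si in auto)
  then have "\<forall>\<^sub>F i in sequentially. (LINT x|lam. \<bar>h x - s i x\<bar>) < e"
    using e by (intro order_tendstoD) auto
  then obtain i where "(LINT x|lam. \<bar>h x - s i x\<bar>) < e" by (auto simp: eventually_sequentially)
  then show "\<exists>k. lipschitz_approx k \<and> (LINT x|lam. \<bar>h x - k x\<bar>) < e" using s by blast
qed

lemma lipschitz_approx_lipschitz:
  assumes "M-lipschitz_on {0..1} g" shows "lipschitz_approx g"
  unfolding lipschitz_approx_def using assms lipschitz_integrable by (auto intro!: exI[of _ g] exI[of _ M])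

text \<open>The positive parts of 1 - i dist(x, T) are i-Lipschitz, bounded by 1, and converge to
  the indicator because T is closed.\<close>

lemma lipschitz_approx_closed_set:
  assumes T: "closed T" shows "lipschitz_approx (indicator T)"
proof (cases "T = {}")
  case True
  have "0-lipschitz_on {0..1} (indicator T :: real \<Rightarrow> real)" using True by (auto simp: lipschitz_on_def)
  then show ?thesis by (rule lipschitz_approx_lipschitz)
next
  case False
  interpret prob_space lam by (rule prob_space_lam)
  define s where "s = (\<lambda>(i::nat) x. max 0 (1 - real i * infdist x T))"
  show ?thesis
  proof (rule lipschitz_approx_lim[where s = s and w = "\<lambda>_. 1"])
    fix i
    have "(real i)-lipschitz_on {0..1} (s i)"
    proof (rule lipschitz_onI)
      fix x y :: real
      have "\<bar>infdist x T - infdist y T\<bar> \<le> dist x y" by (rule infdist_triangle_abs)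
      then have "real i * \<bar>infdist x T - infdist y T\<bar> \<le> real i * dist x y" by (intro mult_left_mono) auto
      moreover have "\<bar>real i * infdist x T - real i * infdist y T\<bar> = real i * \<bar>infdist x T - infdist y T\<bar>"
        by (simp add: abs_mult flip: right_diff_distrib)
      ultimately show "dist (s i x) (s i y) \<le> real i * dist x y"
        unfolding s_def dist_real_def by linarith
    qed simp
    then show "lipschitz_approx (s i)" by (rule lipschitz_approx_lipschitz)
  next
    fix x :: real
    show "(\<lambda>i. s i x) \<longlonglongrightarrow> indicator T x"
    proof (cases "x \<in> T")
      case False
      then have "0 < infdist x T" using T \<open>T \<noteq> {}\<close> by (simp add: infdist_pos_not_in_closed)
      then obtain n :: nat where n: "1 < real n * infdist x T" using ex_less_of_nat_mult by blast
      have "s i x = 0" if "n \<le> i" for i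
      proof -
        have "real n * infdist x T \<le> real i * infdist x T" using that by (intro mult_right_mono infdist_nonneg) auto
        then show ?thesis using n by (simp add: s_def)
      qed
      then have "\<forall>\<^sub>F i in sequentially. s i x = 0" by (auto simp: eventually_sequentially)
      then show ?thesis using False by (simp add: tendsto_eventually)
    qed (simp add: s_def)
    fix i show "\<bar>s i x\<bar> \<le> 1" using infdist_nonneg[of x T] by (simp add: s_def)
  next
    have "T \<in> sets borel" using T by auto
    then show "integrable lam (indicator T :: real \<Rightarrow> real)"
      by (intro integrable_lam_bounded[where B = 1] lam_borelI) (auto simp: indicator_def)
  qed simp
qed

lemma lipschitz_dense:
  assumes "integrable lam h" shows "lipschitz_approx h"
  using assms
proof (induction rule: integrable_induct)
  case (base A c)
  interpret prob_space lam by (rule prob_space_lam)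
  have iA: "integrable lam (\<lambda>x. indicator A x *\<^sub>R c)" using base by (auto simp: emeasure_eq_measure)
  show ?case
  proof (rule lipschitz_approx_closed[OF iA])
    fix e :: real assume e: "0 < e"
    have A: "A \<in> sets lborel" "A \<subseteq> {0..1}" using base(1) by (auto simp: sets_restrict_space)
    have "A \<in> sets lebesgue" using A by auto
    \<comment> \<open>Inner regularity replaces A by a closed subset. Dividing by \<bar>c\<bar> + 1
      avoids a separate case c = 0.\<close>
    from sets_lebesgue_inner_closed[OF this, of "e / (\<bar>c\<bar> + 1)"] e
    obtain T where T: "closed T" "T \<subseteq> A" "A - T \<in> lmeasurable" "emeasure lebesgue (A - T) < ennreal (e / (\<bar>c\<bar> + 1))"
      by (auto simp: add_nonneg_pos)
    have AT: "A - T \<in> sets lborel" using A T by auto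
    then have "measure lam (A - T) = measure lborel (A - T)" using A by (subst measure_restrict_space) auto
    also have "\<dots> < e / (\<bar>c\<bar> + 1)"
    proof -
      have *: "emeasure lborel (A - T) < ennreal (e / (\<bar>c\<bar> + 1))" using T(4) AT by simp
      then have "emeasure lborel (A - T) \<noteq> \<top>" by auto
      then have "emeasure lborel (A - T) = ennreal (measure lborel (A - T))" by (rule emeasure_eq_ennreal_measure)
      with * show ?thesis by (simp add: ennreal_less_iff)
    qed
    finally have m: "measure lam (A - T) * (\<bar>c\<bar> + 1) < e" by (simp add: field_simps)
    have tl: "lipschitz_approx (\<lambda>x. indicator T x *\<^sub>R c)"
      unfolding lipschitz_approx_def
    proof (intro conjI allI impI)
      have T1: "lipschitz_approx (indicator T)" by (rule lipschitz_approx_closed_set[OF T(1)])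
      then show "integrable lam (\<lambda>x. indicat_real T x *\<^sub>R c)" by (simp add: lipschitz_approx_def)
      fix d :: real assume d: "0 < d"
      then have "0 < d / (\<bar>c\<bar> + 1)" by (simp add: add_nonneg_pos)
      then obtain g M where g: "M-lipschitz_on {0..1} g" "(LINT x|lam. \<bar>indicator T x - g x\<bar>) < d / (\<bar>c\<bar> + 1)"
        using T1 unfolding lipschitz_approx_def by blast
      have "(LINT x|lam. \<bar>indicator T x *\<^sub>R c - c * g x\<bar>) = \<bar>c\<bar> * (LINT x|lam. \<bar>indicator T x - g x\<bar>)"
        by (simp add: mult.commute[of _ c] flip: right_diff_distrib) (simp add: abs_mult)
      also have "\<dots> \<le> (\<bar>c\<bar> + 1) * (LINT x|lam. \<bar>indicator T x - g x\<bar>)" by (intro mult_right_mono) auto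
      also have "\<dots> < d" using g(2) by (simp add: field_simps add_nonneg_pos)
      finally have "(LINT x|lam. \<bar>indicator T x *\<^sub>R c - c * g x\<bar>) < d" .
      moreover have "(\<bar>c\<bar> * M)-lipschitz_on {0..1} (\<lambda>x. c * g x)"
        using g(1) by (rule lipschitz_on_cmult_real)
      ultimately show "\<exists>g M. M-lipschitz_on {0..1} g \<and> (LINT x|lam. \<bar>indicator T x *\<^sub>R c - g x\<bar>) < d" by blast
    qed
    have "(LINT x|lam. \<bar>indicator A x *\<^sub>R c - indicator T x *\<^sub>R c\<bar>) = (LINT x|lam. \<bar>c\<bar> * indicator (A - T) x)"
      using T(2) by (intro integral_lam_cong) (auto simp: indicator_def)
    also have "\<dots> = \<bar>c\<bar> * measure lam (A - T)"
    proof -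
      have "(A - T) \<inter> {0..1} = A - T" using A(2) by auto
      then show ?thesis by simp
    qed
    also have "\<dots> \<le> measure lam (A - T) * (\<bar>c\<bar> + 1)" by (simp add: algebra_simps)
    also note m
    finally show "\<exists>k. lipschitz_approx k \<and> (LINT x|lam. \<bar>indicator A x *\<^sub>R c - k x\<bar>) < e" using tl by blast
  qed
next
  case (add f g)
  show ?case unfolding lipschitz_approx_def
  proof (intro conjI allI impI)
    fix e :: real assume "0 < e"
    then obtain f' M g' M' where *: "M-lipschitz_on {0..1} f'" "(LINT x|lam. \<bar>f x - f' x\<bar>) < e / 2"
      "M'-lipschitz_on {0..1} g'" "(LINT x|lam. \<bar>g x - g' x\<bar>) < e / 2"
      using add(3,4) unfolding lipschitz_approx_def by (meson half_gt_zero)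
    note i = add(1,2) lipschitz_integrable[OF *(1)] lipschitz_integrable[OF *(3)]
    have "(LINT x|lam. \<bar>f x + g x - (f' x + g' x)\<bar>) \<le> (LINT x|lam. \<bar>f x - f' x\<bar> + \<bar>g x - g' x\<bar>)"
      using i by (intro integral_lam_mono) auto
    also have "\<dots> = (LINT x|lam. \<bar>f x - f' x\<bar>) + (LINT x|lam. \<bar>g x - g' x\<bar>)" using i by simp
    also have "\<dots> < e" using * by simp
    finally show "\<exists>ga M. M-lipschitz_on {0..1} ga \<and> (LINT x|lam. \<bar>f x + g x - ga x\<bar>) < e"
      using lipschitz_on_add[OF *(1,3)] by blast
  qed (use add in auto)
next
  case (lim f s)
  show ?case
    by (rule lipschitz_approx_lim[where s = s and w = "\<lambda>x. 2 * norm (f x)"]) (use lim in auto)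
qed

section \<open>Decay of correlations\<close>

context random_lsv
begin

text \<open>These densities replace the stationary one, about which only L^1 information is
  available. With mass 1 and A = \<open>astar \<alpha>\<close>, the invariance condition of
  \<open>transfer_cone\<close> holds with equality.\<close>

lemma density_iterate:
  "cone \<alpha> (1 + \<alpha>) (astar \<alpha>) ((transfer ^^ k) (\<lambda>_. 1))"
  "integral\<^sup>L lam ((transfer ^^ k) (\<lambda>_. 1)) = 1"
proof -
  interpret prob_space lam by (rule prob_space_lam)
  have i: "integrable lam (\<lambda>_::real. 1::real)" by simp
  have m1: "integral\<^sup>L lam (\<lambda>_::real. 1::real) = 1" using prob_space by simp
  show m: "integral\<^sup>L lam ((transfer ^^ k) (\<lambda>_. 1)) = 1" for k
    using transfer_pow_integral[OF i, of k] m1 by simp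
  have a: "3 \<le> astar \<alpha>" by (rule astar_ge3[OF \<alpha>])
  show "cone \<alpha> (1 + \<alpha>) (astar \<alpha>) ((transfer ^^ k) (\<lambda>_. 1))"
  proof (induction k)
    case 0
    show ?case unfolding cone_def
    proof (intro conjI ballI)
      fix x :: real assume x: "x \<in> {0<..1}"
      have "1 \<le> x powr - \<alpha>" using powr_mono2'[of "-\<alpha>" x 1] x \<alpha> by simp
      then have "1 * 1 \<le> astar \<alpha> * x powr - \<alpha>" using a by (intro mult_mono) auto
      then show "(transfer ^^ 0) (\<lambda>_. 1) x \<le> astar \<alpha> * x powr - \<alpha>" by simp
    qed (use \<alpha> i in \<open>auto intro: regular_const\<close>)
  next
    case (Suc k)
    show ?case using transfer_cone[OF Suc] m[of k] a by simp
  qed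
qed

text \<open>Since \<psi> \<ge> 2M decreases with slope at least -2M, x \<psi>(x) increases.
  Splitting x^(2 (1 + \<alpha>)) into x^\<alpha>, x and x^(1 + \<alpha>), the second factor serves
  \<psi> and the third serves f. The size bound uses \<psi> \<le> 5M \<le> 3m, which follows from m
  \<ge> 2M; this is what the ranges of \<psi> are tuned for.\<close>

lemma normal_cone_mult:
  assumes f: "cone \<alpha> (1 + \<alpha>) (astar \<alpha>) f" "integral\<^sup>L lam f = 1" and M: "0 \<le> M"
    and \<psi>: "\<And>x. x \<in> {0..1} \<Longrightarrow> 2 * M \<le> \<psi> x" "\<And>x. x \<in> {0..1} \<Longrightarrow> \<psi> x \<le> 5 * M"
      "\<And>x y. 0 \<le> x \<Longrightarrow> x \<le> y \<Longrightarrow> y \<le> 1 \<Longrightarrow> \<psi> y \<le> \<psi> x \<and> \<psi> x - \<psi> y \<le> 2 * M * (y - x)"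
    and meas: "\<psi> \<in> borel_measurable lam"
  defines "m \<equiv> (LINT x|lam. f x * \<psi> x)"
  shows "normal_cone \<alpha> m (\<lambda>x. f x * \<psi> x)" "2 * M \<le> m" "m \<le> 5 * M"
proof -
  note fi = coneD(1)[OF f(1)] and reg = coneD(2)[OF f(1)]
  have \<psi>0: "0 \<le> \<psi> x" if "x \<in> {0..1}" for x using \<psi>(1)[OF that] M by linarith
  have i: "integrable lam (\<lambda>x. f x * \<psi> x)"
    by (rule integrable_lam_mult_bounded[OF fi meas, of "5 * M"]) (use \<psi>(2) \<psi>0 in auto)
  have "(LINT x|lam. f x * (2 * M)) \<le> m" unfolding m_def
    using fi i \<psi>(1) by (intro integral_lam_mono mult_left_mono regularD(1)[OF reg]) auto
  then show m2: "2 * M \<le> m" using f(2) by simp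
  have "m \<le> (LINT x|lam. f x * (5 * M))" unfolding m_def
    using fi i \<psi>(2) by (intro integral_lam_mono mult_left_mono regularD(1)[OF reg]) auto
  then show "m \<le> 5 * M" using f(2) by simp
  have a: "3 \<le> astar \<alpha>" by (rule astar_ge3[OF \<alpha>])
  have "cone \<alpha> (2 * (1 + \<alpha>)) (3 * astar \<alpha> * m) (\<lambda>x. f x * \<psi> x)"
    unfolding cone_def
  proof (intro conjI ballI i regularI)
    fix x :: real assume "0 < x" "x \<le> 1"
    then show "0 \<le> f x * \<psi> x" using \<psi>0[of x] regularD(1)[OF reg, of x] by simp
  next
    fix x y :: real assume xy: "0 < x" "x \<le> y" "y \<le> 1"
    show "f y * \<psi> y \<le> f x * \<psi> x"
      using xy \<psi>(3)[of x y] \<psi>0[of y] regularD(1)[OF reg, of x] regularD(2)[OF reg, of x y] by (intro mult_mono) auto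
    have "x * (2 * M * (y - x)) \<le> 1 * (2 * M * (y - x))" using xy M by (intro mult_right_mono mult_nonneg_nonneg) auto
    moreover have "(y - x) * (2 * M) \<le> (y - x) * \<psi> y" using \<psi>(1)[of y] xy by (intro mult_left_mono) auto
    moreover have "x * (\<psi> x - \<psi> y) \<le> x * (2 * M * (y - x))" using \<psi>(3)[of x y] xy by (intro mult_left_mono) auto
    ultimately have *: "x * \<psi> x \<le> y * \<psi> y" by (simp add: algebra_simps)
    have "x powr \<alpha> * (x * \<psi> x) \<le> y powr \<alpha> * (y * \<psi> y)"
      using xy \<alpha> \<psi>0[of x] by (intro mult_mono[OF _ *] powr_mono2) auto
    then have "x powr \<alpha> * (x * \<psi> x) * (x powr (1 + \<alpha>) * f x) \<le> y powr \<alpha> * (y * \<psi> y) * (y powr (1 + \<alpha>) * f y)"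
      using xy \<psi>0[of y] regularD(1)[OF reg, of x] regularD(3)[OF reg xy]
      by (elim mult_mono) auto
    moreover have "t powr (2 * (1 + \<alpha>)) = t powr \<alpha> * t * t powr (1 + \<alpha>)" if "0 < t" for t
    proof -
      have "t powr \<alpha> * t powr 1 * t powr (1 + \<alpha>) = t powr (2 * (1 + \<alpha>))"
        unfolding powr_add[symmetric] by (simp add: algebra_simps)
      then show ?thesis using that by simp
    qed
    ultimately show "x powr (2 * (1 + \<alpha>)) * (f x * \<psi> x) \<le> y powr (2 * (1 + \<alpha>)) * (f y * \<psi> y)"
      using xy by (simp add: mult_ac)
  next
    fix x :: real assume x: "x \<in> {0<..1}"
    have "f x * \<psi> x \<le> (astar \<alpha> * x powr - \<alpha>) * (5 * M)"
      using x coneD(3)[OF f(1), of x] \<psi>(2)[of x] \<psi>0[of x] a by (intro mult_mono) auto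
    also have "\<dots> \<le> (astar \<alpha> * x powr - \<alpha>) * (3 * m)" using m2 M a by (intro mult_left_mono) auto
    finally show "f x * \<psi> x \<le> 3 * astar \<alpha> * m * x powr - \<alpha>" by (simp add: mult_ac)
  qed
  then show "normal_cone \<alpha> m (\<lambda>x. f x * \<psi> x)" by (simp add: normal_cone_def m_def)
qed

text \<open>An observable that changes sign is written as a difference of two positive ones that
  multiply f into normal cones, and these are compared by the contraction. The mean of f \<phi> need
  not vanish, because it will vanish for h and only approximately for the densities standing in for
  h.\<close>

lemma lipschitz_decay:
  assumes f: "cone \<alpha> (1 + \<alpha>) (astar \<alpha>) f" "integral\<^sup>L lam f = 1" and M: "0 < M"
    and \<phi>: "\<And>x. x \<in> {0..1} \<Longrightarrow> \<bar>\<phi> x\<bar> \<le> M" "M-lipschitz_on {0..1} \<phi>" and B: "contracts l B" "0 \<le> B"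
  shows "(LINT x|lam. \<bar>(transfer ^^ l) (\<lambda>x. f x * \<phi> x) x\<bar>) \<le> 5 * M * B + \<bar>LINT x|lam. f x * \<phi> x\<bar>"
proof -
  note fi = coneD(1)[OF f(1)]
  \<comment> \<open>The term - M x brings the slopes of both functions into [-2M, 0], and 4M lifts
    their values into [2M, 5M].\<close>
  define \<psi>1 \<psi>2 where "\<psi>1 = (\<lambda>x. \<phi> x + 4 * M - M * x)" and "\<psi>2 = (\<lambda>x. 4 * M - M * x)"
  have [measurable]: "\<phi> \<in> borel_measurable lam" by (rule lipschitz_borel[OF \<phi>(2)])
  have [measurable]: "(\<lambda>x. x) \<in> borel_measurable lam" by (intro lam_borelI) simp
  have meas: "\<psi>1 \<in> borel_measurable lam" "\<psi>2 \<in> borel_measurable lam" unfolding \<psi>1_def \<psi>2_def by measurable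
  have L: "\<bar>\<phi> x - \<phi> y\<bar> \<le> M * (y - x)" if "0 \<le> x" "x \<le> y" "y \<le> 1" for x y
    using lipschitz_onD[OF \<phi>(2), of x y] that by (simp add: dist_real_def)
  have Mx: "0 \<le> M * x" "M * x \<le> M" if "x \<in> {0..1}" for x
    using that M by (auto intro: mult_left_le)
  define m1 m2 where "m1 = (LINT x|lam. f x * \<psi>1 x)" and "m2 = (LINT x|lam. f x * \<psi>2 x)"
  have n1: "normal_cone \<alpha> m1 (\<lambda>x. f x * \<psi>1 x)" "2 * M \<le> m1" "m1 \<le> 5 * M"
  proof -
    have 1: "2 * M \<le> \<psi>1 x" "\<psi>1 x \<le> 5 * M" if "x \<in> {0..1}" for x
      using \<phi>(1)[OF that] Mx[OF that] by (auto simp: \<psi>1_def)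
    have 2: "\<psi>1 y \<le> \<psi>1 x \<and> \<psi>1 x - \<psi>1 y \<le> 2 * M * (y - x)" if "0 \<le> x" "x \<le> y" "y \<le> 1" for x y
      using L[OF that] by (auto simp: \<psi>1_def algebra_simps)
    show "normal_cone \<alpha> m1 (\<lambda>x. f x * \<psi>1 x)" "2 * M \<le> m1" "m1 \<le> 5 * M"
      using normal_cone_mult[OF f _ 1 2 meas(1)] M by (auto simp: m1_def)
  qed
  have n2: "normal_cone \<alpha> m2 (\<lambda>x. f x * \<psi>2 x)" "2 * M \<le> m2" "m2 \<le> 5 * M"
  proof -
    have 1: "2 * M \<le> \<psi>2 x" "\<psi>2 x \<le> 5 * M" if "x \<in> {0..1}" for x
      using Mx[OF that] M by (auto simp: \<psi>2_def)
    have 2: "\<psi>2 y \<le> \<psi>2 x \<and> \<psi>2 x - \<psi>2 y \<le> 2 * M * (y - x)" if "0 \<le> x" "x \<le> y" "y \<le> 1" for x y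
      using mult_left_mono[of x y M] that M by (auto simp: \<psi>2_def algebra_simps)
    show "normal_cone \<alpha> m2 (\<lambda>x. f x * \<psi>2 x)" "2 * M \<le> m2" "m2 \<le> 5 * M"
      using normal_cone_mult[OF f _ 1 2 meas(2)] M by (auto simp: m2_def)
  qed
  \<comment> \<open>The two masses may differ. Rescaling the second density to mass m1 costs \<bar>r
    - 1\<bar> m2 = \<bar>m1 - m2\<bar>, the absolute mean of f \<phi>.\<close>
  define r where "r = m1 / m2"
  have r: "0 \<le> r" "r * m2 = m1" using n1 n2 M by (auto simp: r_def)
  have n2': "normal_cone \<alpha> m1 (\<lambda>x. r * (f x * \<psi>2 x))" using normal_cone_scale[OF n2(1) r(1)] r(2) by simp
  let ?t = "transfer ^^ l"
  have i: "integrable lam (\<lambda>x. f x * \<psi>1 x)" "integrable lam (\<lambda>x. f x * \<psi>2 x)"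
    using n1(1) n2(1) by (auto simp: normal_cone_def dest: coneD)
  have ti: "integrable lam (?t (\<lambda>x. f x * \<psi>1 x))" "integrable lam (?t (\<lambda>x. f x * \<psi>2 x))"
    "integrable lam (?t (\<lambda>x. r * (f x * \<psi>2 x)))"
    using i by (auto intro!: transfer_pow_integrable)
  have dm: "m1 - m2 = (LINT x|lam. f x * \<phi> x)"
  proof -
    have "m1 - m2 = (LINT x|lam. f x * \<psi>1 x - f x * \<psi>2 x)" using i by (simp add: m1_def m2_def)
    then show ?thesis by (simp add: \<psi>1_def \<psi>2_def algebra_simps)
  qed
  have eq: "?t (\<lambda>x. f x * \<phi> x) x = (?t (\<lambda>x. f x * \<psi>1 x) x - ?t (\<lambda>x. r * (f x * \<psi>2 x)) x) + (r - 1) * ?t (\<lambda>x. f x * \<psi>2 x) x" for x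
  proof -
    have "(\<lambda>x. f x * \<phi> x) = (\<lambda>x. f x * \<psi>1 x - f x * \<psi>2 x)" by (auto simp: \<psi>1_def \<psi>2_def algebra_simps)
    then have "?t (\<lambda>x. f x * \<phi> x) x = ?t (\<lambda>x. f x * \<psi>1 x) x - ?t (\<lambda>x. f x * \<psi>2 x) x"
      by (simp only: transfer_pow_diff)
    then show ?thesis unfolding transfer_pow_scale by (simp add: algebra_simps)
  qed
  have "(LINT x|lam. \<bar>?t (\<lambda>x. f x * \<phi> x) x\<bar>) \<le>
      (LINT x|lam. \<bar>?t (\<lambda>x. f x * \<psi>1 x) x - ?t (\<lambda>x. r * (f x * \<psi>2 x)) x\<bar> + \<bar>r - 1\<bar> * \<bar>?t (\<lambda>x. f x * \<psi>2 x) x\<bar>)"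
    unfolding eq using ti by (intro integral_lam_mono) (auto simp flip: abs_mult)
  also have "\<dots> = (LINT x|lam. \<bar>?t (\<lambda>x. f x * \<psi>1 x) x - ?t (\<lambda>x. r * (f x * \<psi>2 x)) x\<bar>)
      + \<bar>r - 1\<bar> * (LINT x|lam. \<bar>?t (\<lambda>x. f x * \<psi>2 x) x\<bar>)"
    using ti by simp
  also have "\<dots> \<le> B * m1 + \<bar>r - 1\<bar> * m2"
    using B(1) n1 n2' M normal_cone_abs_integral[OF n2(1), of l] unfolding contracts_def
    by (intro add_mono mult_left_mono) auto
  also have "\<dots> \<le> B * (5 * M) + \<bar>m1 - m2\<bar>"
  proof (intro add_mono mult_left_mono n1 B(2))
    have "\<bar>r - 1\<bar> * m2 = \<bar>r - 1\<bar> * \<bar>m2\<bar>" using n2 M by simp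
    also have "\<dots> = \<bar>m1 - m2\<bar>" using r(2) by (simp add: algebra_simps flip: abs_mult)
    finally show "\<bar>r - 1\<bar> * m2 \<le> \<bar>m1 - m2\<bar>" by simp
  qed
  finally show ?thesis unfolding dm by (simp add: mult_ac)
qed

text \<open>\<open>transfer\<close> acts on representatives, so an equation valid almost everywhere
  is carried to the iterates through contraction in L^1.\<close>

lemma transfer_pow_fixed:
  assumes h: "integrable lam h" "AE x in lam. transfer h x = h x"
  shows "(LINT x|lam. \<bar>(transfer ^^ l) h x - h x\<bar>) = 0"
proof (induction l)
  case (Suc l)
  have i: "integrable lam ((transfer ^^ l) h)" by (rule transfer_pow_integrable[OF h(1)])
  have ti: "integrable lam (transfer ((transfer ^^ l) h))" "integrable lam (transfer h)"
    using transfer_integrable i h by auto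
  have z: "(LINT x|lam. \<bar>transfer h x - h x\<bar>) = 0"
    using h ti by (subst integral_nonneg_eq_0_iff_AE) auto
  have "(LINT x|lam. \<bar>(transfer ^^ Suc l) h x - h x\<bar>) \<le>
     (LINT x|lam. \<bar>(transfer ^^ 1) (\<lambda>x. (transfer ^^ l) h x - h x) x\<bar> + \<bar>transfer h x - h x\<bar>)"
    unfolding transfer_pow_diff using ti h by (intro integral_lam_mono) auto
  also have "\<dots> = (LINT x|lam. \<bar>(transfer ^^ 1) (\<lambda>x. (transfer ^^ l) h x - h x) x\<bar>) + (LINT x|lam. \<bar>transfer h x - h x\<bar>)"
    using i h ti by (intro Bochner_Integration.integral_add integrable_abs transfer_pow_integrable) auto
  also have "\<dots> \<le> (LINT x|lam. \<bar>(transfer ^^ l) h x - h x\<bar>)"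
    unfolding z using i h transfer_pow_contract[of "\<lambda>x. (transfer ^^ l) h x - h x" 1] by auto
  finally have "(LINT x|lam. \<bar>(transfer ^^ Suc l) h x - h x\<bar>) \<le> 0" using Suc by simp
  moreover have "0 \<le> (LINT x|lam. \<bar>(transfer ^^ Suc l) h x - h x\<bar>)" by simp
  ultimately show ?case by linarith
qed simp

text \<open>Split h = (h - g) + (g - c) + c with g Lipschitz and close to h, and c its mean. The
  iterates fix h, do not enlarge h - g, make g - c small by \<open>lipschitz_decay\<close> for the
  density 1, and send c to c times the iterate of 1, with c close to 1.\<close>

lemma invariant_density_limit:
  assumes h: "integrable lam h" "AE x in lam. transfer h x = h x" "integral\<^sup>L lam h = 1"
    and B: "\<And>N. 1 \<le> N \<Longrightarrow> contracts N (B * real N powr (1 - 1 / \<alpha>))" "0 \<le> B"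
  shows "(\<lambda>k. LINT x|lam. \<bar>h x - (transfer ^^ k) (\<lambda>_. 1) x\<bar>) \<longlonglongrightarrow> 0"
proof (rule LIMSEQ_I)
  interpret prob_space lam by (rule prob_space_lam)
  fix e :: real assume e: "0 < e"
  obtain g M where g: "M-lipschitz_on {0..1} g" "(LINT x|lam. \<bar>h x - g x\<bar>) < e / 4"
    using lipschitz_dense[OF h(1)] e unfolding lipschitz_approx_def by (meson zero_less_divide_iff zero_less_numeral)
  have gi: "integrable lam g" by (rule lipschitz_integrable[OF g(1)])
  define c where "c = integral\<^sup>L lam g"
  have c: "\<bar>c - 1\<bar> < e / 4"
  proof -
    have "\<bar>1 - c\<bar> = \<bar>LINT x|lam. h x - g x\<bar>" using h gi by (simp add: c_def)
    also have "\<dots> \<le> (LINT x|lam. \<bar>h x - g x\<bar>)" by (rule integral_abs_bound)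
    finally show ?thesis using g(2) by linarith
  qed
  define M1 where "M1 = \<bar>M\<bar> + \<bar>g 0\<bar> + \<bar>c\<bar> + 1"
  have M0: "0 \<le> M" by (rule lipschitz_on_nonneg[OF g(1)])
  have \<phi>: "\<bar>g x - c\<bar> \<le> M1" if "x \<in> {0..1}" for x
  proof -
    have "\<bar>g x - g 0\<bar> \<le> M * \<bar>x - 0\<bar>" using lipschitz_onD[OF g(1), of x 0] that by (simp add: dist_real_def)
    also have "\<dots> \<le> M" using that M0 by (auto intro: mult_left_le)
    finally show ?thesis by (simp add: M1_def)
  qed
  have \<phi>L: "M1-lipschitz_on {0..1} (\<lambda>x. g x - c)"
  proof (rule lipschitz_onI)
    fix x y :: real assume "x \<in> {0..1}" "y \<in> {0..1}"
    then have "dist (g x) (g y) \<le> M * dist x y" by (rule lipschitz_onD[OF g(1)])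
    also have "\<dots> \<le> M1 * dist x y" by (intro mult_right_mono) (auto simp: M1_def)
    finally show "dist (g x - c) (g y - c) \<le> M1 * dist x y" by (simp add: dist_real_def)
  qed (auto simp: M1_def)
  have "(\<lambda>l. 5 * M1 * (B * real l powr (1 - 1 / \<alpha>))) \<longlonglongrightarrow> 5 * M1 * (B * 0)"
    using \<alpha> by (intro tendsto_intros tendsto_neg_powr filterlim_real_sequentially) (auto simp: field_simps)
  then have "\<forall>\<^sub>F l in sequentially. 5 * M1 * (B * real l powr (1 - 1 / \<alpha>)) < e / 4"
    using e by (intro order_tendstoD) auto
  then obtain l0 where l0: "\<And>l. l0 \<le> l \<Longrightarrow> 5 * M1 * (B * real l powr (1 - 1 / \<alpha>)) < e / 4"
    by (auto simp: eventually_sequentially)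
  show "\<exists>no. \<forall>l\<ge>no. norm ((LINT x|lam. \<bar>h x - (transfer ^^ l) (\<lambda>_. 1) x\<bar>) - 0) < e"
  proof (intro exI[of _ "max 1 l0"] allI impI)
    fix l assume l: "max 1 l0 \<le> l"
    let ?t = "transfer ^^ l" and ?r = "(transfer ^^ l) (\<lambda>_. 1)"
    have d0: "cone \<alpha> (1 + \<alpha>) (astar \<alpha>) (\<lambda>_. 1)" "integral\<^sup>L lam (\<lambda>_::real. 1::real) = 1" using density_iterate[of 0] by simp_all
    have d: "(LINT x|lam. \<bar>?t (\<lambda>x. g x - c) x\<bar>) < e / 4"
    proof -
      have "(LINT x|lam. 1 * (g x - c)) = 0" using gi prob_space by (simp add: c_def)
      moreover have "0 < M1" by (simp add: M1_def add_nonneg_pos)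
      ultimately show ?thesis using lipschitz_decay[OF d0 _ \<phi> \<phi>L B(1), of l] l0[of l] l B(2) by simp
    qed
    have ri: "integrable lam ?r" by (intro transfer_pow_integrable) simp
    have ti: "integrable lam (?t h)" "integrable lam (?t (\<lambda>x. h x - g x))" "integrable lam (?t (\<lambda>x. g x - c))"
      using h gi by (auto intro!: transfer_pow_integrable)
    have eq: "?t h x = ?t (\<lambda>x. h x - g x) x + ?t (\<lambda>x. g x - c) x + c * ?r x" for x
      using transfer_pow_scale[of l c "\<lambda>_. 1"] transfer_pow_diff[of l g "\<lambda>_. c * 1" x] by (simp add: transfer_pow_diff)
    have "(LINT x|lam. \<bar>h x - ?r x\<bar>) \<le>
      (LINT x|lam. \<bar>?t h x - h x\<bar> + \<bar>?t (\<lambda>x. h x - g x) x\<bar> + \<bar>?t (\<lambda>x. g x - c) x\<bar> + \<bar>c - 1\<bar> * \<bar>?r x\<bar>)"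
    proof (rule integral_lam_mono)
      fix x :: real
      have "h x - ?r x = - (?t h x - h x) + ?t (\<lambda>x. h x - g x) x + ?t (\<lambda>x. g x - c) x + (c - 1) * ?r x"
        using eq[of x] by (simp add: algebra_simps)
      then show "\<bar>h x - ?r x\<bar> \<le> \<bar>?t h x - h x\<bar> + \<bar>?t (\<lambda>x. h x - g x) x\<bar> + \<bar>?t (\<lambda>x. g x - c) x\<bar> + \<bar>c - 1\<bar> * \<bar>?r x\<bar>"
        unfolding abs_mult[symmetric] by linarith
    qed (use h ri ti in auto)
    also have "\<dots> = (LINT x|lam. \<bar>?t h x - h x\<bar>) + (LINT x|lam. \<bar>?t (\<lambda>x. h x - g x) x\<bar>)
        + (LINT x|lam. \<bar>?t (\<lambda>x. g x - c) x\<bar>) + \<bar>c - 1\<bar> * (LINT x|lam. \<bar>?r x\<bar>)"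
      using h ri ti by simp
    also have "(LINT x|lam. \<bar>?r x\<bar>) \<le> (LINT x|lam. \<bar>1\<bar>)"
      by (rule transfer_pow_contract) simp
    also have "(LINT x|lam. \<bar>?t (\<lambda>x. h x - g x) x\<bar>) \<le> (LINT x|lam. \<bar>h x - g x\<bar>)"
      using h gi by (intro transfer_pow_contract) auto
    finally have "(LINT x|lam. \<bar>h x - ?r x\<bar>) < e"
      using transfer_pow_fixed[OF h(1,2), of l] d g(2) c e prob_space by (simp add: mult_left_mono)
    then show "norm ((LINT x|lam. \<bar>h x - ?r x\<bar>) - 0) < e" by simp
  qed
qed

text \<open>The estimate is proved with the k-th iterate of 1 in place of h, and k tends to
  infinity. The replacement costs M times their L^1 distance twice: in the observable itself and in
  its mean, which is no longer 0.\<close>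

lemma correlation_decay:
  assumes h: "integrable lam h" "AE x in lam. transfer h x = h x" "integral\<^sup>L lam h = 1"
    and B: "\<And>N. 1 \<le> N \<Longrightarrow> contracts N (B * real N powr (1 - 1 / \<alpha>))" "0 \<le> B"
    and M: "0 < M" and \<phi>: "\<And>x. x \<in> {0..1} \<Longrightarrow> \<bar>\<phi> x\<bar> \<le> M" "M-lipschitz_on {0..1} \<phi>"
    and mean: "(LINT x|lam. h x * \<phi> x) = 0" and l: "1 \<le> l"
  shows "(LINT x|lam. \<bar>(transfer ^^ l) (\<lambda>x. h x * \<phi> x) x\<bar>) \<le> 5 * M * (B * real l powr (1 - 1 / \<alpha>))"
proof (rule LIMSEQ_le_const)
  let ?d = "\<lambda>k. LINT x|lam. \<bar>h x - (transfer ^^ k) (\<lambda>_. 1) x\<bar>"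
  have "(\<lambda>k. 5 * M * (B * real l powr (1 - 1 / \<alpha>)) + 2 * M * ?d k) \<longlonglongrightarrow> 5 * M * (B * real l powr (1 - 1 / \<alpha>)) + 2 * M * 0"
    by (intro tendsto_intros invariant_density_limit[OF h B])
  then show "(\<lambda>k. 5 * M * (B * real l powr (1 - 1 / \<alpha>)) + 2 * M * ?d k) \<longlonglongrightarrow> 5 * M * (B * real l powr (1 - 1 / \<alpha>))"
    by simp
  have \<phi>m: "\<phi> \<in> borel_measurable lam" by (rule lipschitz_borel[OF \<phi>(2)])
  show "\<exists>N. \<forall>k\<ge>N. (LINT x|lam. \<bar>(transfer ^^ l) (\<lambda>x. h x * \<phi> x) x\<bar>)
      \<le> 5 * M * (B * real l powr (1 - 1 / \<alpha>)) + 2 * M * ?d k"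
  proof (intro exI[of _ 0] allI impI)
    fix k
    let ?r = "(transfer ^^ k) (\<lambda>_. 1)" and ?t = "transfer ^^ l"
    note c = density_iterate[of k]
    have hi: "integrable lam (\<lambda>x. h x * \<phi> x)" "integrable lam (\<lambda>x. ?r x * \<phi> x)"
      by (rule integrable_lam_mult_bounded[OF h(1) \<phi>m \<phi>(1)] integrable_lam_mult_bounded[OF coneD(1)[OF c(1)] \<phi>m \<phi>(1)]; assumption)+
    have ti: "integrable lam (?t (\<lambda>x. h x * \<phi> x - ?r x * \<phi> x))" "integrable lam (?t (\<lambda>x. ?r x * \<phi> x))"
      using hi by (auto intro!: transfer_pow_integrable)
    have dd: "(LINT x|lam. \<bar>h x * \<phi> x - ?r x * \<phi> x\<bar>) \<le> M * ?d k"
    proof -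
      have "(LINT x|lam. \<bar>h x * \<phi> x - ?r x * \<phi> x\<bar>) \<le> (LINT x|lam. M * \<bar>h x - ?r x\<bar>)"
      proof (rule integral_lam_mono)
        fix x :: real assume "0 < x" "x \<le> 1"
        then have "\<bar>\<phi> x\<bar> * \<bar>h x - ?r x\<bar> \<le> M * \<bar>h x - ?r x\<bar>" using \<phi>(1)[of x] by (intro mult_right_mono) auto
        then show "\<bar>h x * \<phi> x - ?r x * \<phi> x\<bar> \<le> M * \<bar>h x - ?r x\<bar>"
          by (simp only: left_diff_distrib[symmetric] abs_mult mult.commute[of "\<bar>\<phi> x\<bar>"])
      qed (use hi h(1) coneD(1)[OF c(1)] in auto)
      then show ?thesis by simp
    qed
    have "\<bar>LINT x|lam. ?r x * \<phi> x\<bar> = \<bar>LINT x|lam. h x * \<phi> x - ?r x * \<phi> x\<bar>" using hi mean by simp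
    also have "\<dots> \<le> (LINT x|lam. \<bar>h x * \<phi> x - ?r x * \<phi> x\<bar>)" by (rule integral_abs_bound)
    finally have m: "\<bar>LINT x|lam. ?r x * \<phi> x\<bar> \<le> M * ?d k" using dd by linarith
    have eq: "?t (\<lambda>x. h x * \<phi> x) x = ?t (\<lambda>x. h x * \<phi> x - ?r x * \<phi> x) x + ?t (\<lambda>x. ?r x * \<phi> x) x" for x
      by (simp add: transfer_pow_diff)
    have "(LINT x|lam. \<bar>?t (\<lambda>x. h x * \<phi> x) x\<bar>) \<le> 
       (LINT x|lam. \<bar>?t (\<lambda>x. h x * \<phi> x - ?r x * \<phi> x) x\<bar> + \<bar>?t (\<lambda>x. ?r x * \<phi> x) x\<bar>)"
      unfolding eq using ti by (intro integral_lam_mono) auto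
    also have "\<dots> = (LINT x|lam. \<bar>?t (\<lambda>x. h x * \<phi> x - ?r x * \<phi> x) x\<bar>) + (LINT x|lam. \<bar>?t (\<lambda>x. ?r x * \<phi> x) x\<bar>)"
      using ti by simp
    also have "\<dots> \<le> M * ?d k + (5 * M * (B * real l powr (1 - 1 / \<alpha>)) + M * ?d k)"
    proof (intro add_mono)
      show "(LINT x|lam. \<bar>?t (\<lambda>x. h x * \<phi> x - ?r x * \<phi> x) x\<bar>) \<le> M * ?d k"
        using hi transfer_pow_contract[of "\<lambda>x. h x * \<phi> x - ?r x * \<phi> x" l] dd by auto
      show "(LINT x|lam. \<bar>?t (\<lambda>x. ?r x * \<phi> x) x\<bar>) \<le> 5 * M * (B * real l powr (1 - 1 / \<alpha>)) + M * ?d k"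
        using lipschitz_decay[OF c M \<phi> B(1)[OF l]] B(2) m by simp
    qed
    finally show "(LINT x|lam. \<bar>?t (\<lambda>x. h x * \<phi> x) x\<bar>) \<le> 5 * M * (B * real l powr (1 - 1 / \<alpha>)) + 2 * M * ?d k" by simp
  qed
qed

end

section \<open>Moment recursion\<close>

lemma powr_ge_tangent_at:
  fixes a b r :: real assumes "1 \<le> r" "0 \<le> a" "0 \<le> b"
  shows "a powr r + r * a powr (r - 1) * (b - a) \<le> b powr r"
proof (cases "a = 0")
  case False
  then have a: "0 < a" using assms by simp
  have "a powr r * (1 + r * (b / a - 1)) \<le> a powr r * (b / a) powr r"
    using assms a by (intro mult_left_mono powr_ge_tangent) auto
  also have "a powr r * (b / a) powr r = b powr r" using a assms by (simp add: powr_divide)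
  also have "a powr r * (1 + r * (b / a - 1)) = a powr r + r * (a powr r / a) * (b - a)"
    using a by (simp add: field_simps)
  also have "a powr r / a = a powr (r - 1)" using a by (simp add: powr_diff)
  finally show ?thesis .
qed (use assms in auto)

text \<open>Up to the factor r + 1, the derivative of \<bar>z\<bar>^(r + 1).\<close>

definition signed_powr :: "real \<Rightarrow> real \<Rightarrow> real" where
  "signed_powr r z = sgn z * \<bar>z\<bar> powr r"

text \<open>By symmetry \<bar>b\<bar> \<le> \<bar>a\<bar> and a \<ge> 0 may be assumed. For equal
  signs this is the tangent inequality at a; for opposite signs both sides are sums, and z^r = z
  z^(r - 1) is compared term by term.\<close>

lemma signed_powr_diff:
  assumes r: "1 \<le> r"
  shows "\<bar>signed_powr r a - signed_powr r b\<bar> \<le> r * \<bar>a - b\<bar> * (\<bar>a\<bar> powr (r - 1) + \<bar>b\<bar> powr (r - 1))"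
proof -
  let ?G = "\<lambda>a b. \<bar>signed_powr r a - signed_powr r b\<bar> \<le> r * \<bar>a - b\<bar> * (\<bar>a\<bar> powr (r - 1) + \<bar>b\<bar> powr (r - 1))"
  have same: "x powr r - y powr r \<le> r * (x - y) * (x powr (r - 1) + y powr (r - 1))" if "0 \<le> y" "y \<le> x" for x y
  proof -
    have "x powr r - y powr r \<le> r * (x - y) * x powr (r - 1)"
      using powr_ge_tangent_at[OF r, of x y] that by (simp add: algebra_simps)
    also have "\<dots> \<le> r * (x - y) * (x powr (r - 1) + y powr (r - 1))"
      using r that by (intro mult_left_mono mult_nonneg_nonneg) auto
    finally show ?thesis .
  qed
  have opp: "x powr r + y powr r \<le> r * (x + y) * (x powr (r - 1) + y powr (r - 1))" if "0 \<le> y" "0 \<le> x" for x y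
  proof -
    have *: "z powr r = z * z powr (r - 1)" if "0 \<le> z" for z :: real
      using that by (cases "z = 0") (auto simp: powr_diff)
    have "x powr r + y powr r = x * x powr (r - 1) + y * y powr (r - 1)" by (simp only: *[OF that(1)] *[OF that(2)])
    also have "\<dots> \<le> 1 * (x + y) * (x powr (r - 1) + y powr (r - 1))" using that by (simp add: algebra_simps)
    also have "\<dots> \<le> r * (x + y) * (x powr (r - 1) + y powr (r - 1))"
      using r that by (intro mult_right_mono) auto
    finally show ?thesis .
  qed
  have mono: "y powr r \<le> x powr r" if "0 \<le> y" "y \<le> x" for x y :: real using that r by (intro powr_mono2) auto
  have main: "?G a b" if "\<bar>b\<bar> \<le> \<bar>a\<bar>" "0 \<le> a" for a b :: real
  proof (cases "0 \<le> b")
    case True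
    then show ?thesis using same[of b a] mono[of b a] that
      by (cases "a = 0"; cases "b = 0") (auto simp: signed_powr_def)
  next
    case False
    then show ?thesis using opp[of "-b" a] that by (cases "a = 0") (auto simp: signed_powr_def)
  qed
  have neg: "signed_powr r (- x) = - signed_powr r x" for x by (simp add: signed_powr_def sgn_minus)
  have main': "?G a b" if "\<bar>b\<bar> \<le> \<bar>a\<bar>" for a b :: real
  proof (cases "0 \<le> a")
    case True then show ?thesis using main that by auto
  next
    case False
    then have "\<bar>signed_powr r (- a) - signed_powr r (- b)\<bar> \<le> r * \<bar>(- a) - (- b)\<bar> * (\<bar>- a\<bar> powr (r - 1) + \<bar>- b\<bar> powr (r - 1))"
      using that by (intro main) auto
    then show ?thesis unfolding neg by (simp add: abs_minus_commute)
  qed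
  show ?thesis
  proof (cases "\<bar>b\<bar> \<le> \<bar>a\<bar>")
    case False
    then have "?G b a" by (intro main') auto
    then show ?thesis by (simp add: abs_minus_commute add.commute)
  qed (rule main')
qed

text \<open>A second-order expansion without second derivatives: convexity at b gives the
  first-order term with the derivative taken at b, and \<open>signed_powr_diff\<close> moves the
  derivative to a.\<close>

lemma abs_powr_step:
  assumes q: "2 \<le> q"
  shows "\<bar>b\<bar> powr q \<le> \<bar>a\<bar> powr q + q * signed_powr (q - 1) a * (b - a)
     + q * (q - 1) * (b - a)\<^sup>2 * (\<bar>a\<bar> powr (q - 2) + \<bar>b\<bar> powr (q - 2))"
proof -
  let ?s = "signed_powr (q - 1)"
  have sb: "?s b * b = \<bar>b\<bar> powr (q - 1) * \<bar>b\<bar>" by (simp add: signed_powr_def sgn_if)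
  have sa: "?s b * a \<le> \<bar>b\<bar> powr (q - 1) * \<bar>a\<bar>"
  proof -
    have "?s b * a \<le> \<bar>?s b * a\<bar>" by simp
    also have "\<dots> \<le> \<bar>b\<bar> powr (q - 1) * \<bar>a\<bar>" by (auto simp: signed_powr_def abs_mult sgn_if)
    finally show ?thesis .
  qed
  have "\<bar>b\<bar> powr q + q * \<bar>b\<bar> powr (q - 1) * (\<bar>a\<bar> - \<bar>b\<bar>) \<le> \<bar>a\<bar> powr q"
    using q by (intro powr_ge_tangent_at) auto
  moreover have "q * (?s b * (a - b)) \<le> q * (\<bar>b\<bar> powr (q - 1) * (\<bar>a\<bar> - \<bar>b\<bar>))"
    using q sa sb by (intro mult_left_mono) (auto simp: algebra_simps)
  ultimately have 1: "\<bar>b\<bar> powr q \<le> \<bar>a\<bar> powr q + q * (?s b * (b - a))" by (simp add: algebra_simps)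
  have "(?s b - ?s a) * (b - a) \<le> \<bar>?s b - ?s a\<bar> * \<bar>b - a\<bar>" by (simp flip: abs_mult)
  also have "\<dots> \<le> ((q - 1) * \<bar>b - a\<bar> * (\<bar>b\<bar> powr (q - 1 - 1) + \<bar>a\<bar> powr (q - 1 - 1))) * \<bar>b - a\<bar>"
    using q by (intro mult_right_mono signed_powr_diff) auto
  also have "\<dots> = (q - 1) * (b - a)\<^sup>2 * (\<bar>a\<bar> powr (q - 2) + \<bar>b\<bar> powr (q - 2))"
  proof -
    have "\<bar>b - a\<bar> * \<bar>b - a\<bar> = (b - a)\<^sup>2" by (simp add: power2_eq_square)
    moreover have "q - 1 - 1 = q - 2" by simp
    moreover have "((q - 1) * X * (Y + Z)) * X = (q - 1) * (X * X) * (Z + Y)" for X Y Z :: real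
      by (simp add: algebra_simps)
    ultimately show ?thesis by metis
  qed
  finally have "q * ((?s b - ?s a) * (b - a)) \<le> q * ((q - 1) * (b - a)\<^sup>2 * (\<bar>a\<bar> powr (q - 2) + \<bar>b\<bar> powr (q - 2)))"
    using q by (intro mult_left_mono) auto
  with 1 show ?thesis by (simp add: algebra_simps)
qed

text \<open>Replaces Hoelder's inequality: compare \<open>U\<^sup>2\<close> with \<open>M / t\<close>.\<close>

lemma weighted_power_split:
  fixes u h M t U p :: real
  assumes u: "0 \<le> u" "u \<le> M * h" and h: "0 \<le> h" and t: "0 < t" and M: "0 < M" and p: "1 < p" and U: "0 \<le> U"
  shows "u * U powr (2 * p - 2) \<le> t * (h * U powr (2 * p)) + (M / t) powr (p - 1) * u"
proof (cases "U\<^sup>2 \<le> M / t")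
  case True
  have "U powr (2 * p - 2) = (U\<^sup>2) powr (p - 1)"
    using U by (simp add: power2_eq_square powr_mult algebra_simps flip: powr_add)
  also have "\<dots> \<le> (M / t) powr (p - 1)" using True p by (intro powr_mono2) auto
  finally have "u * U powr (2 * p - 2) \<le> u * (M / t) powr (p - 1)" using u by (intro mult_left_mono)
  moreover have "0 \<le> t * (h * U powr (2 * p))" using t h by simp
  ultimately show ?thesis by (simp add: mult.commute)
next
  case False
  then have MU: "M \<le> t * U\<^sup>2" using t by (simp add: field_simps)
  have U0: "0 < U" using False M t U by (cases "U = 0") (auto simp: divide_le_0_iff)
  have "u * U powr (2 * p - 2) \<le> (t * U\<^sup>2 * h) * U powr (2 * p - 2)"
    using u MU h by (intro mult_right_mono order_trans[OF u(2)]) auto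
  also have "\<dots> = t * (h * (U powr 2 * U powr (2 * p - 2)))" using U0 by (simp add: mult_ac)
  also have "U powr 2 * U powr (2 * p - 2) = U powr (2 * p)" by (simp flip: powr_add)
  finally show ?thesis using u by (simp add: add_increasing2)
qed

text \<open>Induction; the step is concavity of x^(1 - s), that is, Bernoulli at n / (n +
  1).\<close>

lemma sum_powr_le:
  assumes s: "0 \<le> s" "s < 1"
  shows "(\<Sum>l<n. real (Suc l) powr - s) \<le> real n powr (1 - s) / (1 - s)"
proof (induction n)
  case (Suc n)
  define x where "x = real (Suc n)"
  have x: "0 < x" by (simp add: x_def)
  have "(real n / x) powr (1 - s) \<le> 1 + (1 - s) * (real n / x - 1)"
    using s x by (intro powr_le_tangent) auto
  also have "real n / x - 1 = - 1 / x" using x by (simp add: x_def field_simps)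
  finally have "x powr (1 - s) * (real n / x) powr (1 - s) \<le> x powr (1 - s) * (1 + (1 - s) * (- 1 / x))"
    by (intro mult_left_mono) auto
  moreover have "x powr (1 - s) * (real n / x) powr (1 - s) = real n powr (1 - s)"
    using x by (simp add: powr_divide)
  moreover have "x powr (1 - s) / x = x powr - s" using x by (simp add: powr_diff powr_minus field_simps)
  moreover have "x powr (1 - s) * (1 + (1 - s) * (- 1 / x)) = x powr (1 - s) - (1 - s) * (x powr (1 - s) / x)"
    by (simp add: algebra_simps)
  ultimately have "real n powr (1 - s) \<le> x powr (1 - s) - (1 - s) * x powr - s" by simp
  then have "(real n powr (1 - s) + (1 - s) * x powr - s) / (1 - s) \<le> x powr (1 - s) / (1 - s)"
    using s by (intro divide_right_mono) auto
  then have "real n powr (1 - s) / (1 - s) + x powr - s \<le> x powr (1 - s) / (1 - s)"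
    using s by (simp add: add_divide_distrib)
  then show ?case using Suc by (simp add: x_def)
qed simp

text \<open>What the absorption leaves: \<open>4 * K * D * (M / c) powr (p - 1) / (1 - s)\<close>
  with s = b/p and c = (1 - s) / (4K).\<close>

definition moment_constant :: "real \<Rightarrow> real \<Rightarrow> real \<Rightarrow> real \<Rightarrow> real \<Rightarrow> real" where
  "moment_constant K M p b D = 4 * K * D * (4 * K * M / (1 - b / p)) powr (p - 1) / (1 - b / p)"

text \<open>The weights \<open>t\<^sub>l\<close> are proportional to \<open>(l + 1) powr (- b / p)\<close> and normalised so that the
  unknown maximal moment on the right-hand side is absorbed.\<close>

lemma moment_recursion:
  fixes w \<delta> :: "nat \<Rightarrow> real" and K M p b D :: real
  assumes K: "0 < K" and M: "0 < M" and D: "0 \<le> D" and b: "0 \<le> b" "b < p" and p: "1 < p"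
    and w: "w 0 = 0" "\<And>m. 0 \<le> w m"
    and \<delta>: "\<And>l. \<delta> l \<le> D * real (Suc l) powr - b"
    and step: "\<And>m t. (\<And>l. 0 < t l) \<Longrightarrow> w (Suc m) - w m \<le>
      K * (\<Sum>l\<le>m. t l * (w (m - l) + w (Suc (m - l))) + 2 * ((M / t l) powr (p - 1) * \<delta> l))"
    and n: "1 \<le> n"
  shows "w n \<le> moment_constant K M p b D * real n powr (2 * p - b)"
proof -
  \<comment> \<open>With s p = b, the product of (l + 1)^(s (p - 1)) and (l + 1)^(-b) is (l +
    1)^(-s). Hence the weights and the terms with their power 1 - p lead to the same sum, which is
    of order n^(1 - s) because s < 1.\<close>
  define s where "s = b / p"
  have s: "0 \<le> s" "s < 1" using b p by (auto simp: s_def)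
  have sp: "s * p = b" using p by (simp add: s_def)
  \<comment> \<open>Chosen so that 2 K c / (1 - s) = 1/2: the unknown maximum enters
    \<open>T1\<close> with coefficient 1/2 and is absorbed.\<close>
  define c where "c = (1 - s) / (4 * K)"
  have c: "0 < c" using s K by (simp add: c_def)
  \<comment> \<open>The power s - 2 of n balances n increments against a sum of order n^(1 -
    s).\<close>
  define t where "t = (\<lambda>l. c * real (Suc l) powr - s * real n powr (s - 2))"
  have t: "0 < t l" for l using c n by (simp add: t_def)
  \<comment> \<open>The maximum includes n itself, as the bound for the increment from m to m + 1
    already contains the moment at m + 1.\<close>
  define W where "W = Max (w ` {..n})"
  have W: "w m \<le> W" if "m \<le> n" for m using that by (simp add: W_def)
  have W0: "0 \<le> W" using W[of 0] w by simp
  define R where "R = (\<lambda>l. 2 * t l * W + 2 * ((M / t l) powr (p - 1) * (D * real (Suc l) powr - b)))"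
  have R0: "0 \<le> R l" for l using t[of l] W0 D by (simp add: R_def)
  have inc: "w (Suc m) - w m \<le> K * (\<Sum>l<n. R l)" if m: "m < n" for m
  proof -
    have "w (Suc m) - w m \<le> K * (\<Sum>l\<le>m. t l * (w (m - l) + w (Suc (m - l))) + 2 * ((M / t l) powr (p - 1) * \<delta> l))"
      by (rule step[OF t])
    also have "\<dots> \<le> K * (\<Sum>l\<le>m. R l)"
    proof (intro mult_left_mono sum_mono)
      fix l assume "l \<in> {..m}"
      then have "w (m - l) \<le> W" "w (Suc (m - l)) \<le> W" using m by (auto intro!: W)
      then have "t l * (w (m - l) + w (Suc (m - l))) \<le> t l * (W + W)" using t[of l] by (intro mult_left_mono) auto
      moreover have "(M / t l) powr (p - 1) * \<delta> l \<le> (M / t l) powr (p - 1) * (D * real (Suc l) powr - b)"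
        by (intro mult_left_mono \<delta>) auto
      ultimately show "t l * (w (m - l) + w (Suc (m - l))) + 2 * ((M / t l) powr (p - 1) * \<delta> l) \<le> R l"
        by (simp add: R_def algebra_simps)
    qed (use K in auto)
    also have "\<dots> \<le> K * (\<Sum>l<n. R l)"
      using m K R0 by (intro mult_left_mono sum_mono2) auto
    finally show ?thesis .
  qed
  have wm: "w m \<le> real m * (K * (\<Sum>l<n. R l))" if "m \<le> n" for m
    using that
  proof (induction m)
    case (Suc m)
    then show ?case using inc[of m] by (simp add: algebra_simps)
  qed (use w in simp)
  have S: "(\<Sum>l<n. real (Suc l) powr - s) \<le> real n powr (1 - s) / (1 - s)" by (rule sum_powr_le[OF s])
  have n0: "0 < real n" using n by simp
  have npow: "real n * real n powr x = real n powr (1 + x)" for x using n0 by (simp add: powr_add)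
  have T1: "real n * K * (\<Sum>l<n. 2 * t l * W) \<le> W / 2"
  proof -
    have "(\<Sum>l<n. 2 * t l * W) = 2 * c * W * real n powr (s - 2) * (\<Sum>l<n. real (Suc l) powr - s)"
      unfolding sum_distrib_left by (rule sum.cong) (auto simp: t_def mult_ac)
    also have "\<dots> \<le> 2 * c * W * real n powr (s - 2) * (real n powr (1 - s) / (1 - s))"
      using c W0 by (intro mult_left_mono S) auto
    finally have "real n * K * (\<Sum>l<n. 2 * t l * W) \<le> real n * K * (2 * c * W * real n powr (s - 2) * (real n powr (1 - s) / (1 - s)))"
      using K by (intro mult_left_mono) auto
    also have "\<dots> = (2 * K * c / (1 - s)) * W * (real n * (real n powr (s - 2) * real n powr (1 - s)))" by (simp add: mult_ac)
    also have "real n * (real n powr (s - 2) * real n powr (1 - s)) = 1"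
      unfolding powr_add[symmetric] npow using n0 by simp
    also have "2 * K * c / (1 - s) = 1 / 2" using K s by (simp add: c_def)
    finally show ?thesis by simp
  qed
  have T2: "real n * K * (\<Sum>l<n. 2 * ((M / t l) powr (p - 1) * (D * real (Suc l) powr - b)))
      \<le> 2 * K * D * (M / c) powr (p - 1) / (1 - s) * real n powr (2 * p - b)"
  proof -
    have e: "(M / t l) powr (p - 1) * real (Suc l) powr - b =
      (M / c) powr (p - 1) * real n powr ((2 - s) * (p - 1)) * real (Suc l) powr - s" for l
    proof -
      have "M / t l = M / c * (real (Suc l) powr s * real n powr (2 - s))"
        using n0 by (simp add: t_def powr_minus powr_diff field_simps)
      then have "(M / t l) powr (p - 1) = (M / c) powr (p - 1) * (real (Suc l) powr (s * (p - 1)) * real n powr ((2 - s) * (p - 1)))"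
        by (simp only: powr_mult powr_powr)
      moreover have "real (Suc l) powr (s * (p - 1)) * real (Suc l) powr - b = real (Suc l) powr - s"
        unfolding powr_add[symmetric] sp[symmetric] by (simp add: algebra_simps)
      ultimately show ?thesis by (simp add: mult_ac)
    qed
    have "(\<Sum>l<n. 2 * ((M / t l) powr (p - 1) * (D * real (Suc l) powr - b))) =
      2 * D * (M / c) powr (p - 1) * real n powr ((2 - s) * (p - 1)) * (\<Sum>l<n. real (Suc l) powr - s)"
      unfolding sum_distrib_left
    proof (rule sum.cong[OF refl])
      fix l
      have "2 * ((M / t l) powr (p - 1) * (D * real (Suc l) powr - b)) = 2 * D * ((M / t l) powr (p - 1) * real (Suc l) powr - b)" by simp
      then show "2 * ((M / t l) powr (p - 1) * (D * real (Suc l) powr - b)) =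
         2 * D * (M / c) powr (p - 1) * real n powr ((2 - s) * (p - 1)) * real (Suc l) powr - s"
        unfolding e by simp
    qed
    also have "\<dots> \<le> 2 * D * (M / c) powr (p - 1) * real n powr ((2 - s) * (p - 1)) * (real n powr (1 - s) / (1 - s))"
      using D by (intro mult_left_mono S) auto
    finally have "real n * K * (\<Sum>l<n. 2 * ((M / t l) powr (p - 1) * (D * real (Suc l) powr - b))) \<le>
       real n * K * (2 * D * (M / c) powr (p - 1) * real n powr ((2 - s) * (p - 1)) * (real n powr (1 - s) / (1 - s)))"
      using K by (intro mult_left_mono) auto
    also have "\<dots> = 2 * K * D * (M / c) powr (p - 1) / (1 - s) * (real n * (real n powr ((2 - s) * (p - 1)) * real n powr (1 - s)))"
      by (simp add: mult_ac)
    also have "real n * (real n powr ((2 - s) * (p - 1)) * real n powr (1 - s)) = real n powr (2 * p - b)"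
      unfolding powr_add[symmetric] npow sp[symmetric] by (simp add: algebra_simps)
    finally show ?thesis .
  qed
  have "W \<in> w ` {..n}" unfolding W_def by (intro Max_in) auto
  then obtain m where m: "m \<le> n" "W = w m" by auto
  have RS: "0 \<le> K * (\<Sum>l<n. R l)" using K R0 by (intro mult_nonneg_nonneg sum_nonneg) auto
  have "W \<le> real m * (K * (\<Sum>l<n. R l))" using wm[OF m(1)] m(2) by simp
  also have "\<dots> \<le> real n * (K * (\<Sum>l<n. R l))" using m RS by (intro mult_right_mono) auto
  also have "\<dots> = real n * K * (\<Sum>l<n. 2 * t l * W) + real n * K * (\<Sum>l<n. 2 * ((M / t l) powr (p - 1) * (D * real (Suc l) powr - b)))"
    by (simp add: R_def sum.distrib algebra_simps)
  finally have "W \<le> 2 * (2 * K * D * (M / c) powr (p - 1) / (1 - s) * real n powr (2 * p - b))"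
    using T1 T2 by linarith
  then have "W \<le> 4 * K * D * (M / c) powr (p - 1) / (1 - s) * real n powr (2 * p - b)" by simp
  moreover have "M / c = 4 * K * M / (1 - s)" using K by (simp add: c_def)
  ultimately show ?thesis using W[of n] by (simp add: moment_constant_def s_def)
qed

section \<open>The skew product\<close>

lemma random_iterate_shift:
  "random_iterate (\<lambda>i. \<omega> (Suc i)) j (intermittent_map (\<omega> 0) x) = random_iterate \<omega> (Suc j) x"
  by (induction j) auto

definition skew :: "(nat \<Rightarrow> real) \<times> real \<Rightarrow> (nat \<Rightarrow> real) \<times> real" where
  "skew z = (\<lambda>i. fst z (Suc i), intermittent_map (fst z 0) (snd z))"

text \<open>The recursion peels off the earliest time, because the past is what gets conditioned on
  the future. The sum starts at time 0; the one with j from 1 to n is obtained after one application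
  of \<open>skew\<close>, which preserves the stationary law.\<close>

primrec birkhoff :: "(real \<Rightarrow> real) \<Rightarrow> nat \<Rightarrow> (nat \<Rightarrow> real) \<times> real \<Rightarrow> real" where
  "birkhoff \<phi> 0 z = 0"
| "birkhoff \<phi> (Suc m) z = \<phi> (snd z) + birkhoff \<phi> m (skew z)"

lemma birkhoff_eq: "birkhoff \<phi> m z = (\<Sum>j<m. \<phi> (random_iterate (fst z) j (snd z)))"
proof (induction m arbitrary: z)
  case (Suc m)
  show ?case unfolding sum.lessThan_Suc_shift
    by (simp add: Suc skew_def random_iterate_shift del: random_iterate.simps(2))
qed simp

lemma birkhoff_skew: "birkhoff \<phi> m (skew (\<omega>, x)) = (\<Sum>j=1..m. \<phi> (random_iterate \<omega> j x))"
proof -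
  have "birkhoff \<phi> m (skew (\<omega>, x)) = (\<Sum>j<m. \<phi> (random_iterate \<omega> (Suc j) x))"
    by (simp add: birkhoff_eq skew_def random_iterate_shift del: random_iterate.simps(2))
  also have "\<dots> = (\<Sum>j=1..m. \<phi> (random_iterate \<omega> j x))"
    by (simp add: sum.atLeast1_atMost_eq)
  finally show ?thesis .
qed

context random_lsv
begin

section \<open>Words over the alphabet and integration against densities on the skew product\<close>

abbreviation letter :: "real measure" where "letter \<equiv> point_measure \<Omega> (\<lambda>\<beta>. ennreal (P \<beta>))"
abbreviation words :: "(nat \<Rightarrow> real) measure" where "words \<equiv> bernoulli_measure \<Omega> P"
abbreviation prod_lam :: "((nat \<Rightarrow> real) \<times> real) measure" where "prod_lam \<equiv> words \<Otimes>\<^sub>M lam"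

lemma prob_space_letter: "prob_space letter"
proof
  have "emeasure letter \<Omega> = (\<Sum>\<beta>\<in>\<Omega>. ennreal (P \<beta>))"
    by (rule emeasure_point_measure_finite) (auto simp: finite_\<Omega>)
  also have "\<dots> = 1" using P_nonneg by (subst sum_ennreal) (auto simp: P_sum)
  finally show "emeasure letter (space letter) = 1" by (simp add: space_point_measure)
qed

lemma sequence_space_letter: "sequence_space letter"
  unfolding sequence_space_def product_prob_space_def product_prob_space_axioms_def product_sigma_finite_def
  using prob_space_letter by (auto simp: prob_space_imp_sigma_finite)

lemma prob_space_words: "prob_space words"
  unfolding bernoulli_measure_def by (rule prob_space_PiM) (rule prob_space_letter)

lemma sets_letter: "sets letter = sets (count_space \<Omega>)"
  by (simp add: sets_point_measure)

lemma measurable_letter: "(\<lambda>\<omega>. \<omega> i) \<in> measurable words (count_space \<Omega>)"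
proof -
  have "(\<lambda>\<omega>. \<omega> i) \<in> measurable words letter"
    unfolding bernoulli_measure_def by (rule measurable_component_singleton) simp
  then show ?thesis using measurable_cong_sets[OF refl sets_letter, of words] by blast
qed

lemma measurable_shift: "(\<lambda>\<omega> i. \<omega> (Suc i)) \<in> measurable words words"
  unfolding bernoulli_measure_def
  by (rule measurable_abs_UNIV) (rule measurable_component_singleton, simp)

lemma measurable_skew [measurable]: "skew \<in> measurable prod_lam prod_lam"
proof -
  have 1: "(\<lambda>z. fst z 0) \<in> measurable prod_lam (count_space \<Omega>)"
    by (rule measurable_compose[OF measurable_fst measurable_letter])
  have 2: "(\<lambda>z. intermittent_map \<beta> (snd z)) \<in> measurable prod_lam lam" if "\<beta> \<in> \<Omega>" for \<beta>
    by (rule measurable_compose[OF measurable_snd intermittent_map_lam[OF \<Omega>D(1,3)[OF that]]])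
  have 3: "(\<lambda>z. intermittent_map (fst z 0) (snd z)) \<in> measurable prod_lam lam"
    by (rule measurable_compose_countable'[OF 2 1]) (use finite_\<Omega> countable_finite in auto)
  have 4: "(\<lambda>z i. fst z (Suc i)) \<in> measurable prod_lam words"
    by (rule measurable_compose[OF measurable_fst measurable_shift])
  show ?thesis unfolding skew_def[abs_def] by (rule measurable_Pair[OF 4 3])
qed

lemma skew_in: "z \<in> space prod_lam \<Longrightarrow> skew z \<in> space prod_lam"
  by (rule measurable_space[OF measurable_skew])

lemma pair_prob_space_words: "pair_prob_space words lam"
  unfolding pair_prob_space_def pair_sigma_finite_def
  using prob_space_words prob_space_lam by (auto simp: prob_space_imp_sigma_finite)

definition bounded_meas :: "((nat \<Rightarrow> real) \<times> real \<Rightarrow> real) \<Rightarrow> bool" where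
  "bounded_meas G \<longleftrightarrow> G \<in> borel_measurable prod_lam \<and> (\<exists>B. \<forall>z\<in>space prod_lam. \<bar>G z\<bar> \<le> B)"

lemma bounded_measI: "G \<in> borel_measurable prod_lam \<Longrightarrow> (\<And>z. z \<in> space prod_lam \<Longrightarrow> \<bar>G z\<bar> \<le> B) \<Longrightarrow> bounded_meas G"
  unfolding bounded_meas_def by blast

lemma bounded_meas_skew:
  assumes "bounded_meas G" shows "bounded_meas (\<lambda>z. G (skew z))"
proof -
  have [measurable]: "G \<in> borel_measurable prod_lam" using assms by (simp add: bounded_meas_def)
  have "(\<lambda>z. G (skew z)) \<in> borel_measurable prod_lam" by measurable
  then show ?thesis using assms skew_in unfolding bounded_meas_def by blast
qed

definition fibre_mean :: "((nat \<Rightarrow> real) \<times> real \<Rightarrow> real) \<Rightarrow> real \<Rightarrow> real" where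
  "fibre_mean G x = (LINT \<omega>|words. G (\<omega>, x))"

text \<open>The reference measure stays fixed and the law of the starting point enters as u, which
  may be signed. Thus h, h \<phi> and their images under \<open>transfer\<close> are treated
  alike.\<close>

definition pairing :: "(real \<Rightarrow> real) \<Rightarrow> ((nat \<Rightarrow> real) \<times> real \<Rightarrow> real) \<Rightarrow> real" where
  "pairing u G = (LINT z|prod_lam. u (snd z) * G z)"

lemma fibre_mean_measurable:
  assumes "bounded_meas G" shows "fibre_mean G \<in> borel_measurable lam"
proof -
  interpret words: prob_space words by (rule prob_space_words)
  have [measurable]: "G \<in> borel_measurable prod_lam" using assms by (simp add: bounded_meas_def)
  show ?thesis unfolding fibre_mean_def[abs_def] by measurable
qed

lemma fibre_mean_bound:
  assumes "bounded_meas G" "\<And>z. z \<in> space prod_lam \<Longrightarrow> \<bar>G z\<bar> \<le> B" "x \<in> {0..1}"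
  shows "\<bar>fibre_mean G x\<bar> \<le> B"
proof -
  interpret words: prob_space words by (rule prob_space_words)
  have [measurable]: "G \<in> borel_measurable prod_lam" using assms by (simp add: bounded_meas_def)
  have x: "x \<in> space lam" using assms by simp
  have G: "(\<lambda>\<omega>. G (\<omega>, x)) \<in> borel_measurable words" using x by measurable
  have i: "integrable words (\<lambda>\<omega>. G (\<omega>, x))"
    by (rule words.integrable_const_bound[OF _ G, of B]) (use assms(2) x in \<open>auto simp: space_pair_measure\<close>)
  have "\<bar>fibre_mean G x\<bar> \<le> (LINT \<omega>|words. \<bar>G (\<omega>, x)\<bar>)" unfolding fibre_mean_def by (rule integral_abs_bound)
  also have "\<dots> \<le> (LINT \<omega>|words. B)"
    using i assms(2) x by (intro integral_mono) (auto simp: space_pair_measure)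
  also have "\<dots> = B" using words.prob_space by simp
  finally show ?thesis .
qed

lemma integrable_pairing:
  assumes u: "integrable lam u" and G: "bounded_meas G"
  shows "integrable prod_lam (\<lambda>z. u (snd z) * G z)"
proof -
  interpret pair_prob_space words lam by (rule pair_prob_space_words)
  have [measurable]: "G \<in> borel_measurable prod_lam" "u \<in> borel_measurable lam"
    using assms by (auto simp: bounded_meas_def)
  obtain B where B: "\<And>z. z \<in> space prod_lam \<Longrightarrow> \<bar>G z\<bar> \<le> B" using G by (auto simp: bounded_meas_def)
  have us: "integrable prod_lam (\<lambda>z. u (snd z))"
  proof (rule Fubini_integrable)
    show "integrable words (\<lambda>\<omega>. LINT x|lam. norm (u (snd (\<omega>, x))))" by simp
    show "AE \<omega> in words. integrable lam (\<lambda>x. u (snd (\<omega>, x)))" using u by simp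
  qed measurable
  have "integrable prod_lam (\<lambda>z. B * u (snd z))" using us by simp
  then show ?thesis
  proof (rule Bochner_Integration.integrable_bound)
    show "AE z in prod_lam. norm (u (snd z) * G z) \<le> norm (B * u (snd z))"
    proof (rule AE_I2)
      fix z assume "z \<in> space prod_lam"
      then have "\<bar>G z\<bar> * \<bar>u (snd z)\<bar> \<le> \<bar>B\<bar> * \<bar>u (snd z)\<bar>" using B[of z] by (intro mult_right_mono) auto
      then show "norm (u (snd z) * G z) \<le> norm (B * u (snd z))" by (simp add: abs_mult mult.commute)
    qed
  qed measurable
qed

lemma pairing_fibre:
  assumes u: "integrable lam u" and G: "bounded_meas G"
  shows "pairing u G = (LINT x|lam. u x * fibre_mean G x)"
proof -
  interpret pair_prob_space words lam by (rule pair_prob_space_words)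
  have "pairing u G = (LINT x|lam. LINT \<omega>|words. u x * G (\<omega>, x))"
    unfolding pairing_def using integral_snd[of "\<lambda>\<omega> x. u x * G (\<omega>, x)"] integrable_pairing[OF u G]
    by (simp add: case_prod_unfold)
  then show ?thesis by (simp add: fibre_mean_def)
qed

lemma pairing_cong_AE:
  assumes "integrable lam u" "integrable lam v" "bounded_meas G" "AE x in lam. u x = v x"
  shows "pairing u G = pairing v G"
proof -
  have [measurable]: "u \<in> borel_measurable lam" "v \<in> borel_measurable lam" "fibre_mean G \<in> borel_measurable lam"
    using assms fibre_mean_measurable by auto
  show ?thesis unfolding pairing_fibre[OF assms(1,3)] pairing_fibre[OF assms(2,3)]
    using assms(4) by (intro integral_cong_AE) auto
qed

text \<open>A random word is a random letter followed by an independent word of the same law.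
  \<open>skew\<close> uses up the letter, and the remaining word integrates to
  \<open>fibre_mean\<close>.\<close>

lemma fibre_mean_skew:
  assumes G: "bounded_meas G" and x: "x \<in> {0..1}"
  shows "fibre_mean (\<lambda>z. G (skew z)) x = (\<Sum>\<beta>\<in>\<Omega>. P \<beta> * fibre_mean G (intermittent_map \<beta> x))"
proof -
  interpret sequence_space letter by (rule sequence_space_letter)
  have w: "S = words" by (simp add: bernoulli_measure_def)
  interpret words: prob_space words by (rule prob_space_words)
  interpret letter: prob_space letter by (rule prob_space_letter)
  interpret lw: pair_prob_space letter words ..
  have [measurable]: "G \<in> borel_measurable prod_lam" using G by (simp add: bounded_meas_def)
  obtain B where B: "\<And>z. z \<in> space prod_lam \<Longrightarrow> \<bar>G z\<bar> \<le> B" using G by (auto simp: bounded_meas_def)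
  have xs: "x \<in> space lam" using x by simp
  define g where "g = (\<lambda>\<omega>. G (skew (\<omega>, x)))"
  have gm: "g \<in> borel_measurable words" unfolding g_def using xs by measurable
  have cn: "(\<lambda>(s, \<omega>). case_nat s \<omega>) \<in> measurable (letter \<Otimes>\<^sub>M words) words"
    unfolding bernoulli_measure_def by measurable
  have gc: "(\<lambda>z. g ((\<lambda>(s, \<omega>). case_nat s \<omega>) z)) \<in> borel_measurable (letter \<Otimes>\<^sub>M words)"
    by (rule measurable_compose[OF cn gm])
  have gB: "\<bar>g \<omega>\<bar> \<le> B" if "\<omega> \<in> space words" for \<omega>
    unfolding g_def using that xs by (intro B skew_in) (auto simp: space_pair_measure)
  have gi: "integrable (letter \<Otimes>\<^sub>M words) (\<lambda>(s, \<omega>). g (case_nat s \<omega>))"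
    using gc gB measurable_space[OF cn]
    by (intro lw.P.integrable_const_bound[of _ B]) (auto simp: case_prod_unfold intro!: AE_I2)
  have "fibre_mean (\<lambda>z. G (skew z)) x = integral\<^sup>L words g" by (simp add: fibre_mean_def g_def)
  also have "\<dots> = integral\<^sup>L (distr (letter \<Otimes>\<^sub>M words) words (\<lambda>(s, \<omega>). case_nat s \<omega>)) g"
    using PiM_iter by (simp add: w)
  also have "\<dots> = (LINT z|(letter \<Otimes>\<^sub>M words). g ((\<lambda>(s, \<omega>). case_nat s \<omega>) z))"
    by (rule integral_distr[OF cn gm])
  also have "\<dots> = (LINT s|letter. LINT \<omega>|words. g (case_nat s \<omega>))"
    using lw.integral_fst[OF gi] by (simp add: case_prod_unfold)
  also have "\<dots> = (\<Sum>\<beta>\<in>\<Omega>. P \<beta> *\<^sub>R (LINT \<omega>|words. g (case_nat \<beta> \<omega>)))"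
    by (rule lebesgue_integral_point_measure_finite[OF finite_\<Omega> P_nonneg])
  also have "\<dots> = (\<Sum>\<beta>\<in>\<Omega>. P \<beta> * fibre_mean G (intermittent_map \<beta> x))"
    by (simp add: g_def skew_def fibre_mean_def)
  finally show ?thesis .
qed

text \<open>The used letter is independent of the remaining word, so \<open>skew\<close> maps the
  product of \<open>words\<close> and u dx to the product of \<open>words\<close> and
  \<open>transfer u\<close> dx. Moving a shift from G to u in this way is the reversal of
  time.\<close>

lemma pairing_skew:
  assumes u: "integrable lam u" and G: "bounded_meas G"
  shows "pairing u (\<lambda>z. G (skew z)) = pairing (transfer u) G"
proof -
  obtain B where B: "\<And>z. z \<in> space prod_lam \<Longrightarrow> \<bar>G z\<bar> \<le> B" using G by (auto simp: bounded_meas_def)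
  note fm = fibre_mean_measurable[OF G] and fb = fibre_mean_bound[OF G B]
  have i: "integrable lam (\<lambda>x. u x * fibre_mean G (intermittent_map \<beta> x))" if "\<beta> \<in> \<Omega>" for \<beta>
    using measurable_compose[OF intermittent_map_lam[OF \<Omega>D(1,3)[OF that]] fm] intermittent_map_unit[OF \<Omega>D(1,3)[OF that]] fb
    by (intro integrable_lam_mult_bounded[OF u, of _ B]) auto
  have "pairing u (\<lambda>z. G (skew z)) = (LINT x|lam. u x * (\<Sum>\<beta>\<in>\<Omega>. P \<beta> * fibre_mean G (intermittent_map \<beta> x)))"
    unfolding pairing_fibre[OF u bounded_meas_skew[OF G]]
    by (rule integral_lam_cong) (simp add: fibre_mean_skew[OF G])
  also have "\<dots> = (LINT x|lam. (\<Sum>\<beta>\<in>\<Omega>. P \<beta> * (u x * fibre_mean G (intermittent_map \<beta> x))))"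
    by (rule integral_lam_cong) (simp add: sum_distrib_left mult_ac)
  also have "\<dots> = (\<Sum>\<beta>\<in>\<Omega>. P \<beta> * (LINT x|lam. u x * fibre_mean G (intermittent_map \<beta> x)))"
    using i by (subst Bochner_Integration.integral_sum) auto
  also have "\<dots> = (LINT x|lam. transfer u x * fibre_mean G x)"
    using transfer_dual(2)[OF u fm fb] by simp
  also have "\<dots> = pairing (transfer u) G"
    by (rule pairing_fibre[OF transfer_integrable[OF u] G, symmetric])
  finally show ?thesis .
qed

end

section \<open>Moments of Birkhoff sums\<close>

context random_lsv
begin

lemma bounded_meas_add: "bounded_meas F \<Longrightarrow> bounded_meas G \<Longrightarrow> bounded_meas (\<lambda>z. F z + G z)"
proof -
  assume F: "bounded_meas F" and G: "bounded_meas G"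
  then obtain A B where "\<forall>z\<in>space prod_lam. \<bar>F z\<bar> \<le> A" "\<forall>z\<in>space prod_lam. \<bar>G z\<bar> \<le> B"
    by (auto simp: bounded_meas_def)
  then have "\<bar>F z + G z\<bar> \<le> A + B" if "z \<in> space prod_lam" for z using that by fastforce
  moreover have "(\<lambda>z. F z + G z) \<in> borel_measurable prod_lam"
    using F G by (auto simp: bounded_meas_def)
  ultimately show ?thesis by (intro bounded_measI)
qed

text \<open>The factor that controls both the second-order remainder of \<bar>S\<bar>^(2p) and the
  variation of its derivative when the term at time 0 is added to the k later ones.\<close>

definition increment_weight :: "(real \<Rightarrow> real) \<Rightarrow> real \<Rightarrow> nat \<Rightarrow> (nat \<Rightarrow> real) \<times> real \<Rightarrow> real" where
  "increment_weight \<phi> p k z =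
     \<bar>birkhoff \<phi> k (skew z)\<bar> powr (2 * p - 2) + \<bar>birkhoff \<phi> (Suc k) z\<bar> powr (2 * p - 2)"

definition moment :: "(real \<Rightarrow> real) \<Rightarrow> (real \<Rightarrow> real) \<Rightarrow> real \<Rightarrow> nat \<Rightarrow> real" where
  "moment h \<phi> p m = pairing h (\<lambda>z. \<bar>birkhoff \<phi> m z\<bar> powr (2 * p))"

definition lagged :: "(real \<Rightarrow> real) \<Rightarrow> (real \<Rightarrow> real) \<Rightarrow> nat \<Rightarrow> real \<Rightarrow> real" where
  "lagged h \<phi> l = (transfer ^^ l) (\<lambda>x. h x * \<phi> x)"

context
  fixes h \<phi> :: "real \<Rightarrow> real" and M p :: real
  assumes h: "integrable lam h" "\<And>x. x \<in> {0..1} \<Longrightarrow> 0 \<le> h x" "AE x in lam. transfer h x = h x"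
    and M: "0 < M" and \<phi>: "\<phi> \<in> borel_measurable lam" "\<And>x. x \<in> {0..1} \<Longrightarrow> \<bar>\<phi> x\<bar> \<le> M" and p: "1 < p"
begin

lemma birkhoff_measurable: "birkhoff \<phi> m \<in> borel_measurable prod_lam"
proof (induction m)
  case (Suc m)
  note [measurable] = Suc \<phi>(1)
  have "(\<lambda>z. \<phi> (snd z) + birkhoff \<phi> m (skew z)) \<in> borel_measurable prod_lam" by measurable
  then show ?case by (simp cong: measurable_cong)
qed simp

lemma snd_in: "z \<in> space prod_lam \<Longrightarrow> snd z \<in> {0..1}"
  by (auto simp: space_pair_measure)

lemma birkhoff_bound: "z \<in> space prod_lam \<Longrightarrow> \<bar>birkhoff \<phi> m z\<bar> \<le> real m * M"
proof (induction m arbitrary: z)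
  case (Suc m)
  show ?case using Suc.IH[OF skew_in[OF Suc.prems]] \<phi>(2)[OF snd_in[OF Suc.prems]] by (simp add: algebra_simps)
qed simp

lemma birkhoff_powr_meas: "0 \<le> r \<Longrightarrow> bounded_meas (\<lambda>z. \<bar>birkhoff \<phi> m z\<bar> powr r)"
proof (rule bounded_measI[where B = "(real m * M) powr r"])
  note [measurable] = birkhoff_measurable
  show "(\<lambda>z. \<bar>birkhoff \<phi> m z\<bar> powr r) \<in> borel_measurable prod_lam" by measurable
  assume "0 \<le> r"
  then show "\<bar>\<bar>birkhoff \<phi> m z\<bar> powr r\<bar> \<le> (real m * M) powr r" if "z \<in> space prod_lam" for z
    using birkhoff_bound[OF that] by (simp add: powr_mono2)
qed

lemma birkhoff_signed_meas: "0 \<le> r \<Longrightarrow> bounded_meas (\<lambda>z. signed_powr r (birkhoff \<phi> m z))"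
proof (rule bounded_measI[where B = "(real m * M) powr r"])
  note [measurable] = birkhoff_measurable
  show "(\<lambda>z. signed_powr r (birkhoff \<phi> m z)) \<in> borel_measurable prod_lam" unfolding signed_powr_def by measurable
  assume r: "0 \<le> r"
  show "\<bar>signed_powr r (birkhoff \<phi> m z)\<bar> \<le> (real m * M) powr r" if "z \<in> space prod_lam" for z
  proof -
    have "\<bar>signed_powr r (birkhoff \<phi> m z)\<bar> \<le> \<bar>birkhoff \<phi> m z\<bar> powr r" by (auto simp: signed_powr_def abs_mult sgn_if)
    also have "\<dots> \<le> (real m * M) powr r" using birkhoff_bound[OF that, of m] r by (intro powr_mono2) auto
    finally show ?thesis .
  qed
qed

lemma increment_weight_meas: "bounded_meas (increment_weight \<phi> p k)"
  unfolding increment_weight_def[abs_def] using p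
  by (intro bounded_meas_add bounded_meas_skew birkhoff_powr_meas) auto

lemma lagged_integrable: "integrable lam (lagged h \<phi> l)"
  unfolding lagged_def by (intro transfer_pow_integrable integrable_lam_mult_bounded[OF h(1) \<phi>])

lemma pairing_invariant: "bounded_meas G \<Longrightarrow> pairing h (\<lambda>z. G (skew z)) = pairing h G"
  using pairing_skew[OF h(1)] pairing_cong_AE[OF transfer_integrable[OF h(1)] h(1) _ h(3)] by simp

lemma moment_skew: "pairing h (\<lambda>z. \<bar>birkhoff \<phi> m (skew z)\<bar> powr (2 * p)) = moment h \<phi> p m"
  unfolding moment_def using p by (intro pairing_invariant birkhoff_powr_meas) auto

lemma pairing_mono:
  assumes "integrable lam u" "bounded_meas F" "integrable lam v" "bounded_meas G"
    and "\<And>z. z \<in> space prod_lam \<Longrightarrow> u (snd z) * F z \<le> v (snd z) * G z"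
  shows "pairing u F \<le> pairing v G"
  unfolding pairing_def using assms by (intro integral_mono integrable_pairing) auto

text \<open>Positivity bounds the iterate of h \<phi> by that of M h, which is M h. This holds only
  almost everywhere, as h is fixed only up to a null set.\<close>

lemma lagged_bound: "AE x in lam. \<bar>lagged h \<phi> l x\<bar> \<le> M * h x"
proof -
  have "(LINT x|lam. \<bar>(transfer ^^ l) h x - h x\<bar>) = 0" by (rule transfer_pow_fixed[OF h(1,3)])
  then have "AE x in lam. \<bar>(transfer ^^ l) h x - h x\<bar> = 0"
    using h transfer_pow_integrable[OF h(1)] by (subst (asm) integral_nonneg_eq_0_iff_AE) auto
  then show ?thesis using AE_space
  proof eventually_elim
    case (elim x)
    then have x: "x \<in> {0..1}" by simp
    have "\<bar>lagged h \<phi> l x\<bar> \<le> (transfer ^^ l) (\<lambda>x. \<bar>h x * \<phi> x\<bar>) x"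
      unfolding lagged_def by (rule transfer_pow_abs[OF x])
    also have "\<dots> \<le> (transfer ^^ l) (\<lambda>x. M * h x) x"
    proof (rule transfer_pow_mono[OF _ x])
      fix x :: real assume "x \<in> {0..1}"
      then have "h x * \<bar>\<phi> x\<bar> \<le> h x * M" using h(2)[of x] \<phi>(2)[of x] by (intro mult_left_mono) auto
      then show "\<bar>h x * \<phi> x\<bar> \<le> M * h x" using h(2)[of x] \<open>x \<in> {0..1}\<close> by (simp add: abs_mult mult.commute)
    qed
    also have "\<dots> = M * h x" using elim by (simp add: transfer_pow_scale)
    finally show ?case .
  qed
qed

text \<open>The sum grows at its earliest time, by \<phi> of the starting point. The first-order
  term carries the signed density h \<phi>, and \<phi>^2 \<le> M \<bar>\<phi>\<bar> makes \<bar>h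
  \<phi>\<bar> the density of the remainder as well.\<close>

lemma moment_increment:
  "moment h \<phi> p (Suc m) \<le> moment h \<phi> p m + 2 * p * pairing (lagged h \<phi> 0) (\<lambda>z. signed_powr (2 * p - 1) (birkhoff \<phi> m (skew z)))
     + 2 * p * (2 * p - 1) * M * pairing (\<lambda>x. \<bar>lagged h \<phi> 0 x\<bar>) (increment_weight \<phi> p m)"
proof -
  let ?a = "\<lambda>z. birkhoff \<phi> m (skew z)" and ?b = "birkhoff \<phi> (Suc m)"
  let ?i1 = "\<lambda>z. h (snd z) * \<bar>?a z\<bar> powr (2 * p)"
  let ?i2 = "\<lambda>z. lagged h \<phi> 0 (snd z) * signed_powr (2 * p - 1) (?a z)"
  let ?i3 = "\<lambda>z. \<bar>lagged h \<phi> 0 (snd z)\<bar> * increment_weight \<phi> p m z"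
  have q: "2 \<le> 2 * p" using p by simp
  have i: "integrable prod_lam ?i1" "integrable prod_lam ?i2" "integrable prod_lam ?i3"
    using p by (intro integrable_pairing h lagged_integrable increment_weight_meas
      bounded_meas_skew[OF birkhoff_powr_meas] bounded_meas_skew[OF birkhoff_signed_meas] integrable_abs; simp)+
  have "moment h \<phi> p (Suc m) \<le> (LINT z|prod_lam. ?i1 z + 2 * p * ?i2 z + 2 * p * (2 * p - 1) * M * ?i3 z)"
    unfolding moment_def pairing_def
  proof (rule integral_mono)
    show "integrable prod_lam (\<lambda>z. h (snd z) * \<bar>?b z\<bar> powr (2 * p))"
      using p by (intro integrable_pairing h birkhoff_powr_meas) auto
    show "integrable prod_lam (\<lambda>z. ?i1 z + 2 * p * ?i2 z + 2 * p * (2 * p - 1) * M * ?i3 z)"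
      using i by (intro Bochner_Integration.integrable_add integrable_mult_right)
    fix z assume z: "z \<in> space prod_lam"
    note x = snd_in[OF z]
    let ?W = "increment_weight \<phi> p m z" and ?f = "\<phi> (snd z)" and ?h = "h (snd z)"
    have W: "0 \<le> ?W" by (simp add: increment_weight_def)
    have eq: "?b z - ?a z = ?f" by simp
    have "\<bar>?b z\<bar> powr (2 * p) \<le> \<bar>?a z\<bar> powr (2 * p) + 2 * p * signed_powr (2 * p - 1) (?a z) * ?f
        + 2 * p * (2 * p - 1) * ?f\<^sup>2 * ?W"
      using abs_powr_step[OF q, of "?b z" "?a z"] unfolding eq increment_weight_def .
    also have "2 * p * (2 * p - 1) * ?f\<^sup>2 * ?W \<le> 2 * p * (2 * p - 1) * (M * \<bar>?f\<bar>) * ?W"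
    proof (intro mult_right_mono mult_left_mono W)
      have "\<bar>?f\<bar> * \<bar>?f\<bar> \<le> M * \<bar>?f\<bar>" using \<phi>(2)[OF x] by (intro mult_right_mono) auto
      then show "?f\<^sup>2 \<le> M * \<bar>?f\<bar>" by (simp add: power2_eq_square)
    qed (use p in auto)
    finally have "\<bar>?b z\<bar> powr (2 * p) \<le> \<bar>?a z\<bar> powr (2 * p) + 2 * p * signed_powr (2 * p - 1) (?a z) * ?f
        + 2 * p * (2 * p - 1) * (M * \<bar>?f\<bar>) * ?W" by simp
    then have "?h * \<bar>?b z\<bar> powr (2 * p) \<le> ?h * (\<bar>?a z\<bar> powr (2 * p) + 2 * p * signed_powr (2 * p - 1) (?a z) * ?f
        + 2 * p * (2 * p - 1) * (M * \<bar>?f\<bar>) * ?W)" using h(2)[OF x] by (rule mult_left_mono)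
    also have "\<dots> = ?i1 z + 2 * p * ?i2 z + 2 * p * (2 * p - 1) * M * ?i3 z"
      using h(2)[OF x] by (simp add: lagged_def abs_mult distrib_left mult_ac)
    finally show "?h * \<bar>?b z\<bar> powr (2 * p) \<le> ?i1 z + 2 * p * ?i2 z + 2 * p * (2 * p - 1) * M * ?i3 z" .
  qed
  also have "\<dots> = integral\<^sup>L prod_lam ?i1 + 2 * p * integral\<^sup>L prod_lam ?i2 + 2 * p * (2 * p - 1) * M * integral\<^sup>L prod_lam ?i3"
    using i by simp
  also have "integral\<^sup>L prod_lam ?i1 = moment h \<phi> p m"
    using moment_skew[of m] by (simp add: pairing_def)
  finally show ?thesis by (simp add: pairing_def)
qed

text \<open>\<open>pairing_skew\<close> trades the shift for one more lag, so the derivative is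
  evaluated at the sum of length m itself. Dropping the first term of that sum costs one increment
  weight and restores the original form with length m - 1; the telescoping ends at the empty sum,
  where \<open>signed_powr\<close> vanishes.\<close>

lemma lagged_cross_term:
  "pairing (lagged h \<phi> l) (\<lambda>z. signed_powr (2 * p - 1) (birkhoff \<phi> m (skew z)))
    \<le> (2 * p - 1) * M * (\<Sum>i<m. pairing (\<lambda>x. \<bar>lagged h \<phi> (Suc l + i) x\<bar>) (increment_weight \<phi> p (m - 1 - i)))"
proof (induction m arbitrary: l)
  case 0
  then show ?case by (simp add: signed_powr_def pairing_def)
next
  case (Suc m)
  let ?g = "\<lambda>m z. signed_powr (2 * p - 1) (birkhoff \<phi> m z)"
  let ?u = "lagged h \<phi> (Suc l)"
  have gm: "bounded_meas (?g k)" for k using p by (intro birkhoff_signed_meas) auto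
  have u: "integrable lam ?u" by (rule lagged_integrable)
  have i: "integrable prod_lam (\<lambda>z. ?u (snd z) * ?g m (skew z))" "integrable prod_lam (\<lambda>z. \<bar>?u (snd z)\<bar> * increment_weight \<phi> p m z)"
    "integrable prod_lam (\<lambda>z. ?u (snd z) * ?g (Suc m) z)"
    using u by (intro integrable_pairing bounded_meas_skew[OF gm] gm increment_weight_meas; simp)+
  have "pairing (lagged h \<phi> l) (\<lambda>z. ?g (Suc m) (skew z)) = pairing ?u (?g (Suc m))"
    using pairing_skew[OF lagged_integrable gm, of l "Suc m"] by (simp add: lagged_def)
  also have "\<dots> \<le> (LINT z|prod_lam. ?u (snd z) * ?g m (skew z) + (2 * p - 1) * M * (\<bar>?u (snd z)\<bar> * increment_weight \<phi> p m z))"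
    unfolding pairing_def
  proof (rule integral_mono[OF i(3)])
    show "integrable prod_lam (\<lambda>z. ?u (snd z) * ?g m (skew z) + (2 * p - 1) * M * (\<bar>?u (snd z)\<bar> * increment_weight \<phi> p m z))"
      using i by (intro Bochner_Integration.integrable_add integrable_mult_right)
    fix z assume z: "z \<in> space prod_lam"
    let ?W = "increment_weight \<phi> p m z"
    have W: "0 \<le> ?W" by (simp add: increment_weight_def)
    have "\<bar>?g (Suc m) z - ?g m (skew z)\<bar> \<le> (2 * p - 1) * \<bar>birkhoff \<phi> (Suc m) z - birkhoff \<phi> m (skew z)\<bar> *
       (\<bar>birkhoff \<phi> (Suc m) z\<bar> powr (2 * p - 1 - 1) + \<bar>birkhoff \<phi> m (skew z)\<bar> powr (2 * p - 1 - 1))"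
      using p by (intro signed_powr_diff) auto
    also have "\<dots> = (2 * p - 1) * \<bar>\<phi> (snd z)\<bar> * ?W" by (simp add: increment_weight_def)
    also have "\<dots> \<le> (2 * p - 1) * M * ?W"
      using p \<phi>(2)[OF snd_in[OF z]] W by (intro mult_right_mono mult_left_mono) auto
    finally have d: "\<bar>?g (Suc m) z - ?g m (skew z)\<bar> \<le> (2 * p - 1) * M * ?W" .
    have "?u (snd z) * (?g (Suc m) z - ?g m (skew z)) \<le> \<bar>?u (snd z)\<bar> * \<bar>?g (Suc m) z - ?g m (skew z)\<bar>"
      by (simp flip: abs_mult)
    also have "\<dots> \<le> \<bar>?u (snd z)\<bar> * ((2 * p - 1) * M * ?W)" by (intro mult_left_mono d) auto
    finally show "?u (snd z) * ?g (Suc m) z \<le> ?u (snd z) * ?g m (skew z) + (2 * p - 1) * M * (\<bar>?u (snd z)\<bar> * ?W)"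
      by (simp add: algebra_simps)
  qed
  also have "\<dots> = pairing ?u (\<lambda>z. ?g m (skew z)) + (2 * p - 1) * M * pairing (\<lambda>x. \<bar>?u x\<bar>) (increment_weight \<phi> p m)"
    using i by (simp add: pairing_def)
  also have "\<dots> \<le> (2 * p - 1) * M * (\<Sum>i<m. pairing (\<lambda>x. \<bar>lagged h \<phi> (Suc (Suc l) + i) x\<bar>) (increment_weight \<phi> p (m - 1 - i)))
     + (2 * p - 1) * M * pairing (\<lambda>x. \<bar>?u x\<bar>) (increment_weight \<phi> p m)"
    by (intro add_right_mono Suc)
  also have "\<dots> = (2 * p - 1) * M * (\<Sum>i<Suc m. pairing (\<lambda>x. \<bar>lagged h \<phi> (Suc l + i) x\<bar>) (increment_weight \<phi> p (Suc m - 1 - i)))"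
    unfolding sum.lessThan_Suc_shift by (simp add: distrib_left)
  finally show ?case .
qed

lemma pairing_lagged_split:
  assumes t: "0 < t"
  shows "pairing (\<lambda>x. \<bar>lagged h \<phi> l x\<bar>) (increment_weight \<phi> p k)
    \<le> t * (moment h \<phi> p k + moment h \<phi> p (Suc k)) + 2 * ((M / t) powr (p - 1) * (LINT x|lam. \<bar>lagged h \<phi> l x\<bar>))"
proof -
  \<comment> \<open>The bound of the lagged density by M h holds almost everywhere, while
    \<open>weighted_power_split\<close> is applied pointwise; the minimum satisfies it everywhere
    and defines the same pairing.\<close>
  define v where "v = (\<lambda>x. min \<bar>lagged h \<phi> l x\<bar> (M * h x))"
  have l: "integrable lam (\<lambda>x. \<bar>lagged h \<phi> l x\<bar>)" using lagged_integrable by simp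
  have vi: "integrable lam v" unfolding v_def using l h(1) by (intro integrable_min) auto
  let ?c = "(M / t) powr (p - 1)"
  let ?i1 = "\<lambda>z. h (snd z) * \<bar>birkhoff \<phi> k (skew z)\<bar> powr (2 * p)"
  let ?i2 = "\<lambda>z. h (snd z) * \<bar>birkhoff \<phi> (Suc k) z\<bar> powr (2 * p)"
  let ?i3 = "\<lambda>z. \<bar>lagged h \<phi> l (snd z)\<bar> * 1"
  have one: "bounded_meas (\<lambda>_. 1)" by (rule bounded_measI[where B = 1]) auto
  have i: "integrable prod_lam ?i1" "integrable prod_lam ?i2" "integrable prod_lam ?i3"
    using p l by (intro integrable_pairing h one bounded_meas_skew[OF birkhoff_powr_meas] birkhoff_powr_meas; simp)+
  have p1: "pairing (\<lambda>x. \<bar>lagged h \<phi> l x\<bar>) (\<lambda>_. 1) = (LINT x|lam. \<bar>lagged h \<phi> l x\<bar>)"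
  proof -
    interpret words: prob_space words by (rule prob_space_words)
    have "fibre_mean (\<lambda>_. 1) x = 1" for x unfolding fibre_mean_def using words.prob_space by simp
    then show ?thesis by (simp add: pairing_fibre[OF l one])
  qed
  have "pairing (\<lambda>x. \<bar>lagged h \<phi> l x\<bar>) (increment_weight \<phi> p k) = pairing v (increment_weight \<phi> p k)"
    by (rule pairing_cong_AE[OF l vi increment_weight_meas]) (use lagged_bound[of l] in \<open>auto simp: v_def\<close>)
  also have "\<dots> \<le> (LINT z|prod_lam. t * ?i1 z + t * ?i2 z + 2 * ?c * ?i3 z)"
    unfolding pairing_def
  proof (rule integral_mono[OF integrable_pairing[OF vi increment_weight_meas]])
    show "integrable prod_lam (\<lambda>z. t * ?i1 z + t * ?i2 z + 2 * ?c * ?i3 z)"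
      using i by (intro Bochner_Integration.integrable_add integrable_mult_right)
    fix z assume z: "z \<in> space prod_lam"
    note x = snd_in[OF z]
    have v: "0 \<le> v (snd z)" "v (snd z) \<le> M * h (snd z)" "v (snd z) \<le> \<bar>lagged h \<phi> l (snd z)\<bar>"
      using h(2)[OF x] M by (auto simp: v_def)
    have s: "v (snd z) * \<bar>U\<bar> powr (2 * p - 2) \<le> t * (h (snd z) * \<bar>U\<bar> powr (2 * p)) + ?c * v (snd z)" for U
      by (rule weighted_power_split[OF v(1,2) h(2)[OF x] t M p]) simp
    have "?c * v (snd z) \<le> ?c * \<bar>lagged h \<phi> l (snd z)\<bar>" using v(3) by (intro mult_left_mono) auto
    then show "v (snd z) * increment_weight \<phi> p k z \<le> t * ?i1 z + t * ?i2 z + 2 * ?c * ?i3 z"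
      using s[of "birkhoff \<phi> k (skew z)"] s[of "birkhoff \<phi> (Suc k) z"]
      unfolding increment_weight_def distrib_left by linarith
  qed
  also have "\<dots> = t * integral\<^sup>L prod_lam ?i1 + t * integral\<^sup>L prod_lam ?i2 + 2 * ?c * integral\<^sup>L prod_lam ?i3"
    using i by simp
  also have "integral\<^sup>L prod_lam ?i1 = moment h \<phi> p k" using moment_skew[of k] by (simp add: pairing_def)
  also have "integral\<^sup>L prod_lam ?i2 = moment h \<phi> p (Suc k)" by (simp add: moment_def pairing_def)
  also have "integral\<^sup>L prod_lam ?i3 = (LINT x|lam. \<bar>lagged h \<phi> l x\<bar>)" using p1 by (simp add: pairing_def)
  finally show ?thesis by (simp add: algebra_simps)
qed

text \<open>Lag 0 is the second-order remainder of the added term, and lags 1 to m come from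
  telescoping the derivative. Both carry the factor \<open>2 * p * (2 * p - 1) * M\<close>, so they
  form a single sum.\<close>

lemma moment_step:
  assumes t: "\<And>l. 0 < t l"
  shows "moment h \<phi> p (Suc m) - moment h \<phi> p m \<le> 2 * p * (2 * p - 1) * M *
    (\<Sum>l\<le>m. t l * (moment h \<phi> p (m - l) + moment h \<phi> p (Suc (m - l))) + 2 * ((M / t l) powr (p - 1) * (LINT x|lam. \<bar>lagged h \<phi> l x\<bar>)))"
proof -
  let ?K = "2 * p * (2 * p - 1) * M"
  let ?P = "\<lambda>l k. pairing (\<lambda>x. \<bar>lagged h \<phi> l x\<bar>) (increment_weight \<phi> p k)"
  have "2 * p * pairing (lagged h \<phi> 0) (\<lambda>z. signed_powr (2 * p - 1) (birkhoff \<phi> m (skew z)))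
     \<le> 2 * p * ((2 * p - 1) * M * (\<Sum>i<m. ?P (Suc 0 + i) (m - 1 - i)))"
    using p by (intro mult_left_mono lagged_cross_term) auto
  then have "moment h \<phi> p (Suc m) - moment h \<phi> p m \<le> 2 * p * ((2 * p - 1) * M * (\<Sum>i<m. ?P (Suc 0 + i) (m - 1 - i))) + ?K * ?P 0 m"
    using moment_increment[of m] by linarith
  also have "\<dots> = ?K * (\<Sum>l<Suc m. ?P l (m - l))"
    unfolding sum.lessThan_Suc_shift by (simp add: distrib_left)
  also have "\<dots> \<le> ?K * (\<Sum>l\<le>m. t l * (moment h \<phi> p (m - l) + moment h \<phi> p (Suc (m - l))) + 2 * ((M / t l) powr (p - 1) * (LINT x|lam. \<bar>lagged h \<phi> l x\<bar>)))"
    unfolding lessThan_Suc_atMost using p M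
    by (intro mult_left_mono sum_mono pairing_lagged_split t) auto
  finally show ?thesis .
qed

lemma moment_bound:
  assumes b: "0 \<le> b" "b < p" and D: "0 \<le> D" "\<And>l. (LINT x|lam. \<bar>lagged h \<phi> l x\<bar>) \<le> D * real (Suc l) powr - b" and n: "1 \<le> n"
  shows "moment h \<phi> p n \<le> moment_constant (2 * p * (2 * p - 1) * M) M p b D * real n powr (2 * p - b)"
proof (rule moment_recursion[OF _ M D(1) b p _ _ D(2) moment_step n])
  show "0 < 2 * p * (2 * p - 1) * M" using p M by simp
  show "moment h \<phi> p 0 = 0" by (simp add: moment_def pairing_def)
  show "0 \<le> moment h \<phi> p m" for m
    unfolding moment_def pairing_def using h(2) snd_in by (intro Bochner_Integration.integral_nonneg) auto
qed

lemma moment_markov: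
  assumes E: "E \<in> sets prod_lam" "\<And>z. z \<in> E \<Longrightarrow> a \<le> \<bar>birkhoff \<phi> n (skew z)\<bar>" and a: "0 < a"
  shows "pairing h (indicator E) \<le> moment h \<phi> p n / a powr (2 * p)"
proof -
  have iE: "bounded_meas (indicator E)" by (rule bounded_measI[where B = 1]) (use E in \<open>auto simp: indicator_def\<close>)
  have G: "bounded_meas (\<lambda>z. \<bar>birkhoff \<phi> n (skew z)\<bar> powr (2 * p))"
    using p by (intro bounded_meas_skew[OF birkhoff_powr_meas]) auto
  have "pairing (\<lambda>x. a powr (2 * p) * h x) (indicator E) \<le> pairing h (\<lambda>z. \<bar>birkhoff \<phi> n (skew z)\<bar> powr (2 * p))"
  proof (rule pairing_mono[OF _ iE h(1) G])
    fix z assume z: "z \<in> space prod_lam"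
    have *: "a powr (2 * p) * indicator E z \<le> \<bar>birkhoff \<phi> n (skew z)\<bar> powr (2 * p)"
      using E(2)[of z] a p by (auto simp: indicator_def intro: powr_mono2)
    then show "a powr (2 * p) * h (snd z) * indicator E z \<le> h (snd z) * \<bar>birkhoff \<phi> n (skew z)\<bar> powr (2 * p)"
      using mult_left_mono[OF * h(2)[OF snd_in[OF z]]] by (simp add: mult_ac)
  qed (use h in auto)
  also have "\<dots> = moment h \<phi> p n" by (rule moment_skew)
  also have "pairing (\<lambda>x. a powr (2 * p) * h x) (indicator E) = a powr (2 * p) * pairing h (indicator E)"
    by (simp add: pairing_def mult.assoc)
  finally show ?thesis using a by (simp add: field_simps)
qed

end

end

section \<open>Large deviations\<close>

context random_lsv
begin

text \<open>Stationarity, tested on a measurable set and rewritten by duality, says that h and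
  \<open>transfer h\<close> have equal integrals over every such set. \<open>enn2real\<close>
  provides a representative that is finite and nonnegative everywhere.\<close>

lemma stationary_density:
  assumes \<mu>: "ac_stationary_measure \<Omega> P \<mu>"
  obtains h where "integrable lam h" "\<And>x. 0 \<le> h x" "AE x in lam. transfer h x = h x"
    "integral\<^sup>L lam h = 1" "\<mu> = density lam (\<lambda>x. ennreal (h x))"
proof -
  interpret lam: prob_space lam by (rule prob_space_lam)
  have st: "stationary_measure \<Omega> P \<mu>" and ac: "absolutely_continuous lam \<mu>"
    using \<mu> by (auto simp: ac_stationary_measure_def)
  interpret \<mu>: prob_space \<mu> using st by (simp add: stationary_measure_def)
  have sets: "sets \<mu> = sets lam" using st by (simp add: stationary_measure_def sets_lam)
  have space: "space \<mu> = {0..1}" using sets_eq_imp_space_eq[OF sets] by simp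
  define r where "r = RN_deriv lam \<mu>"
  define h where "h = (\<lambda>x. enn2real (r x))"
  have [measurable]: "r \<in> borel_measurable lam" by (simp add: r_def)
  have [measurable]: "h \<in> borel_measurable lam" by (simp add: h_def)
  have fin: "AE x in lam. r x \<noteq> \<infinity>"
    unfolding r_def by (rule lam.RN_deriv_finite[OF _ ac sets]) (rule \<mu>.sigma_finite_measure_axioms)
  have "density lam (\<lambda>x. ennreal (h x)) = density lam r"
    by (rule density_cong) (use fin in \<open>auto simp: h_def less_top\<close>)
  then have dens: "\<mu> = density lam (\<lambda>x. ennreal (h x))"
    using lam.density_RN_deriv[OF ac sets] by (simp add: r_def)
  have h0: "0 \<le> h x" for x by (simp add: h_def)
  have [measurable]: "{0..1::real} \<in> sets lam" using sets.top[of lam] by simp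
  have "(\<integral>\<^sup>+x. ennreal (h x) \<partial>lam) = emeasure \<mu> (space \<mu>)"
    unfolding space by (subst dens, subst emeasure_density) (auto intro!: nn_integral_cong simp: indicator_def)
  then have nn: "(\<integral>\<^sup>+x. ennreal (h x) \<partial>lam) = 1" by (simp add: \<mu>.emeasure_space_1)
  have hi: "integrable lam h" by (rule integrableI_nonneg) (use h0 nn in auto)
  have h1: "integral\<^sup>L lam h = 1" using nn h0 by (simp add: integral_eq_nn_integral)
  have meas: "measure \<mu> A = (LINT x|lam. h x * indicator A x)" if A: "A \<in> sets lam" for A
  proof -
    have [measurable]: "A \<in> sets lam" by fact
    have "measure \<mu> A = (LINT x|\<mu>. indicator A x)"
      using A sets sets.sets_into_space[OF A] space by (simp add: Int_absorb2)
    also have "\<dots> = (LINT x|lam. h x * indicator A x)"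
      unfolding dens by (subst integral_real_density) (use h0 in auto)
    finally show ?thesis .
  qed
  have "AE x in lam. transfer h x = h x"
  proof (rule density_unique_real[OF transfer_integrable[OF hi] hi])
    fix A :: "real set" assume A: "A \<in> sets lam"
    have ind: "(indicator A :: real \<Rightarrow> real) \<in> borel_measurable lam" using A by simp
    have "(LINT x:A|lam. transfer h x) = (LINT x|lam. transfer h x * indicator A x)"
      by (simp add: set_lebesgue_integral_def mult.commute)
    also have "\<dots> = (\<Sum>\<beta>\<in>\<Omega>. P \<beta> * (LINT x|lam. h x * indicator A (intermittent_map \<beta> x)))"
      by (rule transfer_dual(2)[OF hi ind, of 1]) (auto simp: indicator_def)
    also have "\<dots> = (\<Sum>\<beta>\<in>\<Omega>. P \<beta> * measure \<mu> (intermittent_map \<beta> -` A \<inter> {0..1}))"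
    proof (rule sum.cong[OF refl])
      fix \<beta> assume \<beta>: "\<beta> \<in> \<Omega>"
      have "intermittent_map \<beta> -` A \<inter> {0..1} \<in> sets lam"
        using measurable_sets[OF intermittent_map_lam[OF \<Omega>D(1,3)[OF \<beta>]] A] by simp
      note meas[OF this]
      also have "(LINT x|lam. h x * indicator (intermittent_map \<beta> -` A \<inter> {0..1}) x) = (LINT x|lam. h x * indicator A (intermittent_map \<beta> x))"
        by (rule integral_lam_cong) (auto simp: indicator_def)
      finally show "P \<beta> * (LINT x|lam. h x * indicator A (intermittent_map \<beta> x)) = P \<beta> * measure \<mu> (intermittent_map \<beta> -` A \<inter> {0..1})"
        by simp
    qed
    also have "\<dots> = measure \<mu> A" using st A sets by (simp add: stationary_measure_def)
    also have "\<dots> = (LINT x:A|lam. h x)"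
      using meas[OF A] by (simp add: set_lebesgue_integral_def mult.commute)
    finally show "(LINT x:A|lam. transfer h x) = (LINT x:A|lam. h x)" .
  qed
  then show ?thesis using that hi h0 h1 dens by blast
qed

lemma measure_pairing:
  assumes h: "integrable lam h" "\<And>x. 0 \<le> h x" and \<mu>: "\<mu> = density lam (\<lambda>x. ennreal (h x))" "prob_space \<mu>"
    and E: "E \<in> sets prod_lam"
  shows "measure (words \<Otimes>\<^sub>M \<mu>) E = pairing h (indicator E)"
proof -
  interpret words: prob_space words by (rule prob_space_words)
  interpret \<mu>: prob_space \<mu> by (rule \<mu>(2))
  interpret lam: prob_space lam by (rule prob_space_lam)
  interpret pp: pair_prob_space words \<mu> ..
  have [measurable]: "h \<in> borel_measurable lam" using h by simp
  have [measurable]: "E \<in> sets prod_lam" by fact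
  have "words \<Otimes>\<^sub>M \<mu> = density words (\<lambda>_. 1) \<Otimes>\<^sub>M density lam (\<lambda>x. ennreal (h x))"
    by (simp add: \<mu>(1) density_1)
  also have "\<dots> = density prod_lam (\<lambda>(\<omega>, x). 1 * ennreal (h x))"
    by (rule pair_measure_density)
       (use \<mu>.sigma_finite_measure_axioms lam.sigma_finite_measure_axioms in \<open>auto simp: \<mu>(1)\<close>)
  also have "(\<lambda>(\<omega>, x). 1 * ennreal (h x)) = (\<lambda>z :: (nat \<Rightarrow> real) \<times> real. ennreal (h (snd z)))" by (auto simp: fun_eq_iff)
  finally have d: "words \<Otimes>\<^sub>M \<mu> = density prod_lam (\<lambda>z. ennreal (h (snd z)))" .
  have "measure (words \<Otimes>\<^sub>M \<mu>) E = (LINT z|(words \<Otimes>\<^sub>M \<mu>). indicator E z)"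
    using sets.sets_into_space[OF E] unfolding d by (simp add: Int_absorb2)
  also have "\<dots> = pairing h (indicator E)"
    unfolding d pairing_def by (subst integral_real_density) (use h in auto)
  finally show ?thesis .
qed

end

text \<open>The quantifiers over \<Omega>, P, \<mu> and \<phi> sit inside, so existence of C for
  each triple of \<alpha>, p and norm N is exactly the required uniformity.\<close>

definition deviation_constant :: "real \<Rightarrow> real \<Rightarrow> real \<Rightarrow> real \<Rightarrow> bool" where
  "deviation_constant \<alpha> p N C \<longleftrightarrow> (\<forall>\<Omega> P \<mu> \<phi>. finite \<Omega> \<longrightarrow> \<Omega> \<subseteq> {0<..<\<alpha>} \<longrightarrow> prob_distribution_on \<Omega> P \<longrightarrow>
      ac_stationary_measure \<Omega> P \<mu> \<longrightarrow> C1_unit \<phi> \<longrightarrow> C1_norm \<phi> = N \<longrightarrow> (LINT x|\<mu>. \<phi> x) = 0 \<longrightarrow>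
      (\<forall>(\<epsilon>::real) (n::nat). \<epsilon> > 0 \<longrightarrow> n \<ge> 2 \<longrightarrow>
        measure (bernoulli_measure \<Omega> P \<Otimes>\<^sub>M \<mu>)
          {(\<omega>, x) \<in> space (bernoulli_measure \<Omega> P \<Otimes>\<^sub>M \<mu>).
             \<bar>\<Sum>j=1..n. \<phi> (random_iterate \<omega> j x)\<bar> \<ge> real n * \<epsilon>}
        \<le> C * real n powr (1 - 1 / \<alpha>) * ln (real n) powr (1 / \<alpha>) * \<epsilon> powr (- 2 * p)))"

lemma deviation_constant_exists:
  fixes \<alpha> p N :: real
  assumes \<alpha>: "0 < \<alpha>" "\<alpha> < 1" and p: "max 1 (1 / \<alpha> - 1) < p"
  shows "\<exists>C. deviation_constant \<alpha> p N C"
proof -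
  define b where "b = 1 / \<alpha> - 1"
  have b: "0 < b" "b < p" and p1: "1 < p" using \<alpha> p by (auto simp: b_def field_simps)
  obtain B where B: "0 < B" "\<And>\<Omega> P N. random_lsv \<alpha> \<Omega> P \<Longrightarrow> 1 \<le> N \<Longrightarrow>
      random_lsv.contracts \<alpha> \<Omega> P N (B * real N powr (1 - 1 / \<alpha>))"
    using uniform_contraction[OF \<alpha>] by blast
  \<comment> \<open>Strictly positive also for N = 0, and for negative N, which no observable
    attains.\<close>
  define M where "M = \<bar>N\<bar> + 1"
  have M: "0 < M" by (simp add: M_def)
  \<comment> \<open>5 M B comes from \<open>correlation_decay\<close>, 2^b from l \<ge> (l + 1) / 2
    when the rate in l is rewritten in l + 1, and the summand M covers l = 0.\<close>
  define D where "D = 5 * M * B * 2 powr b + M"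
  have D: "0 \<le> D" using M B by (simp add: D_def)
  define C0 where "C0 = moment_constant (2 * p * (2 * p - 1) * M) M p b D"
  have C0: "0 \<le> C0" using M D p1 b by (simp add: C0_def moment_constant_def)
  \<comment> \<open>The moment bound gives n^(-b) alone; since n \<ge> 2, the logarithmic factor is
    at least (ln 2)^(1/\<alpha>), and dividing by this number inserts it.\<close>
  define C where "C = C0 / ln 2 powr (1 / \<alpha>)"
  show ?thesis unfolding deviation_constant_def
  proof (intro exI[of _ C] allI impI)
    fix \<Omega> P \<mu> \<phi> and \<epsilon> :: real and n :: nat
    assume fin: "finite \<Omega>" and sub: "\<Omega> \<subseteq> {0<..<\<alpha>}" and pr: "prob_distribution_on \<Omega> P"
      and \<mu>: "ac_stationary_measure \<Omega> P \<mu>" and C1: "C1_unit \<phi>" and norm: "C1_norm \<phi> = N"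
      and mean: "(LINT x|\<mu>. \<phi> x) = 0" and \<epsilon>: "\<epsilon> > 0" and n: "n \<ge> 2"
    interpret random_lsv \<alpha> \<Omega> P using \<alpha> fin sub pr by unfold_locales
    have \<mu>p: "prob_space \<mu>" and \<mu>s: "sets \<mu> = sets lam"
      using \<mu> by (auto simp: ac_stationary_measure_def stationary_measure_def sets_lam)
    obtain h where h: "integrable lam h" "\<And>x. 0 \<le> h x" "AE x in lam. transfer h x = h x"
      "integral\<^sup>L lam h = 1" "\<mu> = density lam (\<lambda>x. ennreal (h x))"
      using stationary_density[OF \<mu>] by blast
    have N0: "0 \<le> N" using C1_unit_bounds(1)[OF C1] norm by simp
    have \<phi>b: "\<bar>\<phi> x\<bar> \<le> M" if "x \<in> {0..1}" for x
      using C1_unit_bounds(2)[OF C1 that] norm by (simp add: M_def)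
    have \<phi>L: "M-lipschitz_on {0..1} \<phi>"
      using C1_unit_bounds(3)[OF C1] N0 by (rule_tac lipschitz_on_mono) (auto simp: norm M_def)
    have \<phi>m: "\<phi> \<in> borel_measurable lam" by (rule lipschitz_borel[OF \<phi>L])
    have mean': "(LINT x|lam. h x * \<phi> x) = 0"
      using mean h(1,2) \<phi>m unfolding h(5) by (subst (asm) integral_real_density) auto
    note ctx = h(1) h(2) h(3) M \<phi>m \<phi>b p1
    have lag: "(LINT x|lam. \<bar>lagged h \<phi> l x\<bar>) \<le> D * real (Suc l) powr - b" for l
    proof (cases "l = 0")
      case True
      have "(LINT x|lam. \<bar>h x * \<phi> x\<bar>) \<le> (LINT x|lam. h x * M)"
      proof (intro integral_lam_mono integrable_abs integrable_mult_left h(1))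
        show "integrable lam (\<lambda>x. h x * \<phi> x)" by (rule integrable_lam_mult_bounded[OF h(1) \<phi>m \<phi>b])
        fix x :: real assume "0 < x" "x \<le> 1"
        then show "\<bar>h x * \<phi> x\<bar> \<le> h x * M"
          using mult_left_mono[OF \<phi>b[of x] h(2)[of x]] h(2)[of x] by (simp add: abs_mult)
      qed
      also have "\<dots> \<le> D" using h(4) B M by (simp add: D_def)
      finally show ?thesis using True by (simp add: lagged_def)
    next
      case False
      then have l: "1 \<le> l" by simp
      have "(LINT x|lam. \<bar>lagged h \<phi> l x\<bar>) \<le> 5 * M * (B * real l powr (1 - 1 / \<alpha>))"
        unfolding lagged_def
        by (rule correlation_decay[OF h(1,3,4) B(2) _ M \<phi>b \<phi>L mean' l]) (use B(1) random_lsv_axioms in auto)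
      also have "real l powr (1 - 1 / \<alpha>) = real l powr - b" by (simp add: b_def)
      also have "real l powr - b \<le> (real (Suc l) / 2) powr - b" using l b by (intro powr_mono2') auto
      also have "\<dots> = 2 powr b * real (Suc l) powr - b" by (simp add: powr_divide powr_minus field_simps)
      finally have "(LINT x|lam. \<bar>lagged h \<phi> l x\<bar>) \<le> 5 * M * B * 2 powr b * real (Suc l) powr - b"
        using M B(1) by (simp add: mult_ac)
      also have "\<dots> \<le> D * real (Suc l) powr - b" using M by (intro mult_right_mono) (auto simp: D_def)
      finally show ?thesis .
    qed
    define E where "E = {(\<omega>, x) \<in> space (words \<Otimes>\<^sub>M \<mu>). \<bar>\<Sum>j=1..n. \<phi> (random_iterate \<omega> j x)\<bar> \<ge> real n * \<epsilon>}"
    have sp: "space (words \<Otimes>\<^sub>M \<mu>) = space prod_lam"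
      using sets_eq_imp_space_eq[OF \<mu>s] by (simp add: space_pair_measure)
    have E_eq: "E = {z \<in> space prod_lam. real n * \<epsilon> \<le> \<bar>birkhoff \<phi> n (skew z)\<bar>}"
      unfolding E_def sp by (auto simp: birkhoff_skew)
    note [measurable] = birkhoff_measurable[OF ctx]
    have E: "E \<in> sets prod_lam" unfolding E_eq by measurable
    have n0: "0 < real n" using n by simp
    have "measure (words \<Otimes>\<^sub>M \<mu>) E = pairing h (indicator E)"
      by (rule measure_pairing[OF h(1,2,5) \<mu>p E])
    also have "\<dots> \<le> moment h \<phi> p n / (real n * \<epsilon>) powr (2 * p)"
      by (rule moment_markov[OF ctx E]) (use n0 \<epsilon> in \<open>auto simp: E_eq\<close>)
    also have "\<dots> \<le> C0 * real n powr (2 * p - b) / (real n * \<epsilon>) powr (2 * p)"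
      unfolding C0_def using b D lag n by (intro divide_right_mono moment_bound[OF ctx]) auto
    also have "\<dots> = C0 * real n powr - b * \<epsilon> powr (- 2 * p)"
      using n0 \<epsilon> by (simp add: powr_mult powr_diff powr_minus field_simps)
    also have "\<dots> \<le> (C * ln (real n) powr (1 / \<alpha>)) * real n powr - b * \<epsilon> powr (- 2 * p)"
    proof (intro mult_right_mono)
      have "ln 2 powr (1 / \<alpha>) \<le> ln (real n) powr (1 / \<alpha>)" using n \<alpha> by (intro powr_mono2) auto
      then have "C * ln 2 powr (1 / \<alpha>) \<le> C * ln (real n) powr (1 / \<alpha>)" 
        using C0 by (intro mult_left_mono) (auto simp: C_def)
      then show "C0 \<le> C * ln (real n) powr (1 / \<alpha>)" by (simp add: C_def)
    qed auto
    finally show "measure (words \<Otimes>\<^sub>M \<mu>) {(\<omega>, x) \<in> space (words \<Otimes>\<^sub>M \<mu>).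
             \<bar>\<Sum>j=1..n. \<phi> (random_iterate \<omega> j x)\<bar> \<ge> real n * \<epsilon>}
        \<le> C * real n powr (1 - 1 / \<alpha>) * ln (real n) powr (1 / \<alpha>) * \<epsilon> powr (- 2 * p)"
      by (simp add: E_def b_def mult_ac)
  qed
qed

theorem theorem4p6:
  shows "\<exists>C :: real \<Rightarrow> real \<Rightarrow> real \<Rightarrow> real.
    \<forall>(\<alpha>::real) (\<Omega>::real set) (P::real \<Rightarrow> real) (\<mu>::real measure) (\<phi>::real \<Rightarrow> real) (p::real).
      0 < \<alpha> \<longrightarrow> \<alpha> < 1 \<longrightarrow>
      finite \<Omega> \<longrightarrow> \<Omega> \<subseteq> {0<..<\<alpha>} \<longrightarrow> prob_distribution_on \<Omega> P \<longrightarrow>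
      ac_stationary_measure \<Omega> P \<mu> \<longrightarrow>
      C1_unit \<phi> \<longrightarrow> (LINT x|\<mu>. \<phi> x) = 0 \<longrightarrow>
      p > max 1 (1 / \<alpha> - 1) \<longrightarrow>
      (\<forall>(\<epsilon>::real) (n::nat). \<epsilon> > 0 \<longrightarrow> n \<ge> 2 \<longrightarrow>
        measure (bernoulli_measure \<Omega> P \<Otimes>\<^sub>M \<mu>)
          {(\<omega>, x) \<in> space (bernoulli_measure \<Omega> P \<Otimes>\<^sub>M \<mu>).
             \<bar>\<Sum>j=1..n. \<phi> (random_iterate \<omega> j x)\<bar> \<ge> real n * \<epsilon>}
        \<le> C \<alpha> p (C1_norm \<phi>) * real n powr (1 - 1 / \<alpha>) * ln (real n) powr (1 / \<alpha>)
            * \<epsilon> powr (- 2 * p))"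
proof -
  \<comment> \<open>One constant is selected for each triple before the system and the observable
    are known; outside the admissible range of \<alpha> and p its value is arbitrary.\<close>
  define C where "C = (\<lambda>\<alpha> p N. SOME C. deviation_constant \<alpha> p N C)"
  have C: "deviation_constant \<alpha> p N (C \<alpha> p N)"
    if "0 < \<alpha>" "\<alpha> < 1" "p > max 1 (1 / \<alpha> - 1)" for \<alpha> p N :: real
    unfolding C_def using deviation_constant_exists[OF that] by (rule someI_ex)
  show ?thesis
  proof (intro exI[of _ C], intro allI impI, goal_cases)
    case (1 \<alpha> \<Omega> P \<mu> \<phi> p \<epsilon> n)
    then show ?case using C[of \<alpha> p "C1_norm \<phi>"] unfolding deviation_constant_def by blast
  qed
qed

end
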